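(* Let $n\ge0$ be an integer. If $E$ is an infinite-dimensional Banach space satisfying any of the following conditions, then $\mathrm{Lip}_0(E)$ is not a Grothendieck space: (1) $E=C_0(Y)^{*(n)}$ for some locally compact space $Y$; (2) $E=L_\infty(\Omega,\Sigma,\mu)^{*(n)}$ for some $\sigma$-finite measure space $(\Omega,\Sigma,\mu)$; (3) $E$ is a predual space of the space $C(K)$ for some compact space $K$; (4) $E=L_1(\Omega,\Sigma,\mu)$ for some $\sigma$-finite measure space $(\Omega,\Sigma,\mu)$; (5) $E=\mathcal{L}(Y,Z)$ for some infinite-dimensional normed space $Y$ and some Banach space $Z$ containing a copy of $c_0$; (6) $E=\mathrm{Bil}(Y\times W,Z)$ for some infinite-dimensional Banach spaces $Y$, $W$, and $Z$ such that $Z$ contains a copy of $c_0$; (7) $E=\mathrm{Lip}_0(M)^{*(n)}$ for some metric space $M$; (8) $E=\mathcal{F}(M)$ for some metric space $M$. In particular, if the infinite-dimensional Banach space $E$ is a $C(K)$-space ($K$ compact), an $L_1(\mu)$-space ($\mu$ $\sigma$-finite), a $\mathrm{Lip}_0(M)$-space, or an $\mathcal{F}(M)$-space ($M$ a metric space), then $\mathrm{Lip}_0(E)$ is not Grothendieck.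
   Context: All vector spaces are real and all topological spaces are Tychonoff (in particular Hausdorff). A Banach space $X$ is Grothendieck if every weak* convergent sequence in $X^*$ converges weakly. For a Banach space $E$: $E^{*(0)}=E$ and $E^{*(n+1)}=(E^{*(n)})^*$. A Banach space $E$ is a predual of a Banach space $F$ if $F$ is isometrically isomorphic to $E^*$. $C(K)$ is the Banach space of continuous real functions on a compact space $K$ and $C_0(Y)$ that of continuous real functions on a locally compact space $Y$ vanishing at infinity, both with the supremum norm. $\mathcal{L}(Y,Z)$ is the Banach space of all continuous linear operators from a normed space $Y$ into a Banach space $Z$; $\mathrm{Bil}(Y\times W,Z)$ is the Banach space of all continuous bilinear mappings $Y\times W\to Z$. A copy of $c_0$ means an isomorphic copy. For a metric space $(M,\rho)$ with a distinguished base point $e$ (in particular for a Banach space regarded as a metric space), $\mathrm{Lip}_0(M)$ is the Banach space of all Lipschitz functions $f\colon M\to\mathbb{R}$ with $f(e)=0$, with norm $\|f\|=\mathrm{Lip}(f)=\sup_{x\neq y}|f(x)-f(y)|/\rho(x,y)$. The Lipschitz-free space $\mathcal{F}(M)$ is the norm closure in $\mathrm{Lip}_0(M)^*$ of the linear span of the evaluation functionals $\delta_x\colon f\mapsto f(x)$, $x\in M$. *)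

theory Defs
  imports
    "HOL-Analysis.Analysis"
    "HOL-Probability.Essential_Supremum"
    "HOL-Library.Function_Algebras"
begin

instantiation "fun" :: (type, real_vector) real_vector
begin

definition scaleR_fun :: "real \<Rightarrow> ('a \<Rightarrow> 'b) \<Rightarrow> 'a \<Rightarrow> 'b"
  where "scaleR_fun c f = (\<lambda>x. c *\<^sub>R f x)"

instance
  by standard (simp_all add: scaleR_fun_def fun_eq_iff scaleR_add_right scaleR_add_left)

end

text \<open>
  A (semi)normed space is a linear subspace of an ambient real vector space together with a
  norm function that is only meaningful on that subspace.  Function spaces live in pointwise
  function types; functions defined on a proper subset of a type are extended by \<open>0\<close>.
  Banach spaces that do not have to be constructed are types of class \<open>banach\<close>,
  turned into the present format by \<open>whole\<close>.
\<close>

datatype 'v nspace = NSpace (pts: "'v set") (nrm: "'v \<Rightarrow> real")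

abbreviation whole :: "'v::real_normed_vector nspace"
  where "whole \<equiv> NSpace UNIV norm"

definition normed_space :: "'v::real_vector nspace \<Rightarrow> bool"
  where "normed_space X \<longleftrightarrow> subspace (pts X) \<and>
    (\<forall>x\<in>pts X. 0 \<le> nrm X x \<and> (nrm X x = 0 \<longleftrightarrow> x = 0)) \<and>
    (\<forall>x\<in>pts X. \<forall>c. nrm X (c *\<^sub>R x) = \<bar>c\<bar> * nrm X x) \<and>
    (\<forall>x\<in>pts X. \<forall>y\<in>pts X. nrm X (x + y) \<le> nrm X x + nrm X y)"

definition linear_between :: "'v::real_vector set \<Rightarrow> 'w::real_vector set \<Rightarrow> ('v \<Rightarrow> 'w) \<Rightarrow> bool"
  where "linear_between S S' T \<longleftrightarrow> T ` S \<subseteq> S' \<and>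
    (\<forall>x\<in>S. \<forall>y\<in>S. T (x + y) = T x + T y) \<and> (\<forall>x\<in>S. \<forall>c. T (c *\<^sub>R x) = c *\<^sub>R T x)"

definition infinite_dimensional :: "'v::real_vector itself \<Rightarrow> bool"
  where "infinite_dimensional _ \<longleftrightarrow> \<not> (\<exists>B :: 'v set. finite B \<and> span B = UNIV)"

text \<open>
  \<open>Y\<close> is always a normed space.  If \<open>X\<close> is normed as well, then \<open>T\<close> is automatically
  injective.  If \<open>X\<close> is only seminormed (the spaces \<open>L1_space\<close> and \<open>Linf_space\<close>
  below), then the kernel of \<open>T\<close> consists exactly of the vectors of seminorm \<open>0\<close>, and the
  definition says that the quotient of \<open>X\<close> by its null vectors is isometrically isomorphic
  to \<open>Y\<close>.
\<close>

definition isometrically_isomorphic :: "'v::real_vector nspace \<Rightarrow> 'w::real_vector nspace \<Rightarrow> bool"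
  where "isometrically_isomorphic X Y \<longleftrightarrow>
    (\<exists>T. linear_between (pts X) (pts Y) T \<and> T ` pts X = pts Y \<and>
         (\<forall>x\<in>pts X. nrm Y (T x) = nrm X x))"

definition contains_copy_of :: "'w::real_vector nspace \<Rightarrow> 'v::real_vector nspace \<Rightarrow> bool"
  where "contains_copy_of Y X \<longleftrightarrow>
    (\<exists>T a b. linear_between (pts X) (pts Y) T \<and> 0 < a \<and>
         (\<forall>x\<in>pts X. a * nrm X x \<le> nrm Y (T x) \<and> nrm Y (T x) \<le> b * nrm X x))"

text \<open>Inserting \<open>0\<close> makes the supremum of nonnegative reals \<open>0\<close> on an empty index set.\<close>

definition Sup0 :: "real set \<Rightarrow> real"
  where "Sup0 A = Sup (insert 0 A)"

definition dual_space :: "'v::real_vector nspace \<Rightarrow> ('v \<Rightarrow> real) nspace"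
  where "dual_space X = NSpace
    {\<phi>. linear_between (pts X) UNIV \<phi> \<and> (\<forall>x. x \<notin> pts X \<longrightarrow> \<phi> x = 0) \<and>
        (\<exists>C. \<forall>x\<in>pts X. \<bar>\<phi> x\<bar> \<le> C * nrm X x)}
    (\<lambda>\<phi>. Sup0 {\<bar>\<phi> x\<bar> | x. x \<in> pts X \<and> nrm X x \<le> 1})"

text \<open>
  \<open>E\<close> is (isometrically) the \<open>n\<close>-th iterated dual of \<open>X\<close>.  As the type of
  \<open>dual_space X\<close> differs from that of \<open>X\<close>, the successive duals are represented by isometric
  copies \<open>F 0, \<dots>, F n\<close> inside one ambient vector space \<open>'u\<close>.  Any \<open>n + 1\<close>
  spaces admit such copies for a suitable \<open>'u\<close>, for instance the product of their
  ambient spaces, so a statement that is polymorphic in \<open>'u\<close> covers all iterated duals.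
\<close>

definition iterated_dual ::
    "'u::real_vector itself \<Rightarrow> nat \<Rightarrow> 'v::real_vector nspace \<Rightarrow> 'e::real_vector nspace \<Rightarrow> bool"
  where "iterated_dual _ n X E \<longleftrightarrow>
    (\<exists>F :: nat \<Rightarrow> 'u nspace.
       (\<forall>i\<le>n. normed_space (F i)) \<and>
       isometrically_isomorphic X (F 0) \<and>
       (\<forall>i<n. isometrically_isomorphic (dual_space (F i)) (F (Suc i))) \<and>
       isometrically_isomorphic (F n) E)"

definition grothendieck :: "'v::real_vector nspace \<Rightarrow> bool"
  where "grothendieck X \<longleftrightarrow>
    (\<forall>\<phi> \<psi>. (\<forall>k::nat. \<phi> k \<in> pts (dual_space X)) \<and> \<psi> \<in> pts (dual_space X) \<and>
           (\<forall>x\<in>pts X. (\<lambda>k. \<phi> k x) \<longlonglongrightarrow> \<psi> x) \<longrightarrow>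
           (\<forall>\<Phi>\<in>pts (dual_space (dual_space X)). (\<lambda>k. \<Phi> (\<phi> k)) \<longlonglongrightarrow> \<Phi> \<psi>))"

definition sup_norm :: "'a set \<Rightarrow> ('a \<Rightarrow> real) \<Rightarrow> real"
  where "sup_norm S f = Sup0 ((\<lambda>x. \<bar>f x\<bar>) ` S)"

definition C_space :: "'a topology \<Rightarrow> ('a \<Rightarrow> real) nspace"
  where "C_space K = NSpace
    {f. continuous_map K euclideanreal f \<and> (\<forall>x. x \<notin> topspace K \<longrightarrow> f x = 0)}
    (sup_norm (topspace K))"

definition C0_space :: "'a topology \<Rightarrow> ('a \<Rightarrow> real) nspace"
  where "C0_space Y = NSpace
    {f. continuous_map Y euclideanreal f \<and> (\<forall>x. x \<notin> topspace Y \<longrightarrow> f x = 0) \<and>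
        (\<forall>\<epsilon>>0. compactin Y {x \<in> topspace Y. \<epsilon> \<le> \<bar>f x\<bar>})}
    (sup_norm (topspace Y))"

definition c0_space :: "(nat \<Rightarrow> real) nspace"
  where "c0_space = NSpace {x. x \<longlonglongrightarrow> 0} (sup_norm UNIV)"

text \<open>
  Seminormed: functions that agree almost everywhere on \<open>space M\<close> are not identified here.
\<close>

definition L1_space :: "'a measure \<Rightarrow> ('a \<Rightarrow> real) nspace"
  where "L1_space M = NSpace {f. integrable M f} (\<lambda>f. \<integral>x. \<bar>f x\<bar> \<partial>M)"

definition Linf_space :: "'a measure \<Rightarrow> ('a \<Rightarrow> real) nspace"
  where "Linf_space M = NSpace
    {f. f \<in> borel_measurable M \<and> esssup M (\<lambda>x. ereal \<bar>f x\<bar>) < \<infinity>}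
    (\<lambda>f. real_of_ereal (esssup M (\<lambda>x. ereal \<bar>f x\<bar>)))"

definition Bil_space ::
    "('y::real_normed_vector \<Rightarrow> 'w::real_normed_vector \<Rightarrow> 'z::real_normed_vector) nspace"
  where "Bil_space = NSpace {B. bounded_bilinear B}
    (\<lambda>B. Sup0 {norm (B y w) | y w. norm y \<le> 1 \<and> norm w \<le> 1})"

definition Lip0_space :: "'m metric \<Rightarrow> 'm \<Rightarrow> ('m \<Rightarrow> real) nspace"
  where "Lip0_space M e = NSpace
    {f. Lipschitz_continuous_map M euclidean_metric f \<and> f e = 0 \<and>
        (\<forall>x. x \<notin> mspace M \<longrightarrow> f x = 0)}
    (\<lambda>f. Sup0 {\<bar>f x - f y\<bar> / mdist M x y | x y. x \<in> mspace M \<and> y \<in> mspace M \<and> x \<noteq> y})"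

definition evaluation :: "'m metric \<Rightarrow> 'm \<Rightarrow> 'm \<Rightarrow> ('m \<Rightarrow> real) \<Rightarrow> real"
  where "evaluation M e x = (\<lambda>f. if f \<in> pts (Lip0_space M e) then f x else 0)"

definition lipschitz_free :: "'m metric \<Rightarrow> 'm \<Rightarrow> (('m \<Rightarrow> real) \<Rightarrow> real) nspace"
  where "lipschitz_free M e = (let D = dual_space (Lip0_space M e) in NSpace
    {\<phi> \<in> pts D. \<forall>\<epsilon>>0. \<exists>\<psi>\<in>span (evaluation M e ` mspace M). nrm D (\<phi> - \<psi>) < \<epsilon>}
    (nrm D))"

end

theory Submission
  imports Defs
begin

text \<open>
  All spaces \<open>E\<close> of the theorem contain the finite-dimensional spaces \<open>\<ell>\<^sub>1\<^sup>n\<close> uniformly, and this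
  alone makes \<open>Lip\<^sub>0(E)\<close> fail the Grothendieck property (\<open>not_grothendieck_Lip0\<close>).

  For the latter one needs functionals \<open>\<psi>\<^sub>r\<close> on Lipschitz functions with
  \<open>\<Sum>r. \<bar>\<psi>\<^sub>r f\<bar> \<le> C Lip(f)\<close> and a bounded sequence of functions \<open>g\<^sub>i\<close> in \<open>Lip\<^sub>0(E)\<close> that is biorthogonal
  to them (\<open>dual_systems_exist\<close>).  The tails \<open>\<phi>\<^sub>k = \<Sum>r\<ge>k. \<psi>\<^sub>r\<close> tend to \<open>0\<close> weak*, but not
  weakly, because \<open>\<phi>\<^sub>k g\<^sub>i = 1\<close> for \<open>i \<ge> k\<close>.

  Such systems come from copies of \<open>\<ell>\<^sub>\<infinity>\<^sup>m\<close> in the free space of \<open>\<ell>\<^sub>1\<close>.  Take a discrete torus with one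
  coordinate for each sign vector in \<open>{-1, 0, 1}\<^sup>m\<close> and with the sum metric.  A cycle embeds into the
  plane, so this torus embeds into \<open>\<ell>\<^sub>1\<close> of finite dimension and hence into \<open>E\<close>, with constants
  independent of \<open>m\<close> (\<open>torus_map\<close>).  It is mapped homomorphically onto the torus of dimension \<open>m\<close> such that
  every sign vector is the image of a generator; so the averages of a Lipschitz function over the
  fibres are Lipschitz for the maximum metric (\<open>quotient_avg_step\<close>).  Using a torus matters here, because the
  averages over its finite fibres are exactly invariant: on a lattice, the sum of the \<open>m\<close> coordinates
  that belong to unit vectors is a Lipschitz function with increment \<open>1\<close> in each of \<open>m\<close> directions.
  For the maximum metric no such function exists: increments in the \<open>m\<close> coordinate
  directions, averaged over a large box, have a bounded absolute sum (\<open>box_avg_signed_sum\<close>).  A generalized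
  limit over \<open>m\<close> turns these averaged increments into the functionals \<open>\<psi>\<^sub>r\<close>, and the coordinates of the
  quotient tori give the functions \<open>g\<^sub>i\<close>.

  It remains to find \<open>\<ell>\<^sub>1\<^sup>n\<close> in the spaces \<open>E\<close>.  An infinite-dimensional space \<open>C\<^sub>0(Y)\<close>, \<open>L\<^sub>\<infinity>(\<mu>)\<close> or
  \<open>Lip\<^sub>0(M)\<close> contains \<open>\<ell>\<^sub>\<infinity>\<^sup>n\<close> uniformly, spanned by functions that up to constants have disjoint supports, with a
  bounded biorthogonal system in the dual.  Then the space contains \<open>\<ell>\<^sub>1\<^sup>n\<close> by means of Rademacher vectors, its
  dual contains \<open>\<ell>\<^sub>1\<^sup>n\<close> by means of the biorthogonal functionals, and both pass to all further duals by
  taking biduals (\<open>iterated_dual_dichotomy\<close>).  For \<open>Lip\<^sub>0(M)\<close> the biorthogonal functionals can be found in \<open>\<F>(M)\<close>,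
  which settles the free spaces; the preduals of \<open>C(K)\<close> are settled by vectors that almost norm the
  images of disjoint bumps, \<open>L\<^sub>1(\<mu>)\<close> by normalised indicators of disjoint sets, and the operator and
  bilinear cases by embedding the range space.
\<close>

section \<open>Sublinear functionals and generalized limits\<close>

definition sublinear :: "('v::real_vector \<Rightarrow> real) \<Rightarrow> bool"
  where "sublinear p \<longleftrightarrow> (\<forall>x y. p (x + y) \<le> p x + p y) \<and> (\<forall>c x. 0 \<le> c \<longrightarrow> p (c *\<^sub>R x) \<le> c * p x)"

lemma sublinearD:
  assumes "sublinear p"
  shows "p (x + y) \<le> p x + p y" "0 \<le> c \<Longrightarrow> p (c *\<^sub>R x) \<le> c * p x"
  using assms by (simp_all add: sublinear_def)

lemma sublinear_zero: assumes "sublinear p" shows "p 0 = 0"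
  using sublinearD(1)[OF assms, of 0 0] sublinearD(2)[OF assms, of 0 0] by simp

lemma sublinear_lower: assumes "sublinear p" shows "- p (- x) \<le> p x"
  using sublinearD(1)[OF assms, of x "- x"] sublinear_zero[OF assms] by simp

text \<open>
  Infima of sublinear functionals are the only tool for building new ones below.  Stating the
  closure property for sets of upper bounds lets one lemma serve for infima over chains, for
  infima along a ray and for the upper limit of a bounded sequence.
\<close>

lemma sublinear_Inf:
  assumes ne: "\<And>x. S x \<noteq> {}" and bdd: "\<And>x. bdd_below (S x :: real set)"
    and add: "\<And>x y b c. b \<in> S x \<Longrightarrow> c \<in> S y \<Longrightarrow> \<exists>d\<in>S (x + y). d \<le> b + c"
    and scale: "\<And>x b c. b \<in> S x \<Longrightarrow> 0 \<le> c \<Longrightarrow> \<exists>d\<in>S (c *\<^sub>R x). d \<le> c * b"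
  shows "sublinear (\<lambda>x. Inf (S x))"
  unfolding sublinear_def
proof (intro conjI allI impI)
  fix x y
  have *: "Inf (S (x + y)) \<le> b + c" if "b \<in> S x" "c \<in> S y" for b c
    using add[OF that] cInf_lower[OF _ bdd] by (meson order_trans)
  have "Inf (S (x + y)) - b \<le> Inf (S y)" if "b \<in> S x" for b
    using *[OF that] by (intro cInf_greatest ne) (simp add: algebra_simps)
  then have "Inf (S (x + y)) - Inf (S y) \<le> Inf (S x)"
    by (intro cInf_greatest ne) (simp add: algebra_simps)
  then show "Inf (S (x + y)) \<le> Inf (S x) + Inf (S y)" by simp
next
  fix c :: real and x assume c: "0 \<le> c"
  have *: "Inf (S (c *\<^sub>R x)) \<le> c * b" if "b \<in> S x" for b
    using scale[OF that c] cInf_lower[OF _ bdd] by (meson order_trans)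
  show "Inf (S (c *\<^sub>R x)) \<le> c * Inf (S x)"
  proof (cases "c = 0")
    case True
    then show ?thesis using ne[of x] * by auto
  next
    case False
    with c have c: "0 < c" by simp
    have "Inf (S (c *\<^sub>R x)) / c \<le> Inf (S x)"
      using * c by (intro cInf_greatest ne) (simp add: pos_divide_le_eq mult.commute)
    then show ?thesis using c by (simp add: pos_divide_le_eq mult.commute)
  qed
qed

text \<open>
  Pushing a sublinear functional \<open>q\<close> down along a ray.  The new functional takes the value
  \<open>- q y\<close> at \<open>- y\<close>, so every linear functional below it takes the value \<open>q y\<close> at \<open>y\<close>.
\<close>

lemma sublinear_lowering:
  assumes q: "sublinear q"
  shows "\<exists>r. sublinear r \<and> (\<forall>t x. 0 \<le> t \<longrightarrow> r x \<le> q (x + t *\<^sub>R y) - t * q y)"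
proof -
  define S where "S x = (\<lambda>t. q (x + t *\<^sub>R y) - t * q y) ` {0..}" for x
  have bdd: "bdd_below (S x)" for x
    unfolding S_def
  proof (rule bdd_belowI2)
    fix t :: real assume t: "t \<in> {0..}"
    show "- q (- x) \<le> q (x + t *\<^sub>R y) - t * q y"
    proof (cases "t = 0")
      case True
      then show ?thesis using sublinear_lower[OF q, of x] by simp
    next
      case False
      with t have t: "0 < t" by simp
      have "q (t *\<^sub>R y) \<le> q (x + t *\<^sub>R y) + q (- x)"
        using sublinearD(1)[OF q, of "x + t *\<^sub>R y" "- x"] by simp
      moreover have "q ((1 / t) *\<^sub>R (t *\<^sub>R y)) \<le> (1 / t) * q (t *\<^sub>R y)"
        using t by (intro sublinearD(2)[OF q]) simp
      then have "t * q y \<le> q (t *\<^sub>R y)" using t by (simp add: field_simps)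
      ultimately show ?thesis by simp
    qed
  qed
  have "sublinear (\<lambda>x. Inf (S x))"
  proof (rule sublinear_Inf[OF _ bdd])
    fix x1 x2 b c assume "b \<in> S x1" "c \<in> S x2"
    then obtain s t where st: "0 \<le> s" "0 \<le> t"
      "b = q (x1 + s *\<^sub>R y) - s * q y" "c = q (x2 + t *\<^sub>R y) - t * q y" by (auto simp: S_def)
    have "x1 + x2 + (s + t) *\<^sub>R y = (x1 + s *\<^sub>R y) + (x2 + t *\<^sub>R y)" by (simp add: algebra_simps)
    then have "q (x1 + x2 + (s + t) *\<^sub>R y) - (s + t) * q y \<le> b + c"
      using sublinearD(1)[OF q, of "x1 + s *\<^sub>R y" "x2 + t *\<^sub>R y"] st by (simp add: algebra_simps)
    then show "\<exists>d\<in>S (x1 + x2). d \<le> b + c" using st unfolding S_def by (intro bexI imageI) auto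
  next
    fix x b and c :: real assume "b \<in> S x" and c: "0 \<le> c"
    then obtain t where t: "0 \<le> t" "b = q (x + t *\<^sub>R y) - t * q y" by (auto simp: S_def)
    have "c *\<^sub>R x + (c * t) *\<^sub>R y = c *\<^sub>R (x + t *\<^sub>R y)" by (simp add: algebra_simps)
    then have "q (c *\<^sub>R x + (c * t) *\<^sub>R y) - (c * t) * q y \<le> c * b"
      using sublinearD(2)[OF q c, of "x + t *\<^sub>R y"] by (simp add: t(2) right_diff_distrib)
    then show "\<exists>d\<in>S (c *\<^sub>R x). d \<le> c * b" using t c unfolding S_def by (intro bexI imageI) auto
  qed (auto simp: S_def)
  moreover have "Inf (S x) \<le> q (x + t *\<^sub>R y) - t * q y" if "0 \<le> t" for t x
    using that by (intro cInf_lower bdd) (auto simp: S_def)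
  ultimately show ?thesis by blast
qed

text \<open>
  The Hahn--Banach theorem in its most economical form: by Zorn's lemma there is a minimal
  sublinear functional below \<open>p\<close>, and minimality forces it to be linear, because lowering it
  along any ray must not change it.
\<close>

lemma dominated_linear_functional_exists:
  fixes p :: "'v::real_vector \<Rightarrow> real"
  assumes p: "sublinear p"
  shows "\<exists>f. linear f \<and> (\<forall>x. f x \<le> p x)"
proof -
  define A where "A = {q. sublinear q \<and> (\<forall>x. q x \<le> p x)}"
  define P where "P q r \<longleftrightarrow> (\<forall>x. r x \<le> q x)" for q r :: "'v \<Rightarrow> real"
  have "\<exists>m\<in>A. \<forall>a\<in>A. P m a \<longrightarrow> a = m"
  proof (rule predicate_Zorn)
    show "partial_order_on A (relation_of P A)"
      unfolding P_def
      by (intro partial_order_on_relation_ofI) (auto simp: fun_eq_iff intro: order_trans order_antisym)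
  next
    fix C assume "C \<in> Chains (relation_of P A)"
    then have CA: "C \<subseteq> A" and chain: "\<And>q r. q \<in> C \<Longrightarrow> r \<in> C \<Longrightarrow> P q r \<or> P r q"
      by (auto simp: Chains_def relation_of_def)
    show "\<exists>u\<in>A. \<forall>a\<in>C. P a u"
    proof (cases "C = {}")
      case True
      then show ?thesis using p by (auto simp: A_def)
    next
      case False
      define S where "S x = (\<lambda>q. q x) ` C" for x
      have C: "sublinear q" "q x \<le> p x" if "q \<in> C" for q x using CA that by (auto simp: A_def)
      have bdd: "bdd_below (S x)" for x
        unfolding S_def
      proof (rule bdd_belowI2)
        fix q assume "q \<in> C"
        then show "- p (- x) \<le> q x" using sublinear_lower[of q x] C(1) C(2)[of q "- x"] by simp
      qed
      have u_le: "Inf (S x) \<le> q x" if "q \<in> C" for q x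
        using that by (intro cInf_lower bdd) (auto simp: S_def)
      have "sublinear (\<lambda>x. Inf (S x))"
      proof (rule sublinear_Inf[OF _ bdd])
        fix x y b c assume "b \<in> S x" "c \<in> S y"
        then obtain q r where qr: "q \<in> C" "r \<in> C" "b = q x" "c = r y" by (auto simp: S_def)
        then have "q (x + y) \<le> b + c \<or> r (x + y) \<le> b + c"
          using chain[OF qr(1,2)] sublinearD(1)[OF C(1), of q x y] sublinearD(1)[OF C(1), of r x y]
          unfolding P_def by (smt (verit))
        then show "\<exists>d\<in>S (x + y). d \<le> b + c" using qr by (auto simp: S_def)
      qed (use False sublinearD(2)[OF C(1)] in \<open>auto simp: S_def\<close>)
      moreover have "Inf (S x) \<le> p x" for x using False u_le C(2) by (meson all_not_in_conv order_trans)
      ultimately show ?thesis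
        using u_le unfolding A_def P_def by (intro bexI[of _ "\<lambda>x. Inf (S x)"]) auto
    qed
  qed
  then obtain q where q: "sublinear q" "\<And>x. q x \<le> p x" and minimal: "\<And>r. r \<in> A \<Longrightarrow> P q r \<Longrightarrow> r = q"
    unfolding A_def by blast
  have super: "q x + q y \<le> q (x + y)" for x y
  proof -
    obtain r where r: "sublinear r" "\<And>t x. 0 \<le> t \<Longrightarrow> r x \<le> q (x + t *\<^sub>R y) - t * q y"
      using sublinear_lowering[OF q(1)] by blast
    have "r x \<le> q x" for x using r(2)[of 0 x] by simp
    then have "r = q" using minimal r(1) q(2) order_trans unfolding A_def P_def by blast
    then show ?thesis using r(2)[of 1 x] by simp
  qed
  have add: "q (x + y) = q x + q y" for x y
    using sublinearD(1)[OF q(1), of x y] super[of x y] by linarith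
  have neg: "q (- x) = - q x" for x
    using add[of x "- x"] sublinear_zero[OF q(1)] by simp
  have pos: "q (c *\<^sub>R x) = c * q x" if "0 \<le> c" for c x
    using sublinearD(2)[OF q(1) that, of x] sublinearD(2)[OF q(1) that, of "- x"] neg by simp
  have "q (c *\<^sub>R x) = c * q x" for c x
    using pos[of c x] pos[of "- c" x] neg[of "c *\<^sub>R x"] by (cases "0 \<le> c") auto
  then have "linear q" using add by (intro linearI) auto
  then show ?thesis using q(2) by blast
qed

lemma norming_functional_exists:
  fixes y :: "'v::real_normed_vector"
  shows "\<exists>f. bounded_linear f \<and> (\<forall>x. \<bar>f x\<bar> \<le> norm x) \<and> f y = norm y"
proof -
  have "sublinear (norm :: 'v \<Rightarrow> real)" by (simp add: sublinear_def norm_triangle_ineq)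
  then obtain r where r: "sublinear r" "\<And>t x. 0 \<le> t \<Longrightarrow> r x \<le> norm (x + t *\<^sub>R y) - t * norm y"
    using sublinear_lowering by blast
  obtain f where f: "linear f" "\<And>x. f x \<le> r x" using dominated_linear_functional_exists[OF r(1)] by blast
  have le: "f x \<le> norm x" for x using f(2)[of x] r(2)[of 0 x] by simp
  have abs: "\<bar>f x\<bar> \<le> norm x" for x
    using le[of x] le[of "- x"] linear_neg[OF f(1), of x] by simp
  have "f y = norm y"
    using f(2)[of "- y"] r(2)[of 1 "- y"] le[of y] linear_neg[OF f(1), of y] by simp
  moreover have "bounded_linear f"
    using f(1) abs by (auto simp: bounded_linear_def bounded_linear_axioms_def intro: exI[of _ 1])
  ultimately show ?thesis using abs by blast
qed

definition generalized_limit :: "((nat \<Rightarrow> real) \<Rightarrow> real) \<Rightarrow> bool"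
  where "generalized_limit \<Lambda> \<longleftrightarrow> linear \<Lambda> \<and>
    (\<forall>a b. Bseq a \<longrightarrow> (\<forall>\<^sub>F n in sequentially. a n \<le> b) \<longrightarrow> \<Lambda> a \<le> b)"

text \<open>
  The upper limit is sublinear on bounded sequences, and any linear functional below it will do.
  A projection onto the bounded sequences makes it a total linear functional, so that it can be
  applied without side conditions.
\<close>

lemma generalized_limit_exists: "\<exists>\<Lambda>. generalized_limit \<Lambda>"
proof -
  define V where "V = {a :: nat \<Rightarrow> real. Bseq a}"
  have "subspace V"
    unfolding subspace_def V_def
  proof (intro conjI ballI allI; clarsimp)
    show "Bseq (0 :: nat \<Rightarrow> real)" by (simp add: zero_fun_def)
    show "Bseq (x + y)" if xy: "Bseq x" "Bseq y" for x y :: "nat \<Rightarrow> real"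
    proof -
      obtain K where "\<forall>n. norm (x n) \<le> K" using xy(1) by (auto elim: BseqE)
      moreover obtain L where "\<forall>n. norm (y n) \<le> L" using xy(2) by (auto elim: BseqE)
      ultimately have "norm ((x + y) n) \<le> K + L" for n
        unfolding plus_fun_apply by (intro norm_triangle_le add_mono) auto
      then show ?thesis by (rule BseqI')
    qed
    show "Bseq (c *\<^sub>R x)" if "Bseq x" for c and x :: "nat \<Rightarrow> real"
      unfolding scaleR_fun_def using that by (cases "c = 0") (auto simp: Bseq_cmult_iff)
  qed
  then obtain \<pi> where \<pi>: "range \<pi> \<subseteq> V" "linear \<pi>" "\<And>v. v \<in> V \<Longrightarrow> \<pi> v = v"
    using linear_exists_left_inverse_on[of id V] linear_id by auto
  define S where "S a = {b. \<forall>\<^sub>F n in sequentially. \<pi> a n \<le> b}" for a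
  have Bs: "\<exists>K. \<forall>n. \<bar>\<pi> a n\<bar> \<le> K" for a
    using \<pi>(1) by (auto simp: V_def Bseq_def)
  have bdd: "bdd_below (S a)" for a
  proof -
    obtain K where K: "\<forall>n. \<bar>\<pi> a n\<bar> \<le> K" using Bs by blast
    have "- K \<le> b" if b: "b \<in> S a" for b
    proof -
      obtain n where "\<pi> a n \<le> b"
        using b eventually_happens'[OF sequentially_bot] unfolding S_def by blast
      then show ?thesis using K[rule_format, of n] by simp
    qed
    then show ?thesis by (meson bdd_belowI)
  qed
  have "sublinear (\<lambda>a. Inf (S a))"
  proof (rule sublinear_Inf[OF _ bdd])
    fix a
    obtain K where "\<forall>n. \<bar>\<pi> a n\<bar> \<le> K" using Bs by blast
    then have "K \<in> S a" by (auto simp: S_def abs_le_iff)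
    then show "S a \<noteq> {}" by blast
  next
    fix x y b c assume "b \<in> S x" "c \<in> S y"
    then have "\<forall>\<^sub>F n in sequentially. \<pi> x n \<le> b \<and> \<pi> y n \<le> c"
      unfolding S_def by (auto intro: eventually_conj)
    then have "b + c \<in> S (x + y)"
      unfolding S_def linear_add[OF \<pi>(2)] mem_Collect_eq plus_fun_apply
      by (rule eventually_mono) linarith
    then show "\<exists>d\<in>S (x + y). d \<le> b + c" by blast
  next
    fix x b and c :: real assume "b \<in> S x" and c: "0 \<le> c"
    then have "\<forall>\<^sub>F n in sequentially. \<pi> x n \<le> b" unfolding S_def by simp
    then have "c * b \<in> S (c *\<^sub>R x)"
      unfolding S_def linear_scale[OF \<pi>(2)] mem_Collect_eq
      by (rule eventually_mono) (simp add: scaleR_fun_def mult_left_mono c)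
    then show "\<exists>d\<in>S (c *\<^sub>R x). d \<le> c * b" by blast
  qed
  then obtain f where f: "linear f" "\<And>x. f x \<le> Inf (S x)"
    using dominated_linear_functional_exists by blast
  have "f a \<le> b" if "Bseq a" "\<forall>\<^sub>F n in sequentially. a n \<le> b" for a b
  proof -
    have "\<pi> a = a" using \<pi>(3) that(1) by (simp add: V_def)
    then have "b \<in> S a" using that(2) by (simp add: S_def)
    then show ?thesis using cInf_lower[OF _ bdd] f(2) order_trans by blast
  qed
  then show ?thesis using f(1) unfolding generalized_limit_def by blast
qed

lemma generalized_limit_le:
  "generalized_limit \<Lambda> \<Longrightarrow> Bseq a \<Longrightarrow> \<forall>\<^sub>F n in sequentially. a n \<le> b \<Longrightarrow> \<Lambda> a \<le> b"
  by (simp add: generalized_limit_def)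

lemma generalized_limit_abs_le:
  assumes \<Lambda>: "generalized_limit \<Lambda>" and a: "\<forall>\<^sub>F n in sequentially. \<bar>a n\<bar> \<le> b"
  shows "\<bar>\<Lambda> a\<bar> \<le> b"
proof -
  have B: "Bseq a" using a by (intro BfunI[of _ b]) simp
  have "\<Lambda> a \<le> b" "\<Lambda> (\<lambda>n. - a n) \<le> b"
    using a B by (auto intro!: generalized_limit_le[OF \<Lambda>] simp: Bseq_minus_iff elim!: eventually_mono)
  moreover have "\<Lambda> (\<lambda>n. - a n) = - \<Lambda> a"
    using \<Lambda> linear_neg[of \<Lambda> a] by (simp add: generalized_limit_def fun_Compl_def)
  ultimately show ?thesis by simp
qed

lemma generalized_limit_const:
  assumes \<Lambda>: "generalized_limit \<Lambda>" and a: "\<forall>\<^sub>F n in sequentially. a n = b"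
  shows "\<Lambda> a = b"
proof -
  have B: "Bseq a" using a by (intro BfunI[of _ "\<bar>b\<bar>"]) (auto elim!: eventually_mono)
  have "\<Lambda> a \<le> b" "\<Lambda> (\<lambda>n. - a n) \<le> - b"
    using a B by (auto intro!: generalized_limit_le[OF \<Lambda>] simp: Bseq_minus_iff elim!: eventually_mono)
  moreover have "\<Lambda> (\<lambda>n. - a n) = - \<Lambda> a"
    using \<Lambda> linear_neg[of \<Lambda> a] by (simp add: generalized_limit_def fun_Compl_def)
  ultimately show ?thesis by simp
qed

section \<open>Cycles in the plane\<close>

text \<open>
  \<open>tent l t\<close> is the distance from \<open>t\<close> to the nearest multiple of \<open>l\<close>, that is, the length of \<open>t\<close>
  in the cyclic group \<open>\<int>/l\<int>\<close> with its word metric.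
\<close>

definition tent :: "int \<Rightarrow> int \<Rightarrow> int"
  where "tent l t = min (t mod l) (l - t mod l)"

lemma tent_le_abs:
  assumes "0 < l" shows "tent l t \<le> \<bar>t - l * j\<bar>"
proof (cases "l * j \<le> t")
  case True
  have "t mod l = (t - l * j) mod l" by (simp add: mod_diff_eq[symmetric])
  also have "\<dots> \<le> t - l * j" using True assms by (simp add: zmod_le_nonneg_dividend)
  finally show ?thesis by (simp add: tent_def)
next
  case False
  have "(l * j - t) mod l = (- t) mod l" by (simp add: mod_diff_left_eq[symmetric])
  also have "l - t mod l \<le> (- t) mod l \<or> t mod l = 0"
    using assms by (auto simp: zmod_zminus1_eq_if)
  moreover have "(l * j - t) mod l \<le> l * j - t" using False assms by (simp add: zmod_le_nonneg_dividend)
  ultimately show ?thesis using False by (auto simp: tent_def)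
qed

lemma tent_eq_abs:
  assumes "0 < l" shows "\<exists>j. tent l t = \<bar>t - l * j\<bar>"
proof (cases "t mod l \<le> l - t mod l")
  case True
  then show ?thesis using assms
    by (intro exI[of _ "t div l"]) (simp add: tent_def minus_mult_div_eq_mod)
next
  case False
  have "t - l * (t div l + 1) = t mod l - l"
    by (simp add: minus_mult_div_eq_mod[symmetric] algebra_simps)
  moreover have "t mod l < l" using assms by simp
  ultimately show ?thesis using False
    by (intro exI[of _ "t div l + 1"]) (simp add: tent_def)
qed

lemma tent_nonneg: "0 < l \<Longrightarrow> 0 \<le> tent l t"
  using tent_eq_abs[of l t] by auto

lemma tent_triangle:
  assumes "0 < l" shows "tent l (s + t) \<le> tent l s + tent l t"
proof -
  obtain i j where "tent l s = \<bar>s - l * i\<bar>" "tent l t = \<bar>t - l * j\<bar>"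
    using tent_eq_abs[OF assms] by meson
  moreover have "tent l (s + t) \<le> \<bar>s + t - l * (i + j)\<bar>" by (rule tent_le_abs[OF assms])
  ultimately show ?thesis by (simp add: distrib_left)
qed

lemma tent_minus: assumes "0 < l" shows "tent l (- t) = tent l t"
proof -
  have "tent l (- t) \<le> tent l t" for t
  proof -
    obtain i where "tent l t = \<bar>t - l * i\<bar>" using tent_eq_abs[OF assms] by meson
    then show ?thesis using tent_le_abs[OF assms, of "- t" "- i"] by simp
  qed
  from this[of t] this[of "- t"] show ?thesis by simp
qed

lemma tent_diff: assumes "0 < l" shows "\<bar>tent l s - tent l t\<bar> \<le> tent l (s - t)"
  using tent_triangle[OF assms, of t "s - t"] tent_triangle[OF assms, of s "t - s"]
    tent_minus[OF assms, of "s - t"] by simp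

lemma tent_periodic: "tent l (t + l * j) = tent l t"
  by (simp add: tent_def)

lemma tent_zero: "0 < l \<Longrightarrow> tent l 0 = 0"
  by (simp add: tent_def)

lemma tent_eq: "0 \<le> t \<Longrightarrow> 2 * t \<le> l \<Longrightarrow> 0 < l \<Longrightarrow> tent l t = t"
  by (simp add: tent_def)

lemma tent_upper: "0 < l \<Longrightarrow> 2 * tent l t \<le> l"
  by (simp add: tent_def min_def)

lemma tent_sum:
  assumes "0 < l" shows "tent l (\<Sum>i\<in>A. f i) \<le> (\<Sum>i\<in>A. tent l (f i))"
proof (induction A rule: infinite_finite_induct)
  case (insert x F)
  then show ?case using tent_triangle[OF assms, of "f x" "sum f F"] by simp
qed (simp_all add: tent_zero assms)

text \<open>
  The cycle of length \<open>4r\<close> embeds into the plane with the \<open>\<ell>\<^sub>1\<close> norm by the two distances to \<open>0\<close> and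
  to \<open>-r\<close>: the former only confuses points that are symmetric about \<open>0\<close>, and these are told apart
  by the distance to a point a quarter turn away.
\<close>

lemma tent_embedding:
  assumes "0 < r"
  shows "tent (4 * r) (s - t) \<le> \<bar>tent (4 * r) s - tent (4 * r) t\<bar> + \<bar>tent (4 * r) (s + r) - tent (4 * r) (t + r)\<bar>"
proof -
  define a b where "a = s mod (4 * r)" and "b = t mod (4 * r)"
  have ab: "0 \<le> a" "a < 4 * r" "0 \<le> b" "b < 4 * r" using assms by (auto simp: a_def b_def)
  have "(s - t) mod (4 * r) = (a - b) mod (4 * r)" by (simp add: a_def b_def mod_diff_eq)
  also have "\<dots> = (if b \<le> a then a - b else a - b + 4 * r)"
    using ab mod_pos_pos_trivial[of "a - b + 4 * r" "4 * r"] by simp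
  finally have 1: "(s - t) mod (4 * r) = (if b \<le> a then a - b else a - b + 4 * r)" .
  have 2: "(u + r) mod (4 * r) = (if u mod (4 * r) < 3 * r then u mod (4 * r) + r else u mod (4 * r) - 3 * r)" for u
  proof -
    define c where "c = u mod (4 * r)"
    have c: "0 \<le> c" "c < 4 * r" using assms by (auto simp: c_def)
    have "(u + r) mod (4 * r) = (c + r) mod (4 * r)" by (simp add: c_def mod_add_left_eq)
    also have "\<dots> = (if c < 3 * r then c + r else c - 3 * r)"
      using c assms mod_pos_pos_trivial[of "c - 3 * r" "4 * r"] minus_mod_self2[of "c + r" "4 * r"] by auto
    finally show ?thesis by (simp add: c_def)
  qed
  show ?thesis
    unfolding tent_def 1 2 a_def[symmetric] b_def[symmetric] using ab by (auto simp: min_def abs_if)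
qed

section \<open>Averages over finite boxes in lattices\<close>

text \<open>
  Iterated one-dimensional averages replace both the average over a finite subgroup of a torus
  and the average over a large box.  The two uses share the estimate \<open>cesaros_shift_le\<close>: shifting by
  one of the directions changes the average only by the boundary term, which vanishes for
  periodic functions and is small for long averages of bounded functions.
\<close>

definition cesaro :: "nat \<Rightarrow> ('k \<Rightarrow> int) \<Rightarrow> (('k \<Rightarrow> int) \<Rightarrow> real) \<Rightarrow> ('k \<Rightarrow> int) \<Rightarrow> real"
  where "cesaro n h F x = (\<Sum>j<n. F (x + (\<lambda>k. int j * h k))) / real n"

primrec cesaros :: "nat \<Rightarrow> ('k \<Rightarrow> int) list \<Rightarrow> (('k \<Rightarrow> int) \<Rightarrow> real) \<Rightarrow> ('k \<Rightarrow> int) \<Rightarrow> real"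
  where
    "cesaros n [] F = F"
  | "cesaros n (h # hs) F = cesaro n h (cesaros n hs F)"

lemma cesaro_diff_le:
  assumes "0 < n" "\<And>z. \<bar>F (x + z) - G (y + z)\<bar> \<le> C"
  shows "\<bar>cesaro n h F x - cesaro n h G y\<bar> \<le> C"
proof -
  have "\<bar>\<Sum>j<n. F (x + (\<lambda>k. int j * h k)) - G (y + (\<lambda>k. int j * h k))\<bar> \<le> (\<Sum>j<n. C)"
    by (rule order_trans[OF sum_abs]) (intro sum_mono assms(2))
  then show ?thesis
    using assms(1) by (simp add: cesaro_def diff_divide_distrib[symmetric] sum_subtractf
        divide_le_eq mult.commute abs_divide)
qed

lemma cesaros_diff_le:
  assumes "0 < n" "\<And>z. \<bar>F (x + z) - G (y + z)\<bar> \<le> C"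
  shows "\<bar>cesaros n hs F x - cesaros n hs G y\<bar> \<le> C"
  using assms(2)
proof (induction hs arbitrary: x y)
  case Nil
  then show ?case using Nil[of 0] by simp
next
  case (Cons h hs)
  then have "\<bar>cesaros n hs F (x + z) - cesaros n hs G (y + z)\<bar> \<le> C" for z
    by (intro Cons.IH) (simp add: add.assoc)
  then show ?case by (simp add: cesaro_diff_le[OF assms(1)])
qed

lemma cesaro_add_scale:
  "cesaro n h (\<lambda>x. F x + c * G x) x = cesaro n h F x + c * cesaro n h G x"
  by (simp add: cesaro_def sum.distrib sum_distrib_left add_divide_distrib)

lemma cesaros_add_scale:
  "cesaros n hs (\<lambda>x. F x + c * G x) = (\<lambda>x. cesaros n hs F x + c * cesaros n hs G x)"
  by (induction hs) (simp_all add: cesaro_add_scale)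

lemma cesaros_translate:
  "0 < n \<Longrightarrow> cesaros n hs (\<lambda>x. F (x + a)) x = cesaros n hs F (x + a)"
  using cesaros_diff_le[of n "\<lambda>x. F (x + a)" x F "x + a" 0 hs] by (simp add: ac_simps)

lemma cesaros_diff:
  "0 < n \<Longrightarrow> cesaros n hs (\<lambda>x. F (x + a) - F x) x = cesaros n hs F (x + a) - cesaros n hs F x"
  using cesaros_add_scale[of n hs "\<lambda>x. F (x + a)" "-1" F] by (simp add: cesaros_translate)

lemma cesaros_shift_le:
  assumes n: "0 < n" and "h \<in> set hs"
    and "\<And>x h. h \<in> set hs \<Longrightarrow> \<bar>F (x + (\<lambda>k. int n * h k)) - F x\<bar> \<le> C"
  shows "\<bar>cesaros n hs F (x + h) - cesaros n hs F x\<bar> \<le> C / real n"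
  using assms(2-)
proof (induction hs arbitrary: x)
  case (Cons g hs)
  let ?G = "cesaros n hs F"
  show ?case
  proof (cases "h = g")
    case True
    have shift: "x + h + (\<lambda>k. int j * h k) = x + (\<lambda>k. int (Suc j) * h k)" for j
      by (simp add: fun_eq_iff algebra_simps)
    have "(\<Sum>j<n. ?G (x + (\<lambda>k. int (Suc j) * h k))) - (\<Sum>j<n. ?G (x + (\<lambda>k. int j * h k)))
        = ?G (x + (\<lambda>k. int n * h k)) - ?G (x + (\<lambda>k. int 0 * h k))"
      unfolding sum_subtractf[symmetric] by (rule sum_lessThan_telescope)
    also have "(x + (\<lambda>k. int 0 * h k)) = x" by (simp add: fun_eq_iff)
    finally have "cesaro n h ?G (x + h) - cesaro n h ?G x = (?G (x + (\<lambda>k. int n * h k)) - ?G x) / n"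
      unfolding cesaro_def shift diff_divide_distrib[symmetric] by (simp only:)
    moreover have "\<bar>?G (x + (\<lambda>k. int n * h k)) - ?G x\<bar> \<le> C"
    proof (rule cesaros_diff_le[OF n])
      fix z
      have "x + (\<lambda>k. int n * h k) + z = x + z + (\<lambda>k. int n * h k)" by (simp add: fun_eq_iff)
      then show "\<bar>F (x + (\<lambda>k. int n * h k) + z) - F (x + z)\<bar> \<le> C"
        using Cons.prems(2)[of h "x + z"] True by (metis list.set_intros(1))
    qed
    ultimately show ?thesis
      by (simp only: True cesaros.simps abs_divide abs_of_nat) (rule divide_right_mono, simp_all)
  next
    case False
    then have IH: "\<bar>?G (y + h) - ?G y\<bar> \<le> C / real n" for y
      using Cons.prems by (intro Cons.IH) auto
    have "\<bar>cesaro n g ?G (x + h) - cesaro n g ?G x\<bar> \<le> C / real n"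
    proof (rule cesaro_diff_le[OF n])
      fix z
      show "\<bar>?G (x + h + z) - ?G (x + z)\<bar> \<le> C / real n"
        using IH[of "x + z"] by (simp add: ac_simps)
    qed
    then show ?thesis by (simp only: cesaros.simps)
  qed
qed simp

section \<open>From a torus with the sum metric to a box with the maximum metric\<close>

text \<open>
  The coordinates of the torus are the sign vectors \<open>k \<in> {-1, 0, 1}\<^sup>m\<close>, and the homomorphism
  \<open>x \<mapsto> (\<Sum>k. k i * x k)\<^sub>i\<close> onto the \<open>m\<close>-dimensional torus sends the generator of coordinate \<open>k\<close> to \<open>k\<close>
  itself.  Since the generators on the left have length \<open>1\<close>, the quotient metric makes all sign
  vectors short: it is the maximum metric.  Averaging a Lipschitz function over the fibres of
  this homomorphism therefore gives a function that is Lipschitz for the maximum metric.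
\<close>

definition unit_vec :: "'i \<Rightarrow> 'i \<Rightarrow> int"
  where "unit_vec r = (\<lambda>i. if i = r then 1 else 0)"

definition sign_vecs :: "nat \<Rightarrow> (nat \<Rightarrow> int) set"
  where "sign_vecs m = {k. \<forall>i. (i \<in> {..<m} \<longrightarrow> k i \<in> {-1, 0, 1}) \<and> (i \<notin> {..<m} \<longrightarrow> k i = 0)}"

lemma finite_sign_vecs: "finite (sign_vecs m)"
  unfolding sign_vecs_def by (rule finite_set_of_finite_funs) auto

lemma unit_vec_in_sign_vecs: "r < m \<Longrightarrow> unit_vec r \<in> sign_vecs m"
  by (auto simp: sign_vecs_def unit_vec_def)

text \<open>A section of the homomorphism, using only the coordinates given by unit vectors.\<close>

definition lift_vec :: "nat \<Rightarrow> (nat \<Rightarrow> int) \<Rightarrow> (nat \<Rightarrow> int) \<Rightarrow> int"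
  where "lift_vec m y = (\<lambda>k. \<Sum>r<m. if k = unit_vec r then y r else 0)"

lemma lift_vec_add: "lift_vec m (y + z) = lift_vec m y + lift_vec m z"
  by (simp add: lift_vec_def fun_eq_iff sum.distrib[symmetric] if_distrib cong: if_cong)

definition kernel_dirs :: "nat \<Rightarrow> ((nat \<Rightarrow> int) \<Rightarrow> int) list"
  where "kernel_dirs m = map (\<lambda>k. unit_vec k - lift_vec m k) (SOME ks. set ks = sign_vecs m)"

lemma set_kernel_dirs: "set (kernel_dirs m) = (\<lambda>k. unit_vec k - lift_vec m k) ` sign_vecs m"
  unfolding kernel_dirs_def using someI_ex[OF finite_list[OF finite_sign_vecs[of m]]] by simp

text \<open>
  The kernel of the homomorphism is generated by the vectors \<open>unit_vec k - lift_vec m k\<close>, so the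
  first average below is the average over the fibre of \<open>y\<close> when the period is \<open>l\<close>.
\<close>

definition quotient_avg :: "nat \<Rightarrow> nat \<Rightarrow> (((nat \<Rightarrow> int) \<Rightarrow> int) \<Rightarrow> real) \<Rightarrow> (nat \<Rightarrow> int) \<Rightarrow> real"
  where "quotient_avg m l F y = cesaros l (kernel_dirs m) F (lift_vec m y)"

definition box_avg :: "nat \<Rightarrow> nat \<Rightarrow> nat \<Rightarrow> (((nat \<Rightarrow> int) \<Rightarrow> int) \<Rightarrow> real) \<Rightarrow> (nat \<Rightarrow> int) \<Rightarrow> real"
  where "box_avg m l n F = cesaros n (map unit_vec [0..<m]) (quotient_avg m l F)"

lemma box_avg_add_scale:
  "box_avg m l n (\<lambda>x. F x + c * G x) y = box_avg m l n F y + c * box_avg m l n G y"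
proof -
  have "quotient_avg m l (\<lambda>x. F x + c * G x) = (\<lambda>y. quotient_avg m l F y + c * quotient_avg m l G y)"
    by (simp add: quotient_avg_def fun_eq_iff cesaros_add_scale)
  then show ?thesis by (simp add: box_avg_def cesaros_add_scale)
qed

text \<open>
  After averaging, moving \<open>y\<close> by a sign vector \<open>k\<close> is the same as moving a point of the fibre by the
  single generator of coordinate \<open>k\<close>.
\<close>

lemma quotient_avg_step:
  assumes l: "0 < l" and k: "k \<in> sign_vecs m"
    and per: "\<And>x z. F (x + (\<lambda>k. int l * z k)) = F x"
    and step: "\<And>x k. k \<in> sign_vecs m \<Longrightarrow> \<bar>F (x + unit_vec k) - F x\<bar> \<le> C"
  shows "\<bar>quotient_avg m l F (y + k) - quotient_avg m l F y\<bar> \<le> C"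
proof -
  let ?F = "cesaros l (kernel_dirs m) F" and ?h = "unit_vec k - lift_vec m k"
  have "\<bar>?F (lift_vec m (y + k) + ?h) - ?F (lift_vec m (y + k))\<bar> \<le> 0 / real l"
    by (rule cesaros_shift_le[OF l]) (use k in \<open>auto simp: set_kernel_dirs per\<close>)
  moreover have "lift_vec m (y + k) + ?h = lift_vec m y + unit_vec k"
    by (simp add: lift_vec_add)
  moreover have "\<bar>?F (lift_vec m y + unit_vec k) - ?F (lift_vec m y)\<bar> \<le> C"
  proof (rule cesaros_diff_le[OF l])
    fix z show "\<bar>F (lift_vec m y + unit_vec k + z) - F (lift_vec m y + z)\<bar> \<le> C"
      using step[OF k, of "lift_vec m y + z"] by (simp add: ac_simps)
  qed
  ultimately show ?thesis by (simp add: quotient_avg_def)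
qed

text \<open>
  Averaging over a large box makes the increments of a function almost independent of the base
  point, hence almost additive.  The signed sum of the increments in the coordinate directions is
  thus almost the increment in the direction of one sign vector, which is at most \<open>C\<close>.  The proof
  walks from \<open>0\<close> to the sign vector \<open>\<epsilon>\<close>, through the vectors \<open>a s\<close> that agree with \<open>\<epsilon>\<close> on the first
  \<open>s\<close> coordinates.
\<close>

lemma box_avg_signed_sum:
  assumes l: "0 < l" and n: "0 < n" and M: "M \<le> m"
    and per: "\<And>x z. F (x + (\<lambda>k. int l * z k)) = F x"
    and step: "\<And>x k. k \<in> sign_vecs m \<Longrightarrow> \<bar>F (x + unit_vec k) - F x\<bar> \<le> C"
    and \<epsilon>: "\<And>i. \<epsilon> i \<in> {-1, 0, 1 :: int}"
  shows "(\<Sum>r<M. \<epsilon> r * (box_avg m l n F (unit_vec r) - box_avg m l n F 0))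
      \<le> C + 2 * C * real M * real M / real n"
proof -
  let ?f = "quotient_avg m l F" and ?g = "box_avg m l n F"
  let ?A = "cesaros n (map unit_vec [0..<m]) :: ((nat \<Rightarrow> int) \<Rightarrow> real) \<Rightarrow> (nat \<Rightarrow> int) \<Rightarrow> real"
  have f_step: "\<bar>?f (y + k) - ?f y\<bar> \<le> C" if "k \<in> sign_vecs m" for y k
    using l that per step by (rule quotient_avg_step)
  have C: "0 \<le> C" using f_step[of 0 0] by (auto simp: sign_vecs_def)
  define a where "a s = (\<lambda>i. if i < s then \<epsilon> i else 0)" for s :: nat
  have a_Suc: "a (Suc s) = a s + (\<lambda>i. \<epsilon> s * unit_vec s i)" for s
    by (auto simp: a_def unit_vec_def fun_eq_iff less_Suc_eq)
  define D where "D s y = ?f (y + unit_vec s) - ?f y" for s y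
  have D: "?A (D s) y = ?g (y + unit_vec s) - ?g y" for s y
    unfolding D_def box_avg_def by (rule cesaros_diff[OF n])
  have D_le: "\<bar>D s y\<bar> \<le> C" if "s < m" for s y
    unfolding D_def by (rule f_step[OF unit_vec_in_sign_vecs[OF that]])
  have D_shift: "\<bar>?A (D s) (y + unit_vec t) - ?A (D s) y\<bar> \<le> 2 * C / n" if "s < m" "t < m" for s t y
  proof (rule cesaros_shift_le[OF n])
    show "\<bar>D s (x + (\<lambda>k. int n * h k)) - D s x\<bar> \<le> 2 * C" for x h
      using D_le[OF that(1), of "x + (\<lambda>k. int n * h k)"] D_le[OF that(1), of x] by linarith
  qed (use that in auto)
  have D_step: "\<bar>?A (D s) (a (Suc t)) - ?A (D s) (a t)\<bar> \<le> 2 * C / n" if st: "s < m" "t < m" for s t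
  proof -
    consider "\<epsilon> t = 1" | "\<epsilon> t = 0" | "\<epsilon> t = -1" using \<epsilon> by auto
    then show ?thesis
    proof cases
      case 1
      then show ?thesis using D_shift[OF st, of "a t"] by (simp add: a_Suc)
    next
      case 2
      moreover have "a t + (\<lambda>i. 0) = a t" by (simp add: fun_eq_iff)
      ultimately show ?thesis using C by (simp add: a_Suc)
    next
      case 3
      have "a t = a (Suc t) + unit_vec t" using 3 by (simp add: a_Suc fun_eq_iff)
      then show ?thesis using D_shift[OF st, of "a (Suc t)"] by (simp add: abs_minus_commute)
    qed
  qed
  have D_a: "\<bar>?A (D s) (a t) - ?A (D s) 0\<bar> \<le> 2 * C * t / n" if "s < m" "t \<le> m" for s t
    using that(2)
  proof (induction t)
    case 0
    have "a 0 = 0" by (simp add: a_def fun_eq_iff)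
    then show ?case by simp
  next
    case (Suc t)
    then have "\<bar>?A (D s) (a t) - ?A (D s) 0\<bar> \<le> 2 * C * t / n" by (intro Suc.IH) simp
    moreover have "\<bar>?A (D s) (a (Suc t)) - ?A (D s) (a t)\<bar> \<le> 2 * C / n"
      using D_step[OF that(1), of t] Suc by simp
    moreover have "2 * C * real (Suc t) / n = 2 * C * t / n + 2 * C / n"
      by (simp add: add_divide_distrib[symmetric] algebra_simps)
    ultimately show ?case by linarith
  qed
  have summand: "\<epsilon> s * (?g (unit_vec s) - ?g 0) \<le> ?g (a (Suc s)) - ?g (a s) + 2 * C * M / n"
    if s: "s < M" for s
  proof -
    have D0: "?A (D s) 0 = ?g (unit_vec s) - ?g 0" using D[of s 0] by simp
    have mono: "2 * C * t / n \<le> 2 * C * M / n" if "t \<le> M" for t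
      using that C by (intro divide_right_mono mult_left_mono) auto
    have near: "\<bar>?A (D s) (a t) - ?A (D s) 0\<bar> \<le> 2 * C * M / n" if "t \<le> M" for t
      using D_a[of s t] mono[OF that] s that M by linarith
    consider "\<epsilon> s = 1" | "\<epsilon> s = 0" | "\<epsilon> s = -1" using \<epsilon> by auto
    then show ?thesis
    proof cases
      case 1
      have "a (Suc s) = a s + unit_vec s" using 1 by (simp add: a_Suc)
      then show ?thesis using near[of s] D[of s "a s"] D0 1 s by (simp add: abs_le_iff)
    next
      case 2
      moreover have "a s + (\<lambda>i. 0) = a s" by (simp add: fun_eq_iff)
      ultimately show ?thesis using C by (simp add: a_Suc)
    next
      case 3
      have "a s = a (Suc s) + unit_vec s" using 3 by (simp add: a_Suc fun_eq_iff)
      then have "?A (D s) (a (Suc s)) = ?g (a s) - ?g (a (Suc s))" using D[of s "a (Suc s)"] by simp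
      then show ?thesis using near[of "Suc s"] D0 3 s by (simp add: abs_le_iff)
    qed
  qed
  have "(\<Sum>s<M. \<epsilon> s * (?g (unit_vec s) - ?g 0)) \<le> (\<Sum>s<M. (?g (a (Suc s)) - ?g (a s)) + 2 * C * M / n)"
    by (intro sum_mono summand) simp
  also have "\<dots> = ?g (a M) - ?g (a 0) + M * (2 * C * M / n)"
    by (simp add: sum.distrib sum_lessThan_telescope[of "\<lambda>s. ?g (a s)"])
  also have "?g (a M) - ?g (a 0) \<le> C"
  proof -
    have a0: "a 0 = 0" by (simp add: a_def fun_eq_iff)
    have "a M \<in> sign_vecs m" using \<epsilon> M by (auto simp: sign_vecs_def a_def)
    then have "\<bar>?f (a M + z) - ?f (0 + z)\<bar> \<le> C" for z using f_step[of "a M" z] by (simp add: ac_simps)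
    then have "\<bar>?g (a M) - ?g 0\<bar> \<le> C" unfolding box_avg_def by (rule cesaros_diff_le[OF n])
    then show ?thesis by (simp add: a0)
  qed
  finally show ?thesis by (simp add: ac_simps)
qed

lemma cesaros_invariant:
  assumes n: "0 < n" and "\<And>x h. h \<in> set hs \<Longrightarrow> F (x + h) = F x"
  shows "cesaros n hs F = F"
  using assms(2)
proof (induction hs)
  case (Cons h hs)
  have *: "F (x + (\<lambda>k. int j * h k)) = F x" for j x
  proof (induction j)
    case 0
    have "x + (\<lambda>k. int 0 * h k) = x" by (simp add: fun_eq_iff)
    then show ?case by (simp only:)
  next
    case (Suc j)
    have "x + (\<lambda>k. int (Suc j) * h k) = x + (\<lambda>k. int j * h k) + h"
      by (simp add: fun_eq_iff algebra_simps)
    then show ?case using Suc Cons.prems[of h "x + (\<lambda>k. int j * h k)"]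
      by (metis list.set_intros(1))
  qed
  have "cesaros n hs F = F" using Cons by simp
  then have "cesaros n (h # hs) F = cesaro n h F" by (simp only: cesaros.simps)
  also have "cesaro n h F x = F x" for x
    unfolding cesaro_def * using n by simp
  then have "cesaro n h F = F" by blast
  finally show ?case .
qed simp

lemma cesaros_coordinate:
  assumes n: "0 < n" and "distinct rs"
  shows "cesaros n (map unit_vec rs) (\<lambda>y. t (y i)) y
    = (if i \<in> set rs then (\<Sum>j<n. t (y i + int j)) / n else t (y i))"
  using assms(2)
proof (induction rs arbitrary: y)
  case (Cons r rs)
  have IH: "cesaros n (map unit_vec rs) (\<lambda>y. t (y i)) y
      = (if i \<in> set rs then (\<Sum>j<n. t (y i + int j)) / n else t (y i))" for y
    using Cons by simp
  have "cesaros n (map unit_vec (r # rs)) (\<lambda>y. t (y i)) y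
      = cesaro n (unit_vec r) (cesaros n (map unit_vec rs) (\<lambda>y. t (y i))) y"
    by (simp only: list.map cesaros.simps)
  also have "\<dots> = (\<Sum>j<n. if i \<in> set rs then (\<Sum>j<n. t (y i + int j)) / n
      else t (y i + int j * unit_vec r i)) / n"
    unfolding cesaro_def IH using Cons.prems
    by (intro arg_cong2[where f = "(/)"] sum.cong refl) (auto simp: unit_vec_def)
  also have "\<dots> = (if i \<in> set (r # rs) then (\<Sum>j<n. t (y i + int j)) / n else t (y i))"
    using n Cons by (auto simp: unit_vec_def)
  finally show ?case .
qed simp

lemma sum_lift_vec:
  assumes "i < m"
  shows "(\<Sum>k\<in>sign_vecs m. k i * lift_vec m y k) = y i"
proof -
  have "(\<Sum>k\<in>sign_vecs m. k i * lift_vec m y k)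
      = (\<Sum>k\<in>sign_vecs m. \<Sum>r<m. if k = unit_vec r then k i * y r else 0)"
    by (simp add: lift_vec_def sum_distrib_left if_distrib cong: if_cong)
  also have "\<dots> = (\<Sum>r<m. \<Sum>k\<in>sign_vecs m. if k = unit_vec r then k i * y r else 0)"
    by (rule sum.swap)
  also have "\<dots> = (\<Sum>r<m. unit_vec r i * y r)"
    by (intro sum.cong refl) (simp add: finite_sign_vecs unit_vec_in_sign_vecs)
  also have "\<dots> = (\<Sum>r<m. if r = i then y r else 0)"
    by (intro sum.cong refl) (auto simp: unit_vec_def)
  also have "\<dots> = y i" using assms by simp
  finally show ?thesis .
qed

lemma sum_unit_vec:
  assumes "k \<in> sign_vecs m"
  shows "(\<Sum>k'\<in>sign_vecs m. k' i * unit_vec k k') = k i"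
proof -
  have "(\<Sum>k'\<in>sign_vecs m. k' i * unit_vec k k') = (\<Sum>k'\<in>sign_vecs m. if k' = k then k' i else 0)"
    by (intro sum.cong refl) (auto simp: unit_vec_def)
  also have "\<dots> = k i" using assms by (simp add: finite_sign_vecs)
  finally show ?thesis .
qed

text \<open>
  The coordinate functions of the quotient survive both averages: they are constant on the fibres,
  and on the box \<open>{0..n}\<close> the tent function of period \<open>4n\<close> has slope \<open>1\<close>.
\<close>

lemma box_avg_coordinate:
  assumes n: "0 < n" and i: "i < m"
  defines "F \<equiv> \<lambda>x. real_of_int (tent (4 * int n) (\<Sum>k\<in>sign_vecs m. k i * x k))"
  shows "box_avg m (4 * n) n F (unit_vec j) - box_avg m (4 * n) n F 0 = (if j = i then 1 else 0)"
proof -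
  let ?t = "\<lambda>s. real_of_int (tent (4 * int n) s)"
  have "cesaros (4 * n) (kernel_dirs m) F = F"
  proof (rule cesaros_invariant)
    fix x h assume "h \<in> set (kernel_dirs m)"
    then obtain k where k: "k \<in> sign_vecs m" "h = unit_vec k - lift_vec m k"
      by (auto simp: set_kernel_dirs)
    have "(\<Sum>k'\<in>sign_vecs m. k' i * (x + h) k') = (\<Sum>k'\<in>sign_vecs m. k' i * x k')
        + ((\<Sum>k'\<in>sign_vecs m. k' i * unit_vec k k') - (\<Sum>k'\<in>sign_vecs m. k' i * lift_vec m k k'))"
      by (simp add: k sum.distrib sum_subtractf algebra_simps)
    also have "\<dots> = (\<Sum>k'\<in>sign_vecs m. k' i * x k')"
      using sum_unit_vec[OF k(1)] sum_lift_vec[OF i] by simp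
    finally show "F (x + h) = F x" by (simp only: F_def)
  qed (use n in simp)
  then have "quotient_avg m (4 * n) F = (\<lambda>y. ?t (y i))"
    unfolding quotient_avg_def by (simp only: F_def sum_lift_vec[OF i])
  then have g: "box_avg m (4 * n) n F y = (\<Sum>j<n. ?t (y i + int j)) / n" for y
    unfolding box_avg_def using cesaros_coordinate[OF n, of "[0..<m]" ?t i y] i by simp
  show ?thesis
  proof (cases "j = i")
    case True
    have "(\<Sum>j<n. ?t (int (Suc j))) - (\<Sum>j<n. ?t (int j)) = ?t (int n) - ?t (int 0)"
      unfolding sum_subtractf[symmetric] by (rule sum_lessThan_telescope)
    also have "\<dots> = n" using n by (simp add: tent_eq)
    finally show ?thesis using True n
      unfolding g by (simp add: unit_vec_def diff_divide_distrib[symmetric])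
  next
    case False
    then show ?thesis unfolding g by (simp add: unit_vec_def)
  qed
qed

text \<open>McShane's extension, for a function given on the range of an indexed family of points.\<close>

lemma lipschitz_extension_exists:
  fixes P :: "'i \<Rightarrow> 'e::metric_space" and w :: "'i \<Rightarrow> real"
  assumes w: "\<And>a b. \<bar>w a - w b\<bar> \<le> C * dist (P a) (P b)" and C: "0 \<le> C"
  shows "\<exists>F. (\<forall>x y. \<bar>F x - F y\<bar> \<le> C * dist x y) \<and> (\<forall>a. F (P a) = w a)"
proof -
  define F where "F x = (INF a. w a + C * dist (P a) x)" for x
  have bdd: "bdd_below (range (\<lambda>a. w a + C * dist (P a) x))" for x
  proof (rule bdd_belowI2)
    fix a
    let ?b = undefined
    have "C * dist (P ?b) (P a) \<le> C * (dist (P ?b) x + dist (P a) x)"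
      by (intro mult_left_mono C dist_triangle2)
    then show "w ?b - C * dist (P ?b) x \<le> w a + C * dist (P a) x"
      using w[of ?b a] by (simp add: algebra_simps)
  qed
  have F_le: "F x \<le> w a + C * dist (P a) x" for a x
    unfolding F_def using bdd by (intro cINF_lower) auto
  have F_ge: "b \<le> F x" if "\<And>a. b \<le> w a + C * dist (P a) x" for b x
    unfolding F_def using that by (intro cINF_greatest) auto
  have le: "F x \<le> F y + C * dist x y" for x y
  proof -
    have "F x - C * dist x y \<le> F y"
    proof (rule F_ge)
      fix a
      have "C * dist (P a) x \<le> C * (dist (P a) y + dist x y)"
        by (intro mult_left_mono C dist_triangle2)
      then show "F x - C * dist x y \<le> w a + C * dist (P a) y"
        using F_le[of x a] by (simp add: algebra_simps)
    qed
    then show ?thesis by simp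
  qed
  have "F (P a) = w a" for a
  proof (rule antisym)
    show "F (P a) \<le> w a" using F_le[of "P a" a] by simp
    show "w a \<le> F (P a)"
    proof (rule F_ge)
      fix b show "w a \<le> w b + C * dist (P b) (P a)" using w[of a b] by (simp add: dist_commute)
    qed
  qed
  moreover have "\<bar>F x - F y\<bar> \<le> C * dist x y" for x y
    using le[of x y] le[of y x] by (simp add: dist_commute)
  ultimately show ?thesis by blast
qed

section \<open>Tori in normed spaces\<close>

text \<open>
  Each coordinate of the torus is a cycle of length \<open>4n\<close> and uses two vectors of the family \<open>u\<close>.  If
  \<open>u\<close> is equivalent to the unit vectors of \<open>\<ell>\<^sub>1\<close>, the map is bi-Lipschitz with constants that do not depend
  on the dimension.
\<close>

definition torus_map :: "nat \<Rightarrow> nat \<Rightarrow> ((nat \<Rightarrow> int) \<times> bool \<Rightarrow> 'e::real_vector) \<Rightarrow> ((nat \<Rightarrow> int) \<Rightarrow> int) \<Rightarrow> 'e"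
  where "torus_map m n u x = (\<Sum>k\<in>sign_vecs m.
    real_of_int (tent (4 * int n) (x k)) *\<^sub>R u (k, False) +
    real_of_int (tent (4 * int n) (x k + int n)) *\<^sub>R u (k, True))"

lemma torus_map_periodic:
  "torus_map m n u (x + (\<lambda>k. int (4 * n) * z k)) = torus_map m n u x"
proof -
  have "tent (4 * int n) (x k + 4 * int n * z k) = tent (4 * int n) (x k)"
    "tent (4 * int n) (x k + 4 * int n * z k + int n) = tent (4 * int n) (x k + int n)" for k
    using tent_periodic[of "4 * int n" "x k" "z k"] tent_periodic[of "4 * int n" "x k + int n" "z k"]
    by (simp_all add: ac_simps)
  then show ?thesis by (simp add: torus_map_def)
qed

lemma sum_times_bool:
  "finite A \<Longrightarrow> (\<Sum>a\<in>A \<times> UNIV. f a) = (\<Sum>k\<in>A. f (k, False) + f (k, True))"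
  for f :: "'a \<times> bool \<Rightarrow> 'b::comm_monoid_add"
  by (subst sum.Sigma[symmetric, where g = "\<lambda>k b. f (k, b)", unfolded split_def prod.collapse])
    (simp_all add: UNIV_bool add.commute)

lemma torus_map_diff:
  fixes u :: "(nat \<Rightarrow> int) \<times> bool \<Rightarrow> 'e::real_vector"
  defines "c \<equiv> \<lambda>n x y (k, b). real_of_int (if b then tent (4 * int n) (x k + int n) - tent (4 * int n) (y k + int n)
    else tent (4 * int n) (x k) - tent (4 * int n) (y k))"
  shows "torus_map m n u x - torus_map m n u y
    = (\<Sum>a\<in>sign_vecs m \<times> UNIV. c n x y a *\<^sub>R u a)"
proof -
  have "(\<Sum>a\<in>sign_vecs m \<times> UNIV. c n x y a *\<^sub>R u a)
      = (\<Sum>k\<in>sign_vecs m. c n x y (k, False) *\<^sub>R u (k, False) + c n x y (k, True) *\<^sub>R u (k, True))"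
    by (rule sum_times_bool[OF finite_sign_vecs])
  also have "\<dots> = torus_map m n u x - torus_map m n u y"
    unfolding torus_map_def sum_subtractf[symmetric]
    by (intro sum.cong refl) (simp add: c_def algebra_simps)
  finally show ?thesis ..
qed

context
  fixes m n :: nat and u :: "(nat \<Rightarrow> int) \<times> bool \<Rightarrow> 'e::real_normed_vector"
  assumes n: "0 < n" and u: "\<And>a. a \<in> sign_vecs m \<times> UNIV \<Longrightarrow> norm (u a) \<le> 1"
begin

lemma torus_map_step: "k \<in> sign_vecs m \<Longrightarrow> norm (torus_map m n u (x + unit_vec k) - torus_map m n u x) \<le> 2"
proof -
  assume k: "k \<in> sign_vecs m"
  let ?t = "\<lambda>s. real_of_int (tent (4 * int n) s)"
  have l: "0 < 4 * int n" using n by simp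
  have one: "\<bar>?t (s + 1) - ?t s\<bar> \<le> 1" for s
    using tent_diff[OF l, of "s + 1" s] tent_eq[of 1 "4 * int n"] n by simp
  have "torus_map m n u (x + unit_vec k) - torus_map m n u x = (\<Sum>k'\<in>sign_vecs m.
      (?t (x k' + unit_vec k k') - ?t (x k')) *\<^sub>R u (k', False) +
      (?t (x k' + unit_vec k k' + int n) - ?t (x k' + int n)) *\<^sub>R u (k', True))"
    unfolding torus_map_def sum_subtractf[symmetric]
    by (intro sum.cong refl) (simp add: algebra_simps)
  also have "\<dots> = (\<Sum>k'\<in>sign_vecs m. if k' = k then
      (?t (x k + 1) - ?t (x k)) *\<^sub>R u (k, False) +
      (?t (x k + int n + 1) - ?t (x k + int n)) *\<^sub>R u (k, True) else 0)"
    by (intro sum.cong refl) (simp add: unit_vec_def ac_simps)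
  also have "\<dots> = (?t (x k + 1) - ?t (x k)) *\<^sub>R u (k, False) +
      (?t (x k + int n + 1) - ?t (x k + int n)) *\<^sub>R u (k, True)"
    using k by (simp add: finite_sign_vecs)
  also have "norm \<dots> \<le> \<bar>?t (x k + 1) - ?t (x k)\<bar> * norm (u (k, False)) +
      \<bar>?t (x k + int n + 1) - ?t (x k + int n)\<bar> * norm (u (k, True))"
    by (rule order_trans[OF norm_triangle_ineq]) (simp only: norm_scaleR order_refl)
  also have "\<dots> \<le> 1 * 1 + 1 * 1"
    by (intro add_mono mult_mono one u) (use k in auto)
  finally show ?thesis by simp
qed

lemma torus_map_bounded:
  "norm (torus_map m n u x) \<le> real (card (sign_vecs m)) * (4 * real n)"
proof -
  let ?t = "\<lambda>s. real_of_int (tent (4 * int n) s)"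
  have l: "0 < 4 * int n" using n by simp
  have t: "\<bar>?t s\<bar> \<le> 2 * real n" for s
    using tent_nonneg[OF l, of s] tent_upper[OF l, of s] by simp
  have "norm (torus_map m n u x) \<le> (\<Sum>k\<in>sign_vecs m. 4 * real n)"
    unfolding torus_map_def
  proof (rule sum_norm_le)
    fix k assume k: "k \<in> sign_vecs m"
    have "norm (?t (x k) *\<^sub>R u (k, False) + ?t (x k + int n) *\<^sub>R u (k, True))
        \<le> \<bar>?t (x k)\<bar> * norm (u (k, False)) + \<bar>?t (x k + int n)\<bar> * norm (u (k, True))"
      by (rule order_trans[OF norm_triangle_ineq]) (simp only: norm_scaleR order_refl)
    also have "\<dots> \<le> 2 * real n * 1 + 2 * real n * 1"
      by (intro add_mono mult_mono t u) (use k in auto)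
    finally show "norm (?t (x k) *\<^sub>R u (k, False) + ?t (x k + int n) *\<^sub>R u (k, True)) \<le> 4 * real n"
      by simp
  qed
  then show ?thesis by simp
qed

lemma torus_map_coordinate_lipschitz:
  assumes C: "\<And>c. (\<Sum>a\<in>sign_vecs m \<times> UNIV. \<bar>c a\<bar>) \<le> C * norm (\<Sum>a\<in>sign_vecs m \<times> UNIV. c a *\<^sub>R u a)"
    and i: "i < m"
  shows "\<bar>real_of_int (tent (4 * int n) (\<Sum>k\<in>sign_vecs m. k i * x k))
      - real_of_int (tent (4 * int n) (\<Sum>k\<in>sign_vecs m. k i * y k))\<bar>
    \<le> C * norm (torus_map m n u x - torus_map m n u y)"
proof -
  let ?t = "tent (4 * int n)"
  have l: "0 < 4 * int n" using n by simp
  have "\<bar>?t (\<Sum>k\<in>sign_vecs m. k i * x k) - ?t (\<Sum>k\<in>sign_vecs m. k i * y k)\<bar>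
      \<le> ?t (\<Sum>k\<in>sign_vecs m. k i * (x k - y k))"
    using tent_diff[OF l] by (simp add: right_diff_distrib sum_subtractf)
  also have "\<dots> \<le> (\<Sum>k\<in>sign_vecs m. ?t (k i * (x k - y k)))" by (rule tent_sum[OF l])
  also have "\<dots> \<le> (\<Sum>k\<in>sign_vecs m. ?t (x k - y k))"
  proof (rule sum_mono)
    fix k assume "k \<in> sign_vecs m"
    then have "k i \<in> {-1, 0, 1}" using i by (auto simp: sign_vecs_def)
    then show "?t (k i * (x k - y k)) \<le> ?t (x k - y k)"
      using tent_nonneg[OF l, of "x k - y k"] tent_minus[OF l, of "x k - y k"] tent_zero[OF l] by auto
  qed
  also have "\<dots> \<le> (\<Sum>k\<in>sign_vecs m. \<bar>?t (x k) - ?t (y k)\<bar> + \<bar>?t (x k + int n) - ?t (y k + int n)\<bar>)"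
    using n by (intro sum_mono tent_embedding) simp
  also have "real_of_int \<dots> = (\<Sum>a\<in>sign_vecs m \<times> UNIV. \<bar>case a of (k, b) \<Rightarrow> real_of_int
      (if b then ?t (x k + int n) - ?t (y k + int n) else ?t (x k) - ?t (y k))\<bar>)"
    by (simp add: sum_times_bool finite_sign_vecs)
  also have "\<dots> \<le> C * norm (torus_map m n u x - torus_map m n u y)"
    unfolding torus_map_diff by (rule C)
  finally show ?thesis by simp
qed

end

section \<open>Dual systems on spaces of Lipschitz functions\<close>

lemma sum_scaleR_apply: "(\<Sum>i\<in>A. c i *\<^sub>R g i) x = (\<Sum>i\<in>A. c i *\<^sub>R g i x)"
  for g :: "'i \<Rightarrow> 'a \<Rightarrow> 'b::real_vector"
  by (induction A rule: infinite_finite_induct) (simp_all add: scaleR_fun_def)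

definition l1_basis :: "'v::real_vector nspace \<Rightarrow> real \<Rightarrow> nat \<Rightarrow> (nat \<Rightarrow> 'v) \<Rightarrow> bool"
  where "l1_basis X C n e \<longleftrightarrow> (\<forall>i<n. e i \<in> pts X \<and> nrm X (e i) \<le> 1) \<and>
    (\<forall>c. (\<Sum>i<n. \<bar>c i\<bar>) \<le> C * nrm X (\<Sum>i<n. c i *\<^sub>R e i))"

definition uniformly_contains_l1 :: "'v::real_vector nspace \<Rightarrow> bool"
  where "uniformly_contains_l1 X \<longleftrightarrow> (\<exists>C>0. \<forall>n. \<exists>e. l1_basis X C n e)"

lemma l1_basis_reindex:
  fixes A :: "'a set" and e :: "nat \<Rightarrow> 'e::real_normed_vector"
  assumes A: "finite A" and e: "l1_basis whole C (card A) e"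
  shows "\<exists>u :: 'a \<Rightarrow> 'e. (\<forall>a\<in>A. norm (u a) \<le> 1) \<and>
    (\<forall>c. (\<Sum>a\<in>A. \<bar>c a\<bar>) \<le> C * norm (\<Sum>a\<in>A. c a *\<^sub>R u a))"
proof -
  obtain h where h: "bij_betw h A {..<card A}"
    using ex_bij_betw_finite_nat[OF A] by (auto simp: atLeast0LessThan)
  have inv: "inv_into A h (h a) = a" if "a \<in> A" for a
    using h that by (simp add: bij_betw_def)
  show ?thesis
  proof (intro exI[of _ "e \<circ> h"] conjI ballI allI)
    fix a assume "a \<in> A"
    then have "h a < card A" using h by (auto simp: bij_betw_def)
    then show "norm ((e \<circ> h) a) \<le> 1" using e by (simp add: l1_basis_def)
  next
    fix c :: "'a \<Rightarrow> real"
    let ?c = "\<lambda>i. c (inv_into A h i)"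
    have "(\<Sum>a\<in>A. \<bar>c a\<bar>) = (\<Sum>i<card A. \<bar>?c i\<bar>)"
      using sum.reindex_bij_betw[OF h, of "\<lambda>i. \<bar>?c i\<bar>"] inv by simp
    also have "\<dots> \<le> C * norm (\<Sum>i<card A. ?c i *\<^sub>R e i)"
      using e by (simp add: l1_basis_def)
    also have "(\<Sum>i<card A. ?c i *\<^sub>R e i) = (\<Sum>a\<in>A. c a *\<^sub>R (e \<circ> h) a)"
      using sum.reindex_bij_betw[OF h, of "\<lambda>i. ?c i *\<^sub>R e i"] inv by simp
    finally show "(\<Sum>a\<in>A. \<bar>c a\<bar>) \<le> C * norm (\<Sum>a\<in>A. c a *\<^sub>R (e \<circ> h) a)" .
  qed
qed

text \<open>
  The functionals \<open>\<psi>\<^sub>r\<close> arise from the increments of box averages in coordinate direction \<open>r\<close>, over tori of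
  growing dimension, by a generalized limit.  The bound on \<open>\<Sum>r. \<bar>\<psi>\<^sub>r f\<bar>\<close> is \<open>box_avg_signed_sum\<close>; the
  biorthogonal functions \<open>g\<^sub>i\<close> are the coordinate functions of the quotient tori.  For one function
  \<open>g\<^sub>i\<close> to work on all tori at once, these are placed far apart along a line.
\<close>

lemma dual_systems_exist:
  assumes "uniformly_contains_l1 (whole :: 'e::real_normed_vector nspace)"
  shows "\<exists>(\<psi> :: nat \<Rightarrow> ('e \<Rightarrow> real) \<Rightarrow> real) g C. 0 \<le> C \<and> (\<forall>r. linear (\<psi> r)) \<and>
    (\<forall>f K N. (\<forall>x y. \<bar>f x - f y\<bar> \<le> K * dist x y) \<longrightarrow> (\<Sum>r<N. \<bar>\<psi> r f\<bar>) \<le> C * K) \<and>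
    (\<forall>i. g i 0 = 0 \<and> (\<forall>x y. \<bar>g i x - g i y\<bar> \<le> C * dist x y)) \<and>
    (\<forall>i j. \<psi> j (g i) = (if j = i then 1 else 0))"
proof -
  obtain C0 where C0: "0 < C0" and l1: "\<forall>n. \<exists>e :: nat \<Rightarrow> 'e. l1_basis whole C0 n e"
    using assms unfolding uniformly_contains_l1_def by (elim exE conjE) (rule that)
  have "\<exists>u :: (nat \<Rightarrow> int) \<times> bool \<Rightarrow> 'e. (\<forall>a\<in>sign_vecs m \<times> UNIV. norm (u a) \<le> 1) \<and>
      (\<forall>c. (\<Sum>a\<in>sign_vecs m \<times> UNIV. \<bar>c a\<bar>) \<le> C0 * norm (\<Sum>a\<in>sign_vecs m \<times> UNIV. c a *\<^sub>R u a))" for m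
    using l1 by (elim allE exE) (rule l1_basis_reindex, simp_all add: finite_sign_vecs)
  then have "\<forall>m. \<exists>u :: (nat \<Rightarrow> int) \<times> bool \<Rightarrow> 'e. (\<forall>a\<in>sign_vecs m \<times> UNIV. norm (u a) \<le> 1) \<and>
      (\<forall>c. (\<Sum>a\<in>sign_vecs m \<times> UNIV. \<bar>c a\<bar>) \<le> C0 * norm (\<Sum>a\<in>sign_vecs m \<times> UNIV. c a *\<^sub>R u a))"
    by blast
  from choice[OF this] obtain U :: "nat \<Rightarrow> (nat \<Rightarrow> int) \<times> bool \<Rightarrow> 'e"
    where U': "\<forall>m. (\<forall>a\<in>sign_vecs m \<times> UNIV. norm (U m a) \<le> 1) \<and>
      (\<forall>c. (\<Sum>a\<in>sign_vecs m \<times> UNIV. \<bar>c a\<bar>) \<le> C0 * norm (\<Sum>a\<in>sign_vecs m \<times> UNIV. c a *\<^sub>R U m a))"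
    by blast
  have U: "norm (U m a) \<le> 1" if "a \<in> sign_vecs m \<times> UNIV" for m a
    using U' that by blast
  have U_C: "(\<Sum>a\<in>sign_vecs m \<times> UNIV. \<bar>c a\<bar>)
        \<le> C0 * norm (\<Sum>a\<in>sign_vecs m \<times> UNIV. c a *\<^sub>R U m a)" for m c
    using U' by blast
  obtain w :: 'e where w: "norm w = 1"
  proof -
    obtain e :: "nat \<Rightarrow> 'e" where "\<forall>c. (\<Sum>i<1. \<bar>c i\<bar>) \<le> C0 * norm (\<Sum>i<1. c i *\<^sub>R e i)"
      using l1[rule_format, of 1] unfolding l1_basis_def by auto
    from this[rule_format, of "\<lambda>_. 1"] have "e 0 \<noteq> 0" using C0 by auto
    then show ?thesis using that[of "sgn (e 0)"] by (simp add: norm_sgn)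
  qed
  \<comment> \<open>a bound for the norms on the torus in dimension \<open>m\<close>, plus a margin for the values of \<open>g\<^sub>i\<close> on it\<close>
  define D where "D m = real (card (sign_vecs m)) * (4 * real (m + 1)) + 2 * real (m + 1)" for m
  define B where "B m = D m + 2 * (\<Sum>j<m. D j)" for m
  have D0: "0 \<le> D m" for m by (simp add: D_def)
  have B_gap: "D m + D m' \<le> B m - B m'" if "m' < m" for m m'
  proof -
    have "(\<Sum>j<m'. D j) + D m' = (\<Sum>j<Suc m'. D j)" by simp
    also have "\<dots> \<le> (\<Sum>j<m. D j)" using that D0 by (intro sum_mono2) auto
    finally show ?thesis by (simp add: B_def)
  qed
  have B_D: "D m \<le> B m" for m using D0 by (simp add: B_def sum_nonneg)
  define J where "J m x = B m *\<^sub>R w + torus_map m (m + 1) (U m) x" for m x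
  have J_bound: "norm (J m x - B m *\<^sub>R w) \<le> D m - 2 * real (m + 1)" for m x
    using torus_map_bounded[of "m + 1" m "U m" x] U by (simp add: J_def D_def)
  have J_far: "\<bar>B m - b\<bar> - (D m - 2 * real (m + 1)) \<le> norm (J m x - b *\<^sub>R w)" for m x b
  proof -
    have "\<bar>B m - b\<bar> = norm (B m *\<^sub>R w - b *\<^sub>R w)" using w by (simp add: scaleR_diff_left[symmetric])
    also have "\<dots> \<le> norm (J m x - b *\<^sub>R w) + norm (J m x - B m *\<^sub>R w)"
      using norm_triangle_ineq4[of "J m x - b *\<^sub>R w" "J m x - B m *\<^sub>R w"] by (simp add: algebra_simps)
    finally show ?thesis using J_bound[of m x] by linarith
  qed
  have J_sep: "2 * real (m + 1) + 2 * real (m' + 1) \<le> dist (J m x) (J m' y)" if "m' < m" for m m' x y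
  proof -
    have "norm (J m x - B m' *\<^sub>R w) \<le> norm (J m x - J m' y) + norm (J m' y - B m' *\<^sub>R w)"
      using norm_triangle_ineq[of "J m x - J m' y" "J m' y - B m' *\<^sub>R w"] by (simp add: algebra_simps)
    then show ?thesis
      using J_far[of m "B m'" x] J_bound[of m' y] B_gap[OF that]
      by (simp add: dist_norm)
  qed
  have J_zero: "2 * real (m + 1) \<le> dist (J m x) 0" for m x
    using J_far[of m 0 x] B_D[of m] D0[of m] by simp
  define t where "t i m x = (if i < m then real_of_int (tent (4 * int (m + 1)) (\<Sum>k\<in>sign_vecs m. k i * x k)) else 0)"
    for i m and x :: "(nat \<Rightarrow> int) \<Rightarrow> int"
  have t0: "0 \<le> t i m x" and t2: "t i m x \<le> 2 * real (m + 1)" for i m x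
    using tent_nonneg[of "4 * int (m + 1)"] tent_upper[of "4 * int (m + 1)" "\<Sum>k\<in>sign_vecs m. k i * x k"]
    by (simp_all add: t_def)
  define C1 where "C1 = max C0 1"
  \<comment> \<open>the index \<open>None\<close> stands for the base point \<open>0\<close>, where the \<open>g\<^sub>i\<close> must vanish\<close>
  define P :: "(nat \<times> ((nat \<Rightarrow> int) \<Rightarrow> int)) option \<Rightarrow> 'e"
    where "P = (\<lambda>a. case a of None \<Rightarrow> 0 | Some (m, x) \<Rightarrow> J m x)"
  define v :: "nat \<Rightarrow> (nat \<times> ((nat \<Rightarrow> int) \<Rightarrow> int)) option \<Rightarrow> real"
    where "v i = (\<lambda>a. case a of None \<Rightarrow> 0 | Some (m, x) \<Rightarrow> t i m x)" for i
  have v_lip: "\<bar>v i a - v i b\<bar> \<le> C1 * dist (P a) (P b)" for i a b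
  proof -
    have up: "d \<le> C1 * d" if "0 \<le> d" for d :: real
      using that by (simp add: C1_def mult_le_cancel_right1 max_def)
    have None_Some: "\<bar>t i m x\<bar> \<le> C1 * dist (J m x) 0" for m x
      using t0[of i m x] t2[of i m x] J_zero[of m x] up[of "dist (J m x) 0"] by simp
    have lt: "\<bar>t i m x - t i m' y\<bar> \<le> C1 * dist (J m x) (J m' y)" if "m' < m" for m m' x y
      using t0[of i m x] t2[of i m x] t0[of i m' y] t2[of i m' y] J_sep[OF that, of x y]
        up[of "dist (J m x) (J m' y)"] by (simp add: abs_le_iff)
    have same: "\<bar>t i m x - t i m y\<bar> \<le> C1 * dist (J m x) (J m y)" for m x y
    proof (cases "i < m")
      case True
      have "\<bar>t i m x - t i m y\<bar> \<le> C0 * norm (torus_map m (m + 1) (U m) x - torus_map m (m + 1) (U m) y)"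
        using torus_map_coordinate_lipschitz[of "m + 1" m "U m" C0 i x y] U U_C[of _ m] True by (simp add: t_def)
      also have "\<dots> \<le> C1 * norm (torus_map m (m + 1) (U m) x - torus_map m (m + 1) (U m) y)"
        by (intro mult_right_mono) (simp_all add: C1_def)
      finally show ?thesis by (simp add: J_def dist_norm)
    next
      case False
      then show ?thesis by (simp add: t_def C1_def)
    qed
    have SS: "\<bar>t i m x - t i m' y\<bar> \<le> C1 * dist (J m x) (J m' y)" for m m' x y
      using lt[of m' m x y] lt[of m m' y x] same[of m x y]
      by (cases m m' rule: linorder_cases) (auto simp: dist_commute abs_minus_commute)
    show ?thesis
      using None_Some SS by (auto simp: P_def v_def dist_commute split: option.split prod.split)
  qed
  have "\<exists>F. (\<forall>x y. \<bar>F x - F y\<bar> \<le> C1 * dist x y) \<and> (\<forall>a. F (P a) = v i a)" for i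
    using v_lip by (rule lipschitz_extension_exists) (simp add: C1_def)
  then obtain g where g_lip: "\<And>i x y. \<bar>g i x - g i y\<bar> \<le> C1 * dist x y"
    and g_P: "\<And>i a. g i (P a) = v i a"
    by metis
  have g0: "g i 0 = 0" for i using g_P[of i None] by (simp add: P_def v_def)
  have gJ: "g i (J m x) = t i m x" for i m x using g_P[of i "Some (m, x)"] by (simp add: P_def v_def)
  obtain \<Lambda> where BL: "generalized_limit \<Lambda>" using generalized_limit_exists by blast
  then have \<Lambda>: "linear \<Lambda>" by (simp add: generalized_limit_def)
  define G where "G f m r = box_avg m (4 * (m + 1)) (m + 1) (f \<circ> J m) (unit_vec r)
      - box_avg m (4 * (m + 1)) (m + 1) (f \<circ> J m) 0" for f m r
  define \<psi> where "\<psi> r f = \<Lambda> (\<lambda>m. G f m r)" for r f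
  have G_lin: "G (\<lambda>x. f1 x + c * f2 x) m r = G f1 m r + c * G f2 m r" for f1 f2 c m r
    using box_avg_add_scale[of m "4 * (m + 1)" "m + 1" "f1 \<circ> J m" c "f2 \<circ> J m"]
    by (simp add: G_def o_def algebra_simps)
  have \<psi>_lin: "linear (\<psi> r)" for r
  proof (rule linearI)
    fix f1 f2 :: "'e \<Rightarrow> real"
    have "(\<lambda>m. G (f1 + f2) m r) = (\<lambda>m. G f1 m r) + (\<lambda>m. G f2 m r)"
      using G_lin[of f1 1 f2] by (simp add: plus_fun_def)
    then show "\<psi> r (f1 + f2) = \<psi> r f1 + \<psi> r f2" by (simp add: \<psi>_def linear_add[OF \<Lambda>])
  next
    fix c and f :: "'e \<Rightarrow> real"
    have "(\<lambda>m. G (\<lambda>x. 0) m r) = (\<lambda>m. 0)"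
      using G_lin[of "\<lambda>x. 0" 1 "\<lambda>x. 0"] by simp
    then have "(\<lambda>m. G (c *\<^sub>R f) m r) = c *\<^sub>R (\<lambda>m. G f m r)"
      using G_lin[of "\<lambda>x. 0" c f] by (simp add: scaleR_fun_def fun_eq_iff)
    then show "\<psi> r (c *\<^sub>R f) = c *\<^sub>R \<psi> r f" by (simp add: \<psi>_def linear_scale[OF \<Lambda>])
  qed
  have \<psi>_bound: "(\<Sum>r<N. \<bar>\<psi> r f\<bar>) \<le> 6 * K" if f: "\<And>x y. \<bar>f x - f y\<bar> \<le> K * dist x y" for f K N
  proof -
    have K: "0 \<le> K" using f[of 0 w] w by simp
    have upper: "(\<Sum>r<N. real_of_int (\<epsilon> r) * G f m r) \<le> 6 * K"
      if \<epsilon>: "\<And>i. \<epsilon> i \<in> {-1, 0, 1}" and m: "N * N \<le> m" "N \<le> m" for \<epsilon> m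
    proof -
      have "(\<Sum>r<N. \<epsilon> r * G f m r) \<le> 2 * K + 2 * (2 * K) * real N * real N / real (m + 1)"
        unfolding G_def
      proof (rule box_avg_signed_sum)
        fix x z
        have "J m (x + (\<lambda>k. int (4 * (m + 1)) * z k)) = J m x"
          unfolding J_def torus_map_periodic ..
        then show "(f \<circ> J m) (x + (\<lambda>k. int (4 * (m + 1)) * z k)) = (f \<circ> J m) x"
          by (simp only: o_apply)
      next
        fix x k assume k: "k \<in> sign_vecs m"
        have "dist (J m (x + unit_vec k)) (J m x) \<le> 2"
          using torus_map_step[of "m + 1" m "U m" k x] U k by (simp add: J_def dist_norm)
        then have "K * dist (J m (x + unit_vec k)) (J m x) \<le> K * 2" by (intro mult_left_mono K)
        then show "\<bar>(f \<circ> J m) (x + unit_vec k) - (f \<circ> J m) x\<bar> \<le> 2 * K"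
          using f[of "J m (x + unit_vec k)" "J m x"] by simp
      qed (use \<epsilon> m in auto)
      \<comment> \<open>the dimension \<open>m\<close> is also the side of the box, so the error term is harmless for \<open>m \<ge> N\<^sup>2\<close>\<close>
      also have "2 * (2 * K) * real N * real N / real (m + 1) \<le> 4 * K"
      proof -
        have "real N * real N \<le> real (m + 1)" using m(1) by (simp flip: of_nat_mult)
        then have "4 * K * (real N * real N) \<le> 4 * K * real (m + 1)" using K by (intro mult_left_mono) auto
        then show ?thesis by (simp add: divide_le_eq ac_simps)
      qed
      finally show ?thesis by simp
    qed
    define \<epsilon> :: "nat \<Rightarrow> int" where "\<epsilon> r = (if 0 \<le> \<psi> r f then 1 else -1)" for r
    define a where "a = (\<lambda>m. \<Sum>r<N. real_of_int (\<epsilon> r) * G f m r)"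
    have a: "\<bar>a m\<bar> \<le> 6 * K" if m: "N * N + N \<le> m" for m
    proof -
      have "(\<Sum>r<N. real_of_int (- \<epsilon> r) * G f m r) \<le> 6 * K"
        using m by (intro upper) (auto simp: \<epsilon>_def)
      then have "- a m \<le> 6 * K" by (simp add: a_def sum_negf)
      moreover have "a m \<le> 6 * K"
        unfolding a_def using m by (intro upper) (auto simp: \<epsilon>_def)
      ultimately show ?thesis by simp
    qed
    have "\<forall>\<^sub>F m in sequentially. \<bar>a m\<bar> \<le> 6 * K"
      using a by (auto simp: eventually_sequentially)
    then have "\<bar>\<Lambda> a\<bar> \<le> 6 * K" by (rule generalized_limit_abs_le[OF BL])
    moreover have "a = (\<Sum>r<N. real_of_int (\<epsilon> r) *\<^sub>R (\<lambda>m. G f m r))"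
      by (simp add: a_def fun_eq_iff sum_scaleR_apply)
    then have "\<Lambda> a = (\<Sum>r<N. \<epsilon> r * \<psi> r f)"
      by (simp add: \<psi>_def linear_sum[OF \<Lambda>] linear_scale[OF \<Lambda>])
    moreover have "real_of_int (\<epsilon> r) * \<psi> r f = \<bar>\<psi> r f\<bar>" for r by (simp add: \<epsilon>_def)
    ultimately show ?thesis by simp
  qed
  have \<psi>_g: "\<psi> j (g i) = (if j = i then 1 else 0)" for i j
  proof -
    let ?d = "if j = i then 1 else 0 :: real"
    have "G (g i) m j = ?d" if m: "i < m" for m
    proof -
      have "g i \<circ> J m = (\<lambda>x. real_of_int (tent (4 * int (m + 1)) (\<Sum>k\<in>sign_vecs m. k i * x k)))"
        using m by (simp add: fun_eq_iff gJ t_def)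
      then show ?thesis unfolding G_def using box_avg_coordinate[of "m + 1" i m j] m by simp
    qed
    then have "\<forall>\<^sub>F m in sequentially. G (g i) m j = ?d"
      using eventually_gt_at_top[of i] by (rule eventually_mono[rotated])
    then show ?thesis unfolding \<psi>_def by (rule generalized_limit_const[OF BL])
  qed
  show ?thesis
  proof (intro exI[of _ \<psi>] exI[of _ g] exI[of _ "max 6 C1"] conjI allI impI)
    fix f :: "'e \<Rightarrow> real" and K N assume "\<forall>x y. \<bar>f x - f y\<bar> \<le> K * dist x y"
    then have f: "\<And>x y. \<bar>f x - f y\<bar> \<le> K * dist x y" by blast
    moreover have "0 \<le> K" using f[of 0 w] w by simp
    ultimately show "(\<Sum>r<N. \<bar>\<psi> r f\<bar>) \<le> max 6 C1 * K"
      using \<psi>_bound[of f K N] mult_right_mono[of 6 "max 6 C1" K] by simp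
  next
    fix i x y
    show "\<bar>g i x - g i y\<bar> \<le> max 6 C1 * dist x y"
      using g_lip[of i x y] mult_right_mono[of C1 "max 6 C1" "dist x y"] by simp
  qed (use \<psi>_lin g0 \<psi>_g in auto)
qed

section \<open>Norms, dual spaces and spaces of Lipschitz functions\<close>

lemma Sup0_le: "(\<And>a. a \<in> A \<Longrightarrow> a \<le> C) \<Longrightarrow> 0 \<le> C \<Longrightarrow> Sup0 A \<le> C"
  unfolding Sup0_def by (rule cSup_least) auto

lemma le_Sup0: "a \<in> A \<Longrightarrow> \<exists>C. \<forall>a\<in>A. a \<le> C \<Longrightarrow> a \<le> Sup0 A"
  unfolding Sup0_def by (rule cSup_upper) (simp_all, simp add: bdd_above_def)

lemma Sup0_nonneg: "\<exists>C. \<forall>a\<in>A. a \<le> C \<Longrightarrow> 0 \<le> Sup0 A"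
  unfolding Sup0_def by (rule cSup_upper) (simp_all, simp add: bdd_above_def)

text \<open>
  The norms of \<open>L\<^sub>1(\<mu>)\<close> and \<open>L\<^sub>\<infinity>(\<mu>)\<close> on functions vanish on null functions.  Working with seminorms
  throughout treats these spaces like the others, without passing to equivalence classes.
\<close>

definition seminormed_space :: "'v::real_vector nspace \<Rightarrow> bool"
  where "seminormed_space X \<longleftrightarrow> subspace (pts X) \<and> (\<forall>x\<in>pts X. 0 \<le> nrm X x) \<and>
    (\<forall>x\<in>pts X. \<forall>c. nrm X (c *\<^sub>R x) = \<bar>c\<bar> * nrm X x) \<and>
    (\<forall>x\<in>pts X. \<forall>y\<in>pts X. nrm X (x + y) \<le> nrm X x + nrm X y)"

lemma seminormed_spaceD:
  assumes "seminormed_space X"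
  shows "subspace (pts X)" "x \<in> pts X \<Longrightarrow> 0 \<le> nrm X x"
    "x \<in> pts X \<Longrightarrow> nrm X (c *\<^sub>R x) = \<bar>c\<bar> * nrm X x"
    "x \<in> pts X \<Longrightarrow> y \<in> pts X \<Longrightarrow> nrm X (x + y) \<le> nrm X x + nrm X y"
  using assms unfolding seminormed_space_def by auto

lemma normed_imp_seminormed: "normed_space X \<Longrightarrow> seminormed_space X"
  unfolding normed_space_def seminormed_space_def by blast

lemma seminormed_whole: "seminormed_space (whole :: 'v::real_normed_vector nspace)"
  by (simp add: seminormed_space_def norm_triangle_ineq)

lemma nrm_zero: "seminormed_space X \<Longrightarrow> nrm X 0 = 0"
  using seminormed_spaceD(3)[of X 0 0] subspace_0[OF seminormed_spaceD(1)] by fastforce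

text \<open>
  A supremum norm, a Lipschitz constant or a dual norm of \<open>f\<close> is the least constant \<open>C \<ge> 0\<close> for which
  some family of inequalities \<open>Q f C\<close> holds.  This alone yields the axioms of a seminorm.
\<close>

lemma seminormed_space_if_least_bound:
  assumes zero: "Q 0 (0 :: real)" and add: "\<And>f g C D. Q f C \<Longrightarrow> Q g D \<Longrightarrow> Q (f + g) (C + D)"
    and scale: "\<And>f c C. Q f C \<Longrightarrow> Q (c *\<^sub>R f) (\<bar>c\<bar> * C)"
    and norm: "\<And>f. f \<in> pts X \<Longrightarrow> 0 \<le> nrm X f \<and> Q f (nrm X f)"
    and least: "\<And>f C. Q f C \<Longrightarrow> 0 \<le> C \<Longrightarrow> f \<in> pts X \<and> nrm X f \<le> C"
  shows "seminormed_space X"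
proof -
  have a: "f + g \<in> pts X \<and> nrm X (f + g) \<le> nrm X f + nrm X g" if "f \<in> pts X" "g \<in> pts X" for f g
    using norm[OF that(1)] norm[OF that(2)] by (intro least add) auto
  have s: "c *\<^sub>R f \<in> pts X \<and> nrm X (c *\<^sub>R f) \<le> \<bar>c\<bar> * nrm X f" if "f \<in> pts X" for f c
    using norm[OF that] by (intro least scale) auto
  have "nrm X (c *\<^sub>R f) = \<bar>c\<bar> * nrm X f" if f: "f \<in> pts X" for f c
  proof (cases "c = 0")
    case True
    then show ?thesis using s[OF f, of c] norm[of "c *\<^sub>R f"] by simp
  next
    case False
    have "nrm X ((1 / c) *\<^sub>R c *\<^sub>R f) \<le> \<bar>1 / c\<bar> * nrm X (c *\<^sub>R f)" using s f by blast
    then have "\<bar>c\<bar> * nrm X f \<le> nrm X (c *\<^sub>R f)" using False by (simp add: field_simps)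
    then show ?thesis using s[OF f, of c] by simp
  qed
  then show ?thesis
    unfolding seminormed_space_def subspace_def using least[OF zero] a s norm by simp
qed

definition functional_bound :: "'v::real_vector nspace \<Rightarrow> ('v \<Rightarrow> real) \<Rightarrow> real \<Rightarrow> bool"
  where "functional_bound X \<phi> C \<longleftrightarrow> linear_between (pts X) UNIV \<phi> \<and> (\<forall>x. x \<notin> pts X \<longrightarrow> \<phi> x = 0) \<and>
    (\<forall>x\<in>pts X. \<bar>\<phi> x\<bar> \<le> C * nrm X x)"

lemma functional_boundI:
  assumes "\<And>x y. x \<in> pts X \<Longrightarrow> y \<in> pts X \<Longrightarrow> \<phi> (x + y) = \<phi> x + \<phi> y"
    and "\<And>c x. x \<in> pts X \<Longrightarrow> \<phi> (c *\<^sub>R x) = c * \<phi> x"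
    and "\<And>x. x \<notin> pts X \<Longrightarrow> \<phi> x = 0"
    and "\<And>x. x \<in> pts X \<Longrightarrow> \<bar>\<phi> x\<bar> \<le> C * nrm X x"
  shows "functional_bound X \<phi> C"
  using assms unfolding functional_bound_def linear_between_def by simp

lemma dual_spaceD:
  assumes "\<phi> \<in> pts (dual_space X)"
  shows "x \<in> pts X \<Longrightarrow> y \<in> pts X \<Longrightarrow> \<phi> (x + y) = \<phi> x + \<phi> y"
    and "x \<in> pts X \<Longrightarrow> \<phi> (c *\<^sub>R x) = c * \<phi> x"
    and "x \<notin> pts X \<Longrightarrow> \<phi> x = 0"
  using assms unfolding dual_space_def linear_between_def by auto

lemma dual_norm_eq: "nrm (dual_space X) \<phi> = Sup0 {\<bar>\<phi> x\<bar> | x. x \<in> pts X \<and> nrm X x \<le> 1}"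
  by (simp add: dual_space_def)

lemma functional_bound_imp_dual:
  assumes "functional_bound X \<phi> C" "0 \<le> C"
  shows "\<phi> \<in> pts (dual_space X) \<and> nrm (dual_space X) \<phi> \<le> C"
proof
  show "\<phi> \<in> pts (dual_space X)" using assms(1) by (auto simp: dual_space_def functional_bound_def)
  show "nrm (dual_space X) \<phi> \<le> C"
    unfolding dual_norm_eq
  proof (rule Sup0_le[OF _ assms(2)], clarify)
    fix x assume x: "x \<in> pts X" "nrm X x \<le> 1"
    have "\<bar>\<phi> x\<bar> \<le> C * nrm X x" using assms(1) x(1) by (simp add: functional_bound_def)
    also have "\<dots> \<le> C * 1" using x assms(2) by (intro mult_left_mono)
    finally show "\<bar>\<phi> x\<bar> \<le> C" by simp
  qed
qed

lemma dual_imp_functional_bound: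
  assumes X: "seminormed_space X" and \<phi>: "\<phi> \<in> pts (dual_space X)"
  shows "0 \<le> nrm (dual_space X) \<phi> \<and> functional_bound X \<phi> (nrm (dual_space X) \<phi>)"
proof -
  obtain C where C: "\<And>x. x \<in> pts X \<Longrightarrow> \<bar>\<phi> x\<bar> \<le> C * nrm X x"
    using \<phi> unfolding dual_space_def by auto
  have "\<bar>\<phi> x\<bar> \<le> \<bar>C\<bar>" if x: "x \<in> pts X" "nrm X x \<le> 1" for x
  proof -
    have "C * nrm X x \<le> \<bar>C\<bar> * 1"
      using x seminormed_spaceD(2)[OF X x(1)] by (intro mult_mono) auto
    then show ?thesis using C[OF x(1)] by simp
  qed
  then have bdd: "\<exists>K. \<forall>a\<in>{\<bar>\<phi> x\<bar> | x. x \<in> pts X \<and> nrm X x \<le> 1}. a \<le> K" by blast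
  have "\<bar>\<phi> x\<bar> \<le> nrm (dual_space X) \<phi> * nrm X x" if x: "x \<in> pts X" for x
  proof (cases "nrm X x = 0")
    case True
    then show ?thesis using C[OF x] by simp
  next
    case False
    then have pos: "0 < nrm X x" using seminormed_spaceD(2)[OF X x] by simp
    let ?y = "(1 / nrm X x) *\<^sub>R x"
    have "?y \<in> pts X" "nrm X ?y \<le> 1"
      using X x pos by (simp_all add: seminormed_spaceD(3) subspace_scale[OF seminormed_spaceD(1)])
    then have "\<bar>\<phi> ?y\<bar> \<le> nrm (dual_space X) \<phi>"
      unfolding dual_norm_eq by (intro le_Sup0[OF _ bdd]) blast
    then show ?thesis using pos by (simp add: dual_spaceD(2)[OF \<phi> x] abs_mult divide_le_eq)
  qed
  moreover have "0 \<le> nrm (dual_space X) \<phi>" unfolding dual_norm_eq by (rule Sup0_nonneg[OF bdd])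
  ultimately show ?thesis using \<phi> by (simp add: functional_bound_def dual_space_def)
qed

lemma dual_norm_bound:
  assumes "seminormed_space X" "\<phi> \<in> pts (dual_space X)" "x \<in> pts X"
  shows "\<bar>\<phi> x\<bar> \<le> nrm (dual_space X) \<phi> * nrm X x"
  using dual_imp_functional_bound[OF assms(1,2)] assms(3) by (simp add: functional_bound_def)

lemma dual_norm_nonneg:
  "seminormed_space X \<Longrightarrow> \<phi> \<in> pts (dual_space X) \<Longrightarrow> 0 \<le> nrm (dual_space X) \<phi>"
  using dual_imp_functional_bound by blast

lemma seminormed_dual_space:
  assumes X: "seminormed_space X"
  shows "seminormed_space (dual_space X)"
proof (rule seminormed_space_if_least_bound[where Q = "functional_bound X"])
  fix \<phi> \<psi> C D assume \<phi>: "functional_bound X \<phi> C" and \<psi>: "functional_bound X \<psi> D"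
  have "\<bar>(\<phi> + \<psi>) x\<bar> \<le> (C + D) * nrm X x" if "x \<in> pts X" for x
  proof -
    have "\<bar>\<phi> x\<bar> \<le> C * nrm X x" "\<bar>\<psi> x\<bar> \<le> D * nrm X x" using \<phi> \<psi> that by (auto simp: functional_bound_def)
    then show ?thesis by (simp add: distrib_right)
  qed
  then show "functional_bound X (\<phi> + \<psi>) (C + D)"
    using \<phi> \<psi> by (simp add: functional_bound_def linear_between_def algebra_simps)
next
  fix \<phi> c C assume \<phi>: "functional_bound X \<phi> C"
  then have "\<bar>c\<bar> * \<bar>\<phi> x\<bar> \<le> \<bar>c\<bar> * (C * nrm X x)" if "x \<in> pts X" for x
    using that by (intro mult_left_mono) (auto simp: functional_bound_def)
  then show "functional_bound X (c *\<^sub>R \<phi>) (\<bar>c\<bar> * C)"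
    using \<phi> by (simp add: functional_bound_def linear_between_def scaleR_fun_def abs_mult algebra_simps)
qed (simp_all add: functional_bound_imp_dual dual_imp_functional_bound[OF X],
    simp add: functional_bound_def linear_between_def)

lemma evaluation_functional:
  assumes X: "seminormed_space X" and x: "x \<in> pts X"
    and F: "subspace (pts F)" "pts F \<subseteq> pts (dual_space X)" "nrm F = nrm (dual_space X)"
  defines "ev \<equiv> \<lambda>\<phi>. if \<phi> \<in> pts F then \<phi> x else 0"
  shows "ev \<in> pts (dual_space F) \<and> nrm (dual_space F) ev \<le> nrm X x"
proof (rule functional_bound_imp_dual, rule functional_boundI)
  fix \<phi> assume "\<phi> \<in> pts F"
  then show "\<bar>ev \<phi>\<bar> \<le> nrm X x * nrm F \<phi>" "ev (c *\<^sub>R \<phi>) = c * ev \<phi>" for c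
    using dual_norm_bound[OF X _ x, of \<phi>] F subspace_scale[OF F(1), of \<phi> c]
    by (auto simp: ev_def mult.commute scaleR_fun_def)
qed (use subspace_add[OF F(1)] seminormed_spaceD(2)[OF X x] in \<open>auto simp: ev_def\<close>)

text \<open>The maps in question are linear on a subspace only, so \<open>linear_sum\<close> does not apply to them.\<close>

lemma linear_between_sum:
  assumes S: "subspace S" and T: "linear_between S S' T" and x: "\<And>j. j \<in> A \<Longrightarrow> x j \<in> S"
  shows "T (\<Sum>j\<in>A. c j *\<^sub>R x j) = (\<Sum>j\<in>A. c j *\<^sub>R T (x j))"
  using x
proof (induction A rule: infinite_finite_induct)
  have "T (0 *\<^sub>R 0) = 0 *\<^sub>R T 0" using T subspace_0[OF S] unfolding linear_between_def by blast
  then have T0: "T 0 = 0" by simp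
  {
    case (infinite A)
    then show ?case using T0 by simp
  next
    case empty
    then show ?case using T0 by simp
  }
next
  case (insert a A)
  then have "c a *\<^sub>R x a \<in> S" "(\<Sum>j\<in>A. c j *\<^sub>R x j) \<in> S"
    by (auto intro!: subspace_sum[OF S] subspace_scale[OF S])
  then show ?case using insert T by (simp add: linear_between_def)
qed

lemma functional_sum:
  assumes "seminormed_space X" "h \<in> pts (dual_space X)" "\<And>j. j \<in> A \<Longrightarrow> x j \<in> pts X"
  shows "h (\<Sum>j\<in>A. c j *\<^sub>R x j) = (\<Sum>j\<in>A. c j * h (x j))"
  using linear_between_sum[OF seminormed_spaceD(1)[OF assms(1)], of UNIV h A x c] assms(2,3)
  by (simp add: dual_space_def)

lemma mdist_pos: "x \<in> mspace M \<Longrightarrow> y \<in> mspace M \<Longrightarrow> x \<noteq> y \<Longrightarrow> 0 < mdist M x y"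
  by (rule Metric_space.mdist_pos_less[OF Metric_space_mspace_mdist])

definition lipschitz_bound :: "'m metric \<Rightarrow> 'm \<Rightarrow> ('m \<Rightarrow> real) \<Rightarrow> real \<Rightarrow> bool"
  where "lipschitz_bound M e f C \<longleftrightarrow> f e = 0 \<and> (\<forall>x. x \<notin> mspace M \<longrightarrow> f x = 0) \<and>
    (\<forall>x\<in>mspace M. \<forall>y\<in>mspace M. \<bar>f x - f y\<bar> \<le> C * mdist M x y)"

lemma Lip0_memD:
  assumes "f \<in> pts (Lip0_space M e)"
  shows "f e = 0" "x \<notin> mspace M \<Longrightarrow> f x = 0"
    "\<exists>C. \<forall>x\<in>mspace M. \<forall>y\<in>mspace M. \<bar>f x - f y\<bar> \<le> C * mdist M x y"
  using assms unfolding Lip0_space_def Lipschitz_continuous_map_def by (auto simp: dist_real_def)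

lemma Lip0_norm_eq:
  "nrm (Lip0_space M e) f = Sup0 {\<bar>f x - f y\<bar> / mdist M x y | x y. x \<in> mspace M \<and> y \<in> mspace M \<and> x \<noteq> y}"
  by (simp add: Lip0_space_def)

lemma lipschitz_bound_imp_Lip0:
  assumes "lipschitz_bound M e f C" "0 \<le> C"
  shows "f \<in> pts (Lip0_space M e) \<and> nrm (Lip0_space M e) f \<le> C"
proof
  show "f \<in> pts (Lip0_space M e)"
    using assms(1) unfolding Lip0_space_def Lipschitz_continuous_map_def lipschitz_bound_def
    by (auto simp: dist_real_def)
  show "nrm (Lip0_space M e) f \<le> C"
    unfolding Lip0_norm_eq
    by (rule Sup0_le[OF _ assms(2)])
      (use assms(1) in \<open>auto simp: lipschitz_bound_def divide_le_eq mdist_pos\<close>)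
qed

lemma Lip0_imp_lipschitz_bound:
  assumes f: "f \<in> pts (Lip0_space M e)"
  shows "0 \<le> nrm (Lip0_space M e) f \<and> lipschitz_bound M e f (nrm (Lip0_space M e) f)"
proof -
  obtain C where "\<And>x y. x \<in> mspace M \<Longrightarrow> y \<in> mspace M \<Longrightarrow> \<bar>f x - f y\<bar> \<le> C * mdist M x y"
    using Lip0_memD(3)[OF f] by blast
  then have bdd: "\<exists>C. \<forall>a\<in>{\<bar>f x - f y\<bar> / mdist M x y | x y. x \<in> mspace M \<and> y \<in> mspace M \<and> x \<noteq> y}. a \<le> C"
    by (intro exI[of _ C]) (auto simp: divide_le_eq mdist_pos)
  have "\<bar>f x - f y\<bar> \<le> nrm (Lip0_space M e) f * mdist M x y" if "x \<in> mspace M" "y \<in> mspace M" for x y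
  proof (cases "x = y")
    case False
    have "\<bar>f x - f y\<bar> / mdist M x y \<le> nrm (Lip0_space M e) f"
      unfolding Lip0_norm_eq using that False by (intro le_Sup0[OF _ bdd]) blast
    then show ?thesis using that False by (simp add: divide_le_eq mdist_pos)
  qed (simp add: Lip0_norm_eq Sup0_nonneg[OF bdd])
  then show ?thesis
    using Sup0_nonneg[OF bdd] Lip0_memD(1,2)[OF f] by (simp add: lipschitz_bound_def Lip0_norm_eq)
qed

lemma Lip0_norm_bound:
  "f \<in> pts (Lip0_space M e) \<Longrightarrow> x \<in> mspace M \<Longrightarrow> y \<in> mspace M \<Longrightarrow>
    \<bar>f x - f y\<bar> \<le> nrm (Lip0_space M e) f * mdist M x y"
  using Lip0_imp_lipschitz_bound by (fastforce simp: lipschitz_bound_def)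

lemma seminormed_Lip0: "seminormed_space (Lip0_space M e)"
proof (rule seminormed_space_if_least_bound[where Q = "lipschitz_bound M e"])
  fix f g C D assume f: "lipschitz_bound M e f C" and g: "lipschitz_bound M e g D"
  have "\<bar>(f + g) x - (f + g) y\<bar> \<le> (C + D) * mdist M x y" if "x \<in> mspace M" "y \<in> mspace M" for x y
  proof -
    have "\<bar>f x - f y\<bar> \<le> C * mdist M x y" "\<bar>g x - g y\<bar> \<le> D * mdist M x y"
      using f g that by (auto simp: lipschitz_bound_def)
    then show ?thesis by (simp add: distrib_right)
  qed
  then show "lipschitz_bound M e (f + g) (C + D)" using f g by (simp add: lipschitz_bound_def)
next
  fix f c C assume "lipschitz_bound M e f C"
  then show "lipschitz_bound M e (c *\<^sub>R f) (\<bar>c\<bar> * C)"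
    by (simp add: lipschitz_bound_def scaleR_fun_def right_diff_distrib[symmetric] abs_mult
        mult.assoc mult_left_mono)
qed (simp_all add: lipschitz_bound_imp_Lip0 Lip0_imp_lipschitz_bound, simp add: lipschitz_bound_def)

section \<open>Failure of the Grothendieck property\<close>

text \<open>
  The functionals \<open>\<phi>\<^sub>k f = \<Sum>r\<ge>k. \<psi>\<^sub>r f\<close> are tails of absolutely convergent series, hence converge
  to \<open>0\<close> pointwise.  But \<open>\<phi>\<^sub>k (g i) = 1\<close> for all \<open>i \<ge> k\<close>, so the bidual element
  \<open>\<Phi> \<phi> = LIM i. \<phi> (g i)\<close>, with a generalized limit, is constantly \<open>1\<close> on them.  In other words, the
  \<open>\<psi>\<^sub>r\<close> are the coordinates of a projection onto a copy of \<open>\<ell>\<^sub>1\<close>.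
\<close>

theorem not_grothendieck_Lip0:
  assumes l1: "uniformly_contains_l1 (whole :: 'e::real_normed_vector nspace)"
  shows "\<not> grothendieck (Lip0_space (euclidean_metric :: 'e metric) 0)"
proof
  let ?L = "Lip0_space (euclidean_metric :: 'e metric) 0"
  let ?D = "dual_space ?L"
  assume groth: "grothendieck ?L"
  obtain \<psi> :: "nat \<Rightarrow> ('e \<Rightarrow> real) \<Rightarrow> real" and g C where C: "0 \<le> C"
    and lin: "\<And>r. linear (\<psi> r)"
    and bound: "\<And>f K N. (\<And>x y. \<bar>f x - f y\<bar> \<le> K * dist x y) \<Longrightarrow> (\<Sum>r<N. \<bar>\<psi> r f\<bar>) \<le> C * K"
    and g: "\<And>i. g i 0 = 0" "\<And>i x y. \<bar>g i x - g i y\<bar> \<le> C * dist x y"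
    and biorth: "\<And>i j. \<psi> j (g i) = (if j = i then 1 else 0)"
    using dual_systems_exist[OF l1] by blast
  obtain \<Lambda> where BL: "generalized_limit \<Lambda>" using generalized_limit_exists by blast
  then have \<Lambda>: "linear \<Lambda>" by (simp add: generalized_limit_def)
  note L = seminormed_Lip0[of "euclidean_metric :: 'e metric" 0]
  note subL = seminormed_spaceD(1)[OF L]
  have bnd: "(\<Sum>r<N. \<bar>\<psi> r f\<bar>) \<le> C * nrm ?L f" if "f \<in> pts ?L" for f N
    using Lip0_norm_bound[OF that] by (intro bound) simp
  have abs_summable: "summable (\<lambda>r. \<bar>\<psi> r f\<bar>)" if "f \<in> pts ?L" for f
    using bnd[OF that] by (intro summableI_nonneg_bounded) auto
  have summable: "summable (\<lambda>r. \<psi> r f)" if "f \<in> pts ?L" for f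
    using abs_summable[OF that] by (rule summable_rabs_cancel)
  have tail: "summable (\<lambda>r. \<psi> (r + k) f)" if "f \<in> pts ?L" for f k
    using summable[OF that] by (rule summable_ignore_initial_segment)
  define \<phi> where "\<phi> k f = (if f \<in> pts ?L then \<Sum>r. \<psi> (r + k) f else 0)" for k f
  have "functional_bound ?L (\<phi> k) C" for k
  proof (rule functional_boundI)
    fix f h assume "f \<in> pts ?L" "h \<in> pts ?L"
    then show "\<phi> k (f + h) = \<phi> k f + \<phi> k h"
      using suminf_add[OF tail[of f k] tail[of h k]] subspace_add[OF subL, of f h]
      by (simp add: \<phi>_def linear_add[OF lin])
  next
    fix c f assume "f \<in> pts ?L"
    then show "\<phi> k (c *\<^sub>R f) = c * \<phi> k f"
      using suminf_mult[OF tail[of f k], of c] subspace_scale[OF subL, of f c]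
      by (simp add: \<phi>_def linear_scale[OF lin])
  next
    fix f assume f: "f \<in> pts ?L"
    note s = summable_ignore_initial_segment[OF abs_summable[OF f], of k]
    have "\<bar>\<phi> k f\<bar> \<le> (\<Sum>r. \<bar>\<psi> (r + k) f\<bar>)"
      using f summable_rabs[OF s] by (simp add: \<phi>_def)
    also have "\<dots> \<le> C * nrm ?L f"
    proof (rule suminf_le_const[OF s])
      fix N
      have "(\<Sum>r<N. \<bar>\<psi> (r + k) f\<bar>) = (\<Sum>r\<in>(\<lambda>r. r + k) ` {..<N}. \<bar>\<psi> r f\<bar>)"
        by (simp add: sum.reindex)
      also have "\<dots> \<le> (\<Sum>r<N + k. \<bar>\<psi> r f\<bar>)" by (intro sum_mono2) auto
      also have "\<dots> \<le> C * nrm ?L f" by (rule bnd[OF f])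
      finally show "(\<Sum>r<N. \<bar>\<psi> (r + k) f\<bar>) \<le> C * nrm ?L f" .
    qed
    finally show "\<bar>\<phi> k f\<bar> \<le> C * nrm ?L f" .
  qed (simp add: \<phi>_def)
  then have \<phi>_dual: "\<phi> k \<in> pts ?D" for k using functional_bound_imp_dual C by blast
  have \<phi>_lim: "(\<lambda>k. \<phi> k f) \<longlonglongrightarrow> 0" if f: "f \<in> pts ?L" for f
  proof -
    have "\<phi> k f = (\<Sum>r. \<psi> r f) - (\<Sum>r<k. \<psi> r f)" for k
      using f by (simp add: \<phi>_def suminf_minus_initial_segment[OF summable[OF f]])
    moreover have "(\<lambda>k. (\<Sum>r. \<psi> r f) - (\<Sum>r<k. \<psi> r f)) \<longlonglongrightarrow> (\<Sum>r. \<psi> r f) - (\<Sum>r. \<psi> r f)"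
      using summable_LIMSEQ[OF summable[OF f]] by (intro tendsto_intros)
    ultimately show ?thesis by simp
  qed
  have gL: "g i \<in> pts ?L" and g_norm: "nrm ?L (g i) \<le> C" for i
    using lipschitz_bound_imp_Lip0[of euclidean_metric 0 "g i" C] g C by (simp_all add: lipschitz_bound_def)
  have \<phi>_g: "\<phi> k (g i) = (if k \<le> i then 1 else 0)" for k i
  proof -
    have "(\<Sum>r. \<psi> (r + k) (g i)) = (\<Sum>r\<in>(if k \<le> i then {i - k} else {}). \<psi> (r + k) (g i))"
      by (intro suminf_finite) (auto simp: biorth split: if_splits)
    also have "\<dots> = (if k \<le> i then 1 else 0)" by (simp add: biorth)
    finally show ?thesis using gL by (simp add: \<phi>_def)
  qed
  note D = seminormed_dual_space[OF L]
  note subD = seminormed_spaceD(1)[OF D]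
  define \<Phi> where "\<Phi> \<alpha> = (if \<alpha> \<in> pts ?D then \<Lambda> (\<lambda>i. \<alpha> (g i)) else 0)" for \<alpha>
  have "functional_bound ?D \<Phi> C"
  proof (rule functional_boundI)
    fix \<alpha> \<beta> assume ab: "\<alpha> \<in> pts ?D" "\<beta> \<in> pts ?D"
    have "(\<lambda>i. (\<alpha> + \<beta>) (g i)) = (\<lambda>i. \<alpha> (g i)) + (\<lambda>i. \<beta> (g i))" by (simp add: fun_eq_iff)
    then show "\<Phi> (\<alpha> + \<beta>) = \<Phi> \<alpha> + \<Phi> \<beta>"
      using ab subspace_add[OF subD ab] by (simp only: \<Phi>_def linear_add[OF \<Lambda>] if_True)
  next
    fix c \<alpha> assume a: "\<alpha> \<in> pts ?D"
    have "(\<lambda>i. (c *\<^sub>R \<alpha>) (g i)) = c *\<^sub>R (\<lambda>i. \<alpha> (g i))" by (simp add: fun_eq_iff scaleR_fun_def)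
    then show "\<Phi> (c *\<^sub>R \<alpha>) = c * \<Phi> \<alpha>"
      using a subspace_scale[OF subD a] by (simp only: \<Phi>_def linear_scale[OF \<Lambda>] if_True real_scaleR_def)
  next
    fix \<alpha> assume a: "\<alpha> \<in> pts ?D"
    have val: "\<bar>\<alpha> (g i)\<bar> \<le> nrm ?D \<alpha> * C" for i
      using dual_norm_bound[OF L a gL, of i] mult_left_mono[OF g_norm dual_norm_nonneg[OF L a], of i] by linarith
    then have "\<bar>\<Lambda> (\<lambda>i. \<alpha> (g i))\<bar> \<le> nrm ?D \<alpha> * C"
      by (intro generalized_limit_abs_le[OF BL]) simp
    then show "\<bar>\<Phi> \<alpha>\<bar> \<le> C * nrm ?D \<alpha>" using a by (simp add: \<Phi>_def mult.commute)
  qed (simp add: \<Phi>_def)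
  then have "\<Phi> \<in> pts (dual_space ?D)" using functional_bound_imp_dual C by blast
  moreover have zero: "0 \<in> pts ?D" by (rule subspace_0[OF subD])
  moreover have "\<forall>f\<in>pts ?L. (\<lambda>k. \<phi> k f) \<longlonglongrightarrow> 0 f" using \<phi>_lim by simp
  ultimately have "(\<lambda>k. \<Phi> (\<phi> k)) \<longlonglongrightarrow> \<Phi> 0"
    using groth \<phi>_dual unfolding grothendieck_def by blast
  moreover have "\<Phi> (\<phi> k) = 1" for k
  proof -
    have "\<forall>\<^sub>F i in sequentially. \<phi> k (g i) = 1"
      using eventually_ge_at_top[of k] by (rule eventually_mono) (simp add: \<phi>_g)
    then show ?thesis using \<phi>_dual generalized_limit_const[OF BL] by (simp add: \<Phi>_def)
  qed
  moreover have "\<Phi> 0 = 0"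
    using generalized_limit_const[OF BL, of "\<lambda>i. 0" 0] zero by (simp add: \<Phi>_def)
  ultimately show False by (simp add: LIMSEQ_const_iff)
qed

section \<open>Copies of finite-dimensional sequence spaces and duality\<close>

text \<open>
  Uniform copies of \<open>\<ell>\<^sub>1\<^sup>n\<close> are recorded together with functionals that witness the lower estimate:
  one functional of norm at most \<open>C\<close> for every pattern of signs.  In this form the property passes
  to the bidual without any extension theorem, since the functionals act on the bidual as well.
\<close>

definition l1_system :: "'v::real_vector nspace \<Rightarrow> real \<Rightarrow> nat \<Rightarrow> (nat \<Rightarrow> 'v) \<Rightarrow> bool"
  where "l1_system X C n e \<longleftrightarrow> (\<forall>i<n. e i \<in> pts X \<and> nrm X (e i) \<le> C) \<and>
    (\<forall>\<epsilon>. (\<forall>i. \<epsilon> i \<in> {-1, 1}) \<longrightarrow>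
      (\<exists>h. h \<in> pts (dual_space X) \<and> nrm (dual_space X) h \<le> C \<and> (\<forall>i<n. h (e i) = \<epsilon> i)))"

definition has_l1_systems :: "'v::real_vector nspace \<Rightarrow> bool"
  where "has_l1_systems X \<longleftrightarrow> (\<exists>C. \<forall>n. \<exists>e. l1_system X C n e)"

text \<open>
  Likewise, copies of \<open>\<ell>\<^sub>\<infinity>\<^sup>n\<close> come with biorthogonal functionals.  These are taken from a subspace \<open>F\<close>
  of the dual, because for spaces of Lipschitz functions they can be chosen in the free space.
\<close>

definition linf_system :: "'v::real_vector nspace \<Rightarrow> ('v \<Rightarrow> real) nspace \<Rightarrow> real \<Rightarrow> nat \<Rightarrow>
    (nat \<Rightarrow> 'v) \<Rightarrow> (nat \<Rightarrow> 'v \<Rightarrow> real) \<Rightarrow> bool"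
  where "linf_system X F C n x h \<longleftrightarrow> (\<forall>i<n. x i \<in> pts X \<and> h i \<in> pts F \<and> nrm F (h i) \<le> C) \<and>
    (\<forall>i<n. \<forall>j<n. h i (x j) = (if i = j then 1 else 0)) \<and>
    (\<forall>\<epsilon>. (\<forall>i. \<bar>\<epsilon> i\<bar> \<le> 1) \<longrightarrow> nrm X (\<Sum>i<n. \<epsilon> i *\<^sub>R x i) \<le> C)"

definition has_linf_systems :: "'v::real_vector nspace \<Rightarrow> ('v \<Rightarrow> real) nspace \<Rightarrow> bool"
  where "has_linf_systems X F \<longleftrightarrow> (\<exists>C. \<forall>n. \<exists>x h. linf_system X F C n x h)"

definition dual_subspace :: "'v::real_vector nspace \<Rightarrow> ('v \<Rightarrow> real) nspace \<Rightarrow> bool"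
  where "dual_subspace X F \<longleftrightarrow>
    subspace (pts F) \<and> pts F \<subseteq> pts (dual_space X) \<and> nrm F = nrm (dual_space X)"

lemma dual_subspace_dual: "seminormed_space X \<Longrightarrow> dual_subspace X (dual_space X)"
  by (simp add: dual_subspace_def seminormed_spaceD(1)[OF seminormed_dual_space])

lemma seminormed_dual_subspace:
  assumes X: "seminormed_space X" and F: "dual_subspace X F"
  shows "seminormed_space F"
proof -
  have "\<phi> \<in> pts (dual_space X)" if "\<phi> \<in> pts F" for \<phi> using F that by (auto simp: dual_subspace_def)
  then show ?thesis
    using F seminormed_spaceD[OF seminormed_dual_space[OF X]]
    unfolding seminormed_space_def dual_subspace_def by simp
qed

text \<open>
  The coordinate \<open>rademacher i k\<close> of the \<open>i\<close>-th vector is the \<open>i\<close>-th binary digit of \<open>k\<close>, as a sign; so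
  every pattern of \<open>n\<close> signs occurs at some position \<open>k < 2\<^sup>n\<close>.
\<close>

definition rademacher :: "nat \<Rightarrow> nat \<Rightarrow> real"
  where "rademacher i j = (if odd (j div 2 ^ i) then 1 else -1)"

lemma rademacher_pattern:
  assumes \<epsilon>: "\<forall>i. \<epsilon> i \<in> {-1, 1 :: real}"
  shows "\<exists>k<2 ^ n. \<forall>i<n. rademacher i k = \<epsilon> i"
proof -
  define k where "k = horner_sum of_bool (2 :: nat) (map (\<lambda>i. \<epsilon> i = 1) [0..<n])"
  have "k < 2 ^ n" unfolding k_def
    using horner_sum_of_bool_2_less[of "map (\<lambda>i. \<epsilon> i = 1) [0..<n]"]
    by simp
  moreover have "rademacher i k = \<epsilon> i" if "i < n" for i
  proof -
    have "odd (k div 2 ^ i) \<longleftrightarrow> \<epsilon> i = 1"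
      using that unfolding k_def bit_iff_odd[symmetric] by (simp add: bit_horner_sum_bit_iff)
    then show ?thesis using \<epsilon>[rule_format, of i] by (auto simp: rademacher_def)
  qed
  ultimately show ?thesis by blast
qed

text \<open>
  \<open>\<ell>\<^sub>\<infinity>\<close> of dimension \<open>2\<^sup>n\<close> contains \<open>\<ell>\<^sub>1\<^sup>n\<close>, spanned by the Rademacher vectors; the functionals for the sign
  patterns are the coordinate functionals.
\<close>

lemma linf_systems_imp_l1_systems:
  assumes X: "seminormed_space X" and F: "dual_subspace X F" and linf: "has_linf_systems X F"
  shows "has_l1_systems X"
proof -
  obtain C where C: "\<forall>n. \<exists>x h. linf_system X F C n x h"
    using linf unfolding has_linf_systems_def by blast
  have "\<exists>e. l1_system X C n e" for n
  proof -
    obtain x h where sys: "linf_system X F C (2 ^ n) x h" using C by blast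
    have x: "x i \<in> pts X" and h: "h i \<in> pts (dual_space X)" "nrm (dual_space X) (h i) \<le> C" if "i < 2 ^ n" for i
      using sys F that by (auto simp: linf_system_def dual_subspace_def)
    define e where "e i = (\<Sum>j<2 ^ n. rademacher i j *\<^sub>R x j)" for i
    have sub: "subspace (pts X)" by (rule seminormed_spaceD(1)[OF X])
    have "e i \<in> pts X \<and> nrm X (e i) \<le> C" for i
      using sys x unfolding e_def
      by (auto simp: linf_system_def rademacher_def intro!: subspace_sum[OF sub] subspace_scale[OF sub])
    moreover have "h k (e i) = rademacher i k" if k: "k < 2 ^ n" for i k
    proof -
      have "h k (e i) = (\<Sum>j<2 ^ n. rademacher i j * h k (x j))"
        unfolding e_def by (rule functional_sum[OF X h(1)[OF k]]) (use x in auto)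
      also have "\<dots> = (\<Sum>j<2 ^ n. if j = k then rademacher i j else 0)"
        using sys k by (intro sum.cong refl) (simp add: linf_system_def)
      finally show ?thesis using k by simp
    qed
    ultimately show ?thesis
      unfolding l1_system_def using rademacher_pattern h by (intro exI[of _ e]) metis
  qed
  then show ?thesis unfolding has_l1_systems_def by blast
qed

text \<open>
  The coordinate functionals \<open>h\<^sub>i\<close> span \<open>\<ell>\<^sub>1\<^sup>n\<close>: the functional for a sign pattern is the evaluation at the
  signed sum of the vectors \<open>x\<^sub>i\<close>.
\<close>

lemma linf_systems_imp_l1_systems_dual:
  assumes X: "seminormed_space X" and F: "dual_subspace X F" and linf: "has_linf_systems X F"
  shows "has_l1_systems F"
proof -
  obtain C where C: "\<forall>n. \<exists>x h. linf_system X F C n x h"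
    using linf unfolding has_linf_systems_def by blast
  have "\<exists>e. l1_system F C n e" for n
  proof -
    obtain x h where sys: "linf_system X F C n x h" using C by blast
    note sub = seminormed_spaceD(1)[OF X]
    have x: "x i \<in> pts X" and h: "h i \<in> pts F" "h i \<in> pts (dual_space X)" if "i < n" for i
      using sys F that by (auto simp: linf_system_def dual_subspace_def)
    have "\<exists>g. g \<in> pts (dual_space F) \<and> nrm (dual_space F) g \<le> C \<and> (\<forall>i<n. g (h i) = \<epsilon> i)"
      if \<epsilon>: "\<forall>i. \<epsilon> i \<in> {-1, 1}" for \<epsilon>
    proof -
      let ?y = "\<Sum>i<n. \<epsilon> i *\<^sub>R x i"
      have y: "?y \<in> pts X" using x by (intro subspace_sum[OF sub] subspace_scale[OF sub]) simp
      have "\<bar>\<epsilon> i\<bar> \<le> 1" for i using \<epsilon>[rule_format, of i] by auto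
      then have "nrm X ?y \<le> C" using sys by (simp add: linf_system_def)
      moreover have "h i ?y = \<epsilon> i" if i: "i < n" for i
      proof -
        have "h i ?y = (\<Sum>j<n. \<epsilon> j * h i (x j))"
          by (rule functional_sum[OF X h(2)[OF i]]) (use x in auto)
        also have "\<dots> = (\<Sum>j<n. if j = i then \<epsilon> j else 0)"
          using sys i by (intro sum.cong refl) (simp add: linf_system_def)
        finally show ?thesis using i by simp
      qed
      ultimately show ?thesis
        using evaluation_functional[OF X y, of F] F h(1) unfolding dual_subspace_def
        by (intro exI[of _ "\<lambda>\<phi>. if \<phi> \<in> pts F then \<phi> ?y else 0"]) simp
    qed
    then show ?thesis using sys by (intro exI[of _ h]) (simp add: l1_system_def linf_system_def)
  qed
  then show ?thesis unfolding has_l1_systems_def by blast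
qed

text \<open>
  Both the vectors and the functionals of the system act on the next dual by evaluation, that is, they are
  moved by the canonical embeddings of \<open>X\<close> into its bidual and of the dual of \<open>X\<close> into its own bidual.
\<close>

lemma l1_systems_bidual:
  assumes X: "seminormed_space X" and l1: "has_l1_systems X"
  shows "has_l1_systems (dual_space (dual_space X))"
proof -
  let ?D = "dual_space X"
  obtain C where C: "\<forall>n. \<exists>e. l1_system X C n e" using l1 unfolding has_l1_systems_def by blast
  note D = seminormed_dual_space[OF X]
  have ev: "(\<lambda>\<phi>. if \<phi> \<in> pts ?D then \<phi> x else 0) \<in> pts (dual_space ?D)"
    "nrm (dual_space ?D) (\<lambda>\<phi>. if \<phi> \<in> pts ?D then \<phi> x else 0) \<le> nrm X x" if "x \<in> pts X" for x
    using evaluation_functional[OF X that] dual_subspace_dual[OF X] by (auto simp: dual_subspace_def)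
  have ev': "(\<lambda>\<phi>. if \<phi> \<in> pts (dual_space ?D) then \<phi> h else 0) \<in> pts (dual_space (dual_space ?D))"
    "nrm (dual_space (dual_space ?D)) (\<lambda>\<phi>. if \<phi> \<in> pts (dual_space ?D) then \<phi> h else 0) \<le> nrm ?D h"
    if "h \<in> pts ?D" for h
    using evaluation_functional[OF D that] dual_subspace_dual[OF D] by (auto simp: dual_subspace_def)
  have "\<exists>e. l1_system (dual_space ?D) C n e" for n
  proof -
    obtain e where e: "l1_system X C n e" using C by blast
    have eX: "e i \<in> pts X" "nrm X (e i) \<le> C" if "i < n" for i using e that by (simp_all add: l1_system_def)
    let ?e = "\<lambda>i \<phi>. if \<phi> \<in> pts ?D then \<phi> (e i) else 0"
    have "\<exists>g. g \<in> pts (dual_space (dual_space ?D)) \<and> nrm (dual_space (dual_space ?D)) g \<le> C \<and>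
        (\<forall>i<n. g (?e i) = \<epsilon> i)" if \<epsilon>: "\<forall>i. \<epsilon> i \<in> {-1, 1}" for \<epsilon>
    proof -
      obtain h where h: "h \<in> pts ?D" "nrm ?D h \<le> C" "\<forall>i<n. h (e i) = \<epsilon> i"
        using e \<epsilon> unfolding l1_system_def by blast
      show ?thesis
        using ev'[OF h(1)] ev(1)[OF eX(1)] h
        by (intro exI[of _ "\<lambda>\<phi>. if \<phi> \<in> pts (dual_space ?D) then \<phi> h else 0"]) simp
    qed
    moreover have "?e i \<in> pts (dual_space ?D) \<and> nrm (dual_space ?D) (?e i) \<le> C" if "i < n" for i
      using ev[OF eX(1)[OF that]] eX(2)[OF that] by simp
    ultimately show ?thesis unfolding l1_system_def by (intro exI[of _ ?e]) blast
  qed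
  then show ?thesis unfolding has_l1_systems_def by blast
qed

lemma l1_systems_imp_uniformly_contains_l1:
  assumes X: "seminormed_space X" and l1: "has_l1_systems X"
  shows "uniformly_contains_l1 X"
proof -
  obtain C where C: "\<forall>n. \<exists>e. l1_system X C n e" using l1 unfolding has_l1_systems_def by blast
  define K where "K = max C 1"
  have K: "C \<le> K" "0 < K" by (auto simp: K_def)
  note sub = seminormed_spaceD(1)[OF X]
  have "\<exists>e. l1_basis X (K * K) n e" for n
  proof -
    obtain e where e: "l1_system X C n e" using C by blast
    define e' where "e' i = (1 / K) *\<^sub>R e i" for i
    have eX: "e i \<in> pts X" "nrm X (e i) \<le> K" "e' i \<in> pts X" if "i < n" for i
      using e that K subspace_scale[OF sub] by (auto simp: l1_system_def e'_def)
    have "nrm X (e' i) \<le> 1" if "i < n" for i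
      using eX(2)[OF that] K by (simp add: e'_def seminormed_spaceD(3)[OF X eX(1)[OF that]])
    moreover have "(\<Sum>i<n. \<bar>c i\<bar>) \<le> (K * K) * nrm X (\<Sum>i<n. c i *\<^sub>R e' i)" for c
    proof -
      define \<epsilon> where "\<epsilon> i = (if 0 \<le> c i then 1 else -1 :: real)" for i
      have "\<forall>i. \<epsilon> i \<in> {-1, 1}" by (simp add: \<epsilon>_def)
      then obtain g where g: "g \<in> pts (dual_space X)" "nrm (dual_space X) g \<le> C" "\<forall>i<n. g (e i) = \<epsilon> i"
        using e unfolding l1_system_def by blast
      let ?y = "\<Sum>i<n. c i *\<^sub>R e' i"
      have y: "?y \<in> pts X" using eX(3) by (intro subspace_sum[OF sub] subspace_scale[OF sub]) simp
      have "g ?y = (\<Sum>i<n. c i * g (e' i))"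
        by (rule functional_sum[OF X g(1)]) (use eX(3) in auto)
      also have "\<dots> = (\<Sum>i<n. \<bar>c i\<bar> / K)"
        using g(3) by (intro sum.cong refl) (simp add: e'_def dual_spaceD(2)[OF g(1) eX(1)] \<epsilon>_def)
      finally have "(\<Sum>i<n. \<bar>c i\<bar>) = K * g ?y" using K by (simp add: sum_divide_distrib[symmetric])
      also have "\<dots> \<le> K * (nrm (dual_space X) g * nrm X ?y)"
        using dual_norm_bound[OF X g(1) y] K by (intro mult_left_mono) auto
      also have "\<dots> \<le> K * (K * nrm X ?y)"
        using g(2) K seminormed_spaceD(2)[OF X y] by (intro mult_left_mono mult_right_mono) auto
      finally show ?thesis by (simp add: mult.assoc)
    qed
    ultimately show ?thesis using eX(3) unfolding l1_basis_def by (intro exI[of _ e']) simp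
  qed
  then show ?thesis unfolding uniformly_contains_l1_def using K(2) by (intro exI[of _ "K * K"]) simp
qed

lemma uniformly_contains_l1_copy:
  assumes X: "seminormed_space X" and copy: "contains_copy_of Y X" and l1: "uniformly_contains_l1 X"
  shows "uniformly_contains_l1 Y"
proof -
  obtain T a b where T: "linear_between (pts X) (pts Y) T" and a: "0 < a"
    and T_bound: "\<forall>x\<in>pts X. a * nrm X x \<le> nrm Y (T x) \<and> nrm Y (T x) \<le> b * nrm X x"
    using copy unfolding contains_copy_of_def by (elim exE conjE) (rule that)
  obtain C where C: "0 < C" "\<forall>n. \<exists>e. l1_basis X C n e"
    using l1 unfolding uniformly_contains_l1_def by blast
  define k where "k = max b 1"
  have k: "0 < k" "b \<le> k" by (auto simp: k_def)
  note sub = seminormed_spaceD(1)[OF X]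
  have "\<exists>e. l1_basis Y (C * k / a) n e" for n
  proof -
    obtain e where e: "l1_basis X C n e" using C(2) by blast
    define e' where "e' i = (1 / k) *\<^sub>R e i" for i
    have eX: "e i \<in> pts X" "nrm X (e i) \<le> 1" "e' i \<in> pts X" if "i < n" for i
      using e that subspace_scale[OF sub] by (auto simp: l1_basis_def e'_def)
    have "nrm Y (T (e' i)) \<le> 1" if i: "i < n" for i
    proof -
      have "nrm Y (T (e' i)) \<le> b * nrm X (e' i)" using T_bound eX(3)[OF i] by blast
      also have "\<dots> \<le> k * nrm X (e' i)"
        using k seminormed_spaceD(2)[OF X eX(3)[OF i]] by (intro mult_right_mono) auto
      also have "\<dots> \<le> 1" using k eX(2)[OF i] by (simp add: e'_def seminormed_spaceD(3)[OF X eX(1)[OF i]])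
      finally show ?thesis .
    qed
    moreover have "(\<Sum>i<n. \<bar>c i\<bar>) \<le> C * k / a * nrm Y (\<Sum>i<n. c i *\<^sub>R T (e' i))" for c
    proof -
      let ?x = "\<Sum>i<n. c i *\<^sub>R e i"
      have x: "?x \<in> pts X" using eX(1) by (intro subspace_sum[OF sub] subspace_scale[OF sub]) simp
      have "(\<Sum>i<n. c i *\<^sub>R T (e' i)) = T (\<Sum>i<n. c i *\<^sub>R e' i)"
        using linear_between_sum[OF sub T, of "{..<n}" e' c] eX(3) by simp
      also have "(\<Sum>i<n. c i *\<^sub>R e' i) = (1 / k) *\<^sub>R ?x"
        by (simp add: e'_def scaleR_sum_right mult.commute)
      finally have eq: "(\<Sum>i<n. c i *\<^sub>R T (e' i)) = T ((1 / k) *\<^sub>R ?x)" .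
      have "a * nrm X ((1 / k) *\<^sub>R ?x) \<le> nrm Y (\<Sum>i<n. c i *\<^sub>R T (e' i))"
        unfolding eq using T_bound subspace_scale[OF sub x] by blast
      then have "C * nrm X ?x \<le> C * (k / a * nrm Y (\<Sum>i<n. c i *\<^sub>R T (e' i)))"
        using a k C(1) by (intro mult_left_mono) (simp_all add: seminormed_spaceD(3)[OF X x] field_simps)
      moreover have "(\<Sum>i<n. \<bar>c i\<bar>) \<le> C * nrm X ?x" using e by (simp add: l1_basis_def)
      ultimately show ?thesis by simp
    qed
    moreover have "T (e' i) \<in> pts Y" if "i < n" for i
      using T eX(3)[OF that] by (auto simp: linear_between_def)
    ultimately show ?thesis unfolding l1_basis_def by (intro exI[of _ "\<lambda>i. T (e' i)"]) simp
  qed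
  then show ?thesis
    unfolding uniformly_contains_l1_def using C(1) k a by (intro exI[of _ "C * k / a"]) simp
qed

section \<open>Finite dimension modulo null vectors\<close>

text \<open>
  This says that the quotient of \<open>X\<close> by its null vectors has finite dimension, which is the alternative
  to containing copies of \<open>\<ell>\<^sub>1\<^sup>n\<close> or \<open>\<ell>\<^sub>\<infinity>\<^sup>n\<close> in each of the concrete spaces below.
\<close>

definition finite_dimensional_mod_null :: "'v::real_vector nspace \<Rightarrow> bool"
  where "finite_dimensional_mod_null X \<longleftrightarrow>
    (\<exists>B. finite B \<and> B \<subseteq> pts X \<and> (\<forall>x\<in>pts X. \<exists>y\<in>span B. nrm X (x - y) = 0))"

text \<open>
  Each functional of \<open>\<Lambda>\<close> is split off in turn: its kernel in \<open>S\<close> has codimension at most \<open>1\<close>.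
\<close>

lemma separating_functionals_imp_finite_span:
  fixes S :: "'v::real_vector set" and \<Lambda> :: "('v \<Rightarrow> real) set"
  assumes "finite \<Lambda>" "subspace S"
    and "\<And>l x y. l \<in> \<Lambda> \<Longrightarrow> x \<in> S \<Longrightarrow> y \<in> S \<Longrightarrow> l (x + y) = l x + l y"
    and "\<And>l c x. l \<in> \<Lambda> \<Longrightarrow> x \<in> S \<Longrightarrow> l (c *\<^sub>R x) = c * l x"
    and "\<And>x. x \<in> S \<Longrightarrow> (\<And>l. l \<in> \<Lambda> \<Longrightarrow> l x = 0) \<Longrightarrow> x = 0"
  shows "\<exists>B. finite B \<and> B \<subseteq> S \<and> S \<subseteq> span B"
  using assms
proof (induction \<Lambda> arbitrary: S rule: finite_induct)
  case empty
  then have "S \<subseteq> {0}" by auto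
  then show ?case by (intro exI[of _ "{}"]) auto
next
  case (insert l \<Lambda>)
  note S = \<open>subspace S\<close>
  have l0: "l 0 = 0" using insert.prems(3)[of l 0 0] subspace_0[OF S] by simp
  define S' where "S' = {x \<in> S. l x = 0}"
  have S': "subspace S'"
    unfolding subspace_def S'_def
    using insert.prems(2)[of l] insert.prems(3)[of l] l0
    by (auto simp: subspace_0[OF S] subspace_add[OF S] subspace_scale[OF S])
  have "\<exists>B. finite B \<and> B \<subseteq> S' \<and> S' \<subseteq> span B"
  proof (rule insert.IH[OF S'])
    fix x assume x: "x \<in> S'" "\<And>k. k \<in> \<Lambda> \<Longrightarrow> k x = 0"
    then show "x = 0" by (intro insert.prems(4)) (auto simp: S'_def)
  qed (use insert.prems(2,3) in \<open>auto simp: S'_def\<close>)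
  then obtain B where B: "finite B" "B \<subseteq> S'" "S' \<subseteq> span B" by blast
  show ?case
  proof (cases "S' = S")
    case True
    then show ?thesis using B by blast
  next
    case False
    then obtain x0 where x0: "x0 \<in> S" "l x0 \<noteq> 0" by (auto simp: S'_def)
    have "x \<in> span (insert x0 B)" if x: "x \<in> S" for x
    proof -
      let ?c = "l x / l x0"
      have "l (x + (- ?c) *\<^sub>R x0) = l x + (- ?c) * l x0"
        using insert.prems(2)[OF insertI1 x subspace_scale[OF S x0(1), of "- ?c"]]
          insert.prems(3)[OF insertI1 x0(1), of "- ?c"] by (simp only:)
      then have "l (x + (- ?c) *\<^sub>R x0) = 0" using x0 by simp
      then have "x + (- ?c) *\<^sub>R x0 \<in> S'"
        using x x0 by (simp add: S'_def subspace_add[OF S] subspace_scale[OF S] del: scaleR_minus_left)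
      then have "x + (- ?c) *\<^sub>R x0 \<in> span (insert x0 B)"
        using B(3) span_mono[of B "insert x0 B"] by blast
      then have "(x + (- ?c) *\<^sub>R x0) + ?c *\<^sub>R x0 \<in> span (insert x0 B)"
        by (rule span_add) (intro span_scale span_base, simp)
      moreover have "(x + (- ?c) *\<^sub>R x0) + ?c *\<^sub>R x0 = x" by simp
      ultimately show ?thesis by (simp only:)
    qed
    then show ?thesis using B x0 by (intro exI[of _ "insert x0 B"]) (auto simp: S'_def)
  qed
qed

lemma finite_dimensional_mod_nullI:
  assumes "seminormed_space X" "finite B" "B \<subseteq> pts X" "pts X \<subseteq> span B"
  shows "finite_dimensional_mod_null X"
  unfolding finite_dimensional_mod_null_def
  using assms by (intro exI[of _ B]) (auto intro!: bexI simp: nrm_zero)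

lemma finite_dimensional_functions_on_finite_set:
  assumes X: "seminormed_space X" and S: "finite S" "\<And>f x. f \<in> pts X \<Longrightarrow> x \<notin> S \<Longrightarrow> f x = (0 :: real)"
  shows "finite_dimensional_mod_null X"
proof -
  have "\<exists>B. finite B \<and> B \<subseteq> pts X \<and> pts X \<subseteq> span B"
  proof (rule separating_functionals_imp_finite_span[where \<Lambda> = "(\<lambda>x f. f x) ` S"])
    fix f assume f: "f \<in> pts X" and 0: "\<And>l. l \<in> (\<lambda>x f. f x) ` S \<Longrightarrow> l f = 0"
    have "f x = 0" for x
    proof (cases "x \<in> S")
      case True
      then show ?thesis using 0[of "\<lambda>f. f x"] by simp
    qed (rule S(2)[OF f])
    then show "f = 0" by (simp add: fun_eq_iff)
  qed (use S(1) seminormed_spaceD(1)[OF X] in \<open>auto simp: scaleR_fun_def\<close>)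
  then show ?thesis using finite_dimensional_mod_nullI[OF X] by blast
qed

lemma infinite_dimensional_whole:
  assumes "infinite_dimensional TYPE('e::real_normed_vector)"
  shows "\<not> finite_dimensional_mod_null (whole :: 'e nspace)"
  using assms unfolding infinite_dimensional_def finite_dimensional_mod_null_def by auto

section \<open>Isometries and iterated duals\<close>

definition isometry_onto :: "'v::real_vector nspace \<Rightarrow> 'w::real_vector nspace \<Rightarrow> ('v \<Rightarrow> 'w) \<Rightarrow> bool"
  where "isometry_onto X Y T \<longleftrightarrow> linear_between (pts X) (pts Y) T \<and> T ` pts X = pts Y \<and>
         (\<forall>x\<in>pts X. nrm Y (T x) = nrm X x)"

lemma isometrically_isomorphic_iff: "isometrically_isomorphic X Y \<longleftrightarrow> (\<exists>T. isometry_onto X Y T)"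
  by (simp add: isometrically_isomorphic_def isometry_onto_def)

lemma isometry_onto_linear: "isometry_onto X Y T \<Longrightarrow> linear_between (pts X) (pts Y) T"
  by (simp add: isometry_onto_def)

lemma isometrically_isomorphic_imp_copy: "isometrically_isomorphic X Y \<Longrightarrow> contains_copy_of Y X"
  unfolding isometrically_isomorphic_def contains_copy_of_def
  by (elim exE) (intro exI[of _ "1 :: real"] exI, auto)

lemma isometry_ontoD:
  assumes "isometry_onto X Y T"
  shows "x \<in> pts X \<Longrightarrow> T x \<in> pts Y" "x \<in> pts X \<Longrightarrow> y \<in> pts X \<Longrightarrow> T (x + y) = T x + T y"
    "x \<in> pts X \<Longrightarrow> T (c *\<^sub>R x) = c *\<^sub>R T x" "x \<in> pts X \<Longrightarrow> nrm Y (T x) = nrm X x"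
    "u \<in> pts Y \<Longrightarrow> \<exists>x\<in>pts X. T x = u"
proof -
  have im: "T ` pts X = pts Y"
    and "\<forall>x\<in>pts X. \<forall>y\<in>pts X. T (x + y) = T x + T y" "\<forall>x\<in>pts X. \<forall>c. T (c *\<^sub>R x) = c *\<^sub>R T x"
      "\<forall>x\<in>pts X. nrm Y (T x) = nrm X x"
    using assms by (simp_all add: isometry_onto_def linear_between_def)
  then show "x \<in> pts X \<Longrightarrow> y \<in> pts X \<Longrightarrow> T (x + y) = T x + T y"
    "x \<in> pts X \<Longrightarrow> T (c *\<^sub>R x) = c *\<^sub>R T x" "x \<in> pts X \<Longrightarrow> nrm Y (T x) = nrm X x"
    by simp_all
  show "x \<in> pts X \<Longrightarrow> T x \<in> pts Y" by (simp add: im[symmetric])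
  show "u \<in> pts Y \<Longrightarrow> \<exists>x\<in>pts X. T x = u" unfolding im[symmetric] by auto
qed

lemma isometry_onto_diff:
  assumes X: "seminormed_space X" and T: "isometry_onto X Y T" and x: "x \<in> pts X" "y \<in> pts X"
  shows "T (x - y) = T x - T y"
  using isometry_ontoD(2)[OF T x(1), of "(-1) *\<^sub>R y"] isometry_ontoD(3)[OF T x(2), of "-1"]
    subspace_scale[OF seminormed_spaceD(1)[OF X] x(2), of "-1"] by simp

lemma seminormed_isometric:
  assumes X: "seminormed_space X" and T: "isometry_onto X Y T"
  shows "seminormed_space Y"
proof -
  note sub = seminormed_spaceD(1)[OF X] and T' = isometry_ontoD[OF T]
  have "subspace (pts Y)"
    unfolding subspace_def
  proof (intro conjI ballI allI)
    show "0 \<in> pts Y" using T'(1)[OF subspace_0[OF sub]] T'(3)[OF subspace_0[OF sub], of 0] by simp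
  next
    fix u v assume "u \<in> pts Y" "v \<in> pts Y"
    then obtain x y where "x \<in> pts X" "T x = u" "y \<in> pts X" "T y = v" using T'(5) by blast
    then show "u + v \<in> pts Y" using T'(1)[OF subspace_add[OF sub], of x y] T'(2)[of x y] by simp
  next
    fix c u assume "u \<in> pts Y"
    then obtain x where "x \<in> pts X" "T x = u" using T'(5) by blast
    then show "c *\<^sub>R u \<in> pts Y" using T'(1)[OF subspace_scale[OF sub], of x c] T'(3)[of x c] by simp
  qed
  moreover have "0 \<le> nrm Y u \<and> nrm Y (c *\<^sub>R u) = \<bar>c\<bar> * nrm Y u" if u: "u \<in> pts Y" for u c
  proof -
    obtain x where x: "x \<in> pts X" "T x = u" using T'(5)[OF u] by blast
    show ?thesis using seminormed_spaceD(2,3)[OF X x(1)] T'(4)[OF x(1)]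
      T'(4)[OF subspace_scale[OF sub x(1), of c]] T'(3)[OF x(1), of c] x(2) by simp
  qed
  moreover have "nrm Y (u + v) \<le> nrm Y u + nrm Y v" if uv: "u \<in> pts Y" "v \<in> pts Y" for u v
  proof -
    obtain x y where "x \<in> pts X" "T x = u" "y \<in> pts X" "T y = v" using T'(5) uv by blast
    then show ?thesis using seminormed_spaceD(4)[OF X, of x y] T'(4)[of x] T'(4)[of y]
      T'(4)[OF subspace_add[OF sub], of x y] T'(2)[of x y] by simp
  qed
  ultimately show ?thesis unfolding seminormed_space_def by blast
qed

text \<open>
  On seminormed spaces an isometry need not be injective.  A functional on \<open>X\<close> is moved to \<open>Y\<close> along an
  arbitrary choice of preimages; the choice does not matter because bounded functionals vanish on null
  vectors.
\<close>

lemma dual_isometric: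
  assumes X: "seminormed_space X" and T: "isometry_onto X Y T"
  shows "\<exists>S. isometry_onto (dual_space X) (dual_space Y) S \<and>
    (\<forall>h\<in>pts (dual_space X). \<forall>x\<in>pts X. S h (T x) = h x)"
proof -
  note Y = seminormed_isometric[OF X T] and T' = isometry_ontoD[OF T]
  note subX = subspace_0[OF seminormed_spaceD(1)[OF X]] subspace_add[OF seminormed_spaceD(1)[OF X]]
    subspace_scale[OF seminormed_spaceD(1)[OF X]]
  define S where "S h = (\<lambda>y. if y \<in> pts Y then h (inv_into (pts X) T y) else 0)" for h :: "'a \<Rightarrow> real"
  have ST: "S h (T x) = h x" if h: "h \<in> pts (dual_space X)" and x: "x \<in> pts X" for h x
  proof -
    let ?x = "inv_into (pts X) T (T x)"
    have x': "?x \<in> pts X" "T ?x = T x"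
      using x by (auto intro: inv_into_into f_inv_into_f)
    have d: "?x - x \<in> pts X" using subspace_diff[OF seminormed_spaceD(1)[OF X]] x x' by blast
    have "nrm X (?x - x) = 0"
      using T'(4)[OF d] isometry_onto_diff[OF X T x'(1) x] x'(2) nrm_zero[OF Y] by simp
    then have "h (?x - x) = 0" using dual_norm_bound[OF X h d] by simp
    moreover have "h (x + (?x - x)) = h x + h (?x - x)" by (rule dual_spaceD(1)[OF h x d])
    ultimately show ?thesis using T'(1)[OF x] by (simp add: S_def)
  qed
  have S_bound: "functional_bound Y (S h) (nrm (dual_space X) h)" if h: "h \<in> pts (dual_space X)" for h
  proof (rule functional_boundI)
    fix u v assume "u \<in> pts Y" "v \<in> pts Y"
    then obtain x y where x: "x \<in> pts X" "T x = u" and y: "y \<in> pts X" "T y = v" using T'(5) by blast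
    have "S h (T (x + y)) = h (x + y)" using x y subX(2) by (intro ST[OF h]) simp
    then show "S h (u + v) = S h u + S h v"
      using x y T'(2)[of x y] dual_spaceD(1)[OF h, of x y] ST[OF h x(1)] ST[OF h y(1)] by simp
  next
    fix c u assume "u \<in> pts Y"
    then obtain x where x: "x \<in> pts X" "T x = u" using T'(5) by blast
    have "S h (T (c *\<^sub>R x)) = h (c *\<^sub>R x)" using x subX(3) by (intro ST[OF h]) simp
    then show "S h (c *\<^sub>R u) = c * S h u"
      using x T'(3)[of x c] dual_spaceD(2)[OF h, of x c] ST[OF h x(1)] by simp
  next
    fix y assume "y \<in> pts Y"
    then obtain x where x: "x \<in> pts X" "T x = y" using T'(5) by blast
    show "\<bar>S h y\<bar> \<le> nrm (dual_space X) h * nrm Y y"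
      using dual_norm_bound[OF X h x(1)] ST[OF h x(1)] T'(4)[OF x(1)] x(2) by simp
  qed (simp add: S_def)
  have S_mem: "S h \<in> pts (dual_space Y)" "nrm (dual_space Y) (S h) \<le> nrm (dual_space X) h"
    if "h \<in> pts (dual_space X)" for h
    using functional_bound_imp_dual[OF S_bound dual_norm_nonneg[OF X]] that by simp_all
  have pullback: "functional_bound X (\<lambda>x. if x \<in> pts X then g (T x) else 0) (nrm (dual_space Y) g)"
    if g: "g \<in> pts (dual_space Y)" for g
  proof (rule functional_boundI)
    fix x assume x: "x \<in> pts X"
    then show "\<bar>if x \<in> pts X then g (T x) else 0\<bar> \<le> nrm (dual_space Y) g * nrm X x"
      using dual_norm_bound[OF Y g T'(1)[OF x]] T'(4)[OF x] by simp
  qed (auto simp: dual_spaceD[OF g] T' subX)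
  have S_norm: "nrm (dual_space Y) (S h) = nrm (dual_space X) h" if h: "h \<in> pts (dual_space X)" for h
  proof (rule antisym[OF S_mem(2)[OF h]])
    have "(\<lambda>x. if x \<in> pts X then S h (T x) else 0) = h"
      using ST[OF h] dual_spaceD(3)[OF h] by (auto simp: fun_eq_iff)
    then show "nrm (dual_space X) h \<le> nrm (dual_space Y) (S h)"
      using functional_bound_imp_dual[OF pullback[OF S_mem(1)[OF h]] dual_norm_nonneg[OF Y S_mem(1)[OF h]]] by simp
  qed
  have onto: "\<exists>h\<in>pts (dual_space X). S h = g" if g: "g \<in> pts (dual_space Y)" for g
  proof -
    define h where "h = (\<lambda>x. if x \<in> pts X then g (T x) else 0)"
    have h: "h \<in> pts (dual_space X)"
      using functional_bound_imp_dual[OF pullback[OF g] dual_norm_nonneg[OF Y g]] by (simp add: h_def)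
    have "S h y = g y" for y
    proof (cases "y \<in> pts Y")
      case True
      then obtain x where x: "x \<in> pts X" "T x = y" using T'(5) by blast
      then show ?thesis using ST[OF h x(1)] by (simp add: h_def)
    next
      case False
      then show ?thesis using dual_spaceD(3)[OF g] by (simp add: S_def)
    qed
    then show ?thesis using h by blast
  qed
  have "isometry_onto (dual_space X) (dual_space Y) S"
    unfolding isometry_onto_def linear_between_def
  proof (intro conjI ballI allI subset_antisym subsetI)
    fix h k assume "h \<in> pts (dual_space X)" "k \<in> pts (dual_space X)"
    show "S (h + k) = S h + S k" by (simp add: S_def fun_eq_iff)
  next
    fix h c assume "h \<in> pts (dual_space X)"
    show "S (c *\<^sub>R h) = c *\<^sub>R S h" by (simp add: S_def fun_eq_iff scaleR_fun_def)
  next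
    fix g assume "g \<in> pts (dual_space Y)"
    then show "g \<in> S ` pts (dual_space X)" using onto[of g] by blast
  qed (use S_mem S_norm in auto)
  then show ?thesis using ST by blast
qed

lemma dual_isometrically_isomorphic:
  "seminormed_space X \<Longrightarrow> isometrically_isomorphic X Y \<Longrightarrow>
    isometrically_isomorphic (dual_space X) (dual_space Y)"
  using dual_isometric unfolding isometrically_isomorphic_iff by meson

lemma l1_systems_isometric:
  assumes X: "seminormed_space X" and iso: "isometrically_isomorphic X Y" and l1: "has_l1_systems X"
  shows "has_l1_systems Y"
proof -
  obtain T where T: "isometry_onto X Y T" using iso isometrically_isomorphic_iff by blast
  obtain S where S: "isometry_onto (dual_space X) (dual_space Y) S"
    "\<And>h x. h \<in> pts (dual_space X) \<Longrightarrow> x \<in> pts X \<Longrightarrow> S h (T x) = h x"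
    using dual_isometric[OF X T] by blast
  obtain C where C: "\<forall>n. \<exists>e. l1_system X C n e" using l1 unfolding has_l1_systems_def by blast
  have "\<exists>e. l1_system Y C n e" for n
  proof -
    obtain e where e: "l1_system X C n e" using C by blast
    have "\<exists>g. g \<in> pts (dual_space Y) \<and> nrm (dual_space Y) g \<le> C \<and> (\<forall>i<n. g (T (e i)) = \<epsilon> i)"
      if \<epsilon>: "\<forall>i. \<epsilon> i \<in> {-1, 1}" for \<epsilon>
    proof -
      obtain h where h: "h \<in> pts (dual_space X)" "nrm (dual_space X) h \<le> C" "\<forall>i<n. h (e i) = \<epsilon> i"
        using e \<epsilon> unfolding l1_system_def by blast
      show ?thesis
        using isometry_ontoD(1,4)[OF S(1) h(1)] S(2)[OF h(1)] h e
        by (intro exI[of _ "S h"]) (simp add: l1_system_def)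
    qed
    then show ?thesis
      using e isometry_ontoD(1,4)[OF T] by (intro exI[of _ "\<lambda>i. T (e i)"]) (simp add: l1_system_def)
  qed
  then show ?thesis unfolding has_l1_systems_def by blast
qed

lemma finite_dimensional_mod_null_isometric:
  assumes X: "seminormed_space X" and iso: "isometrically_isomorphic X Y" and "finite_dimensional_mod_null X"
  shows "finite_dimensional_mod_null Y"
proof -
  obtain T where T: "isometry_onto X Y T" using iso isometrically_isomorphic_iff by blast
  obtain B where B: "finite B" "B \<subseteq> pts X" "\<forall>x\<in>pts X. \<exists>y\<in>span B. nrm X (x - y) = 0"
    using assms(3) unfolding finite_dimensional_mod_null_def by blast
  note sub = seminormed_spaceD(1)[OF X] and T' = isometry_ontoD[OF T]
  have spanB: "span B \<subseteq> pts X" using B(2) sub by (rule span_minimal)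
  have "y \<in> pts X \<and> T y \<in> span (T ` B)" if "y \<in> span B" for y
    using that
  proof (induction rule: span_induct_alt)
    case base
    show ?case using T'(3)[OF subspace_0[OF sub], of 0] by (simp add: span_zero subspace_0[OF sub])
  next
    case (step c x y)
    have x: "x \<in> pts X" using step.hyps B(2) by (rule rev_subsetD)
    have y: "y \<in> pts X" using step by blast
    have "T (c *\<^sub>R x + y) = c *\<^sub>R T x + T y"
      using T'(2)[OF subspace_scale[OF sub x] y] T'(3)[OF x] by simp
    then show ?case using step x
      by (simp add: span_add span_scale span_base subspace_add[OF sub] subspace_scale[OF sub])
  qed
  then have T_span: "T y \<in> span (T ` B)" if "y \<in> span B" for y using that by blast
  show ?thesis
    unfolding finite_dimensional_mod_null_def
  proof (intro exI[of _ "T ` B"] conjI ballI)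
    fix u assume "u \<in> pts Y"
    then obtain x where x: "x \<in> pts X" "T x = u" using T'(5) by blast
    then obtain y where y: "y \<in> span B" "nrm X (x - y) = 0" using B(3) by blast
    then have y': "y \<in> pts X" using spanB by blast
    have "nrm Y (u - T y) = 0"
      using isometry_onto_diff[OF X T x(1) y'] x y(2) T'(4)[OF subspace_diff[OF sub x(1) y']] by simp
    then show "\<exists>v\<in>span (T ` B). nrm Y (u - v) = 0" using T_span[OF y(1)] by blast
  qed (use B T'(1) in auto)
qed

lemma finite_dimensional_mod_null_dual:
  assumes X: "seminormed_space X" and "finite_dimensional_mod_null X"
  shows "finite_dimensional_mod_null (dual_space X)"
proof -
  obtain B where B: "finite B" "B \<subseteq> pts X" "\<forall>x\<in>pts X. \<exists>y\<in>span B. nrm X (x - y) = 0"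
    using assms(2) unfolding finite_dimensional_mod_null_def by blast
  note sub = seminormed_spaceD(1)[OF X] and D = seminormed_dual_space[OF X]
  have spanB: "span B \<subseteq> pts X" using B(2) sub by (rule span_minimal)
  have "\<exists>A. finite A \<and> A \<subseteq> pts (dual_space X) \<and> pts (dual_space X) \<subseteq> span A"
  proof (rule separating_functionals_imp_finite_span[where \<Lambda> = "(\<lambda>b \<phi>. \<phi> b) ` B"])
    fix \<phi> assume \<phi>: "\<phi> \<in> pts (dual_space X)" and 0: "\<And>l. l \<in> (\<lambda>b \<phi>. \<phi> b) ` B \<Longrightarrow> l \<phi> = 0"
    have "y \<in> pts X \<and> \<phi> y = 0" if "y \<in> span B" for y
      using that
    proof (induction rule: span_induct_alt)
      case base
      show ?case using dual_spaceD(2)[OF \<phi> subspace_0[OF sub], of 0] subspace_0[OF sub] by simp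
    next
      case (step c x y)
      have x: "x \<in> pts X" using step.hyps B(2) by (rule rev_subsetD)
      have y: "y \<in> pts X" using step by blast
      note xy = x y subspace_scale[OF sub x, of c]
      have "\<phi> x = 0" by (rule 0[of "\<lambda>\<phi>. \<phi> x"]) (use step.hyps in simp)
      then show ?case using step xy dual_spaceD(1,2)[OF \<phi>] subspace_add[OF sub] by simp
    qed
    then have zero: "\<phi> y = 0" if "y \<in> span B" for y using that by blast
    have "\<phi> x = 0" for x
    proof (cases "x \<in> pts X")
      case True
      then obtain y where y: "y \<in> span B" "nrm X (x - y) = 0" using B(3) by blast
      then have y': "y \<in> pts X" using spanB by blast
      have d: "x - y \<in> pts X" by (rule subspace_diff[OF sub True y'])
      have "\<phi> (y + (x - y)) = \<phi> y + \<phi> (x - y)" by (rule dual_spaceD(1)[OF \<phi> y' d])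
      moreover have "\<phi> (x - y) = 0" using dual_norm_bound[OF X \<phi> d] y(2) by simp
      ultimately show ?thesis using zero[OF y(1)] by simp
    qed (rule dual_spaceD(3)[OF \<phi>])
    then show "\<phi> = 0" by (simp add: fun_eq_iff)
  qed (use B(1) seminormed_spaceD(1)[OF D] in \<open>auto simp: scaleR_fun_def\<close>)
  then show ?thesis using finite_dimensional_mod_nullI[OF D] by blast
qed

text \<open>
  Even duals inherit the systems from \<open>X\<close> and odd duals from the first dual, so one copy of \<open>\<ell>\<^sub>\<infinity>\<^sup>n\<close> in
  \<open>X\<close> settles all iterated duals.
\<close>

lemma iterated_dual_dichotomy:
  assumes X: "seminormed_space X" and dual: "iterated_dual TYPE('u::real_vector) n X Y"
    and alt: "has_linf_systems X (dual_space X) \<or> finite_dimensional_mod_null X"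
  shows "has_l1_systems Y \<or> finite_dimensional_mod_null Y"
proof -
  obtain F :: "nat \<Rightarrow> 'u nspace" where F: "\<And>i. i \<le> n \<Longrightarrow> normed_space (F i)"
    and iso: "isometrically_isomorphic X (F 0)"
      "\<And>i. i < n \<Longrightarrow> isometrically_isomorphic (dual_space (F i)) (F (Suc i))"
      "isometrically_isomorphic (F n) Y"
    using dual unfolding iterated_dual_def by blast
  have sF: "seminormed_space (F i)" if "i \<le> n" for i using F[OF that] by (rule normed_imp_seminormed)
  note sD = seminormed_dual_space
  note dual_iso = dual_isometrically_isomorphic
  from alt show ?thesis
  proof
    assume linf: "has_linf_systems X (dual_space X)"
    have "has_l1_systems (F i)" if "i \<le> n" for i
      using that
    proof (induction i rule: less_induct)
      case (less i)
      consider "i = 0" | "i = 1" | j where "i = Suc (Suc j)"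
        by (cases i; cases "i - 1") auto
      then show ?case
      proof cases
        case 1
        have "has_l1_systems X" by (rule linf_systems_imp_l1_systems[OF X dual_subspace_dual[OF X] linf])
        then show ?thesis unfolding 1 by (rule l1_systems_isometric[OF X iso(1)])
      next
        case 2
        then have "isometrically_isomorphic (dual_space (F 0)) (F i)" using iso(2)[of 0] less.prems by simp
        moreover have "has_l1_systems (dual_space X)"
          by (rule linf_systems_imp_l1_systems_dual[OF X dual_subspace_dual[OF X] linf])
        then have "has_l1_systems (dual_space (F 0))"
          by (rule l1_systems_isometric[OF sD[OF X] dual_iso[OF X iso(1)]])
        ultimately show ?thesis by (rule l1_systems_isometric[OF sD[OF sF[OF le0]]])
      next
        case (3 j)
        then have j: "j \<le> n" "Suc j \<le> n" "j < n" "Suc j < n" using less.prems by auto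
        have "has_l1_systems (F j)" using less.IH[of j] 3 j by simp
        then have "has_l1_systems (dual_space (dual_space (F j)))" by (rule l1_systems_bidual[OF sF[OF j(1)]])
        then have "has_l1_systems (dual_space (F (Suc j)))"
          by (rule l1_systems_isometric[OF sD[OF sD[OF sF[OF j(1)]]] dual_iso[OF sD[OF sF[OF j(1)]] iso(2)[OF j(3)]]])
        then show ?thesis
          unfolding 3 by (rule l1_systems_isometric[OF sD[OF sF[OF j(2)]] iso(2)[OF j(4)]])
      qed
    qed
    then show ?thesis using l1_systems_isometric[OF sF iso(3)] by blast
  next
    assume fin: "finite_dimensional_mod_null X"
    have "finite_dimensional_mod_null (F i)" if "i \<le> n" for i
      using that
    proof (induction i)
      case 0
      show ?case by (rule finite_dimensional_mod_null_isometric[OF X iso(1) fin])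
    next
      case (Suc i)
      then have i: "i \<le> n" "i < n" by simp_all
      have "finite_dimensional_mod_null (dual_space (F i))"
        using Suc by (intro finite_dimensional_mod_null_dual[OF sF[OF i(1)]]) simp
      then show ?case by (rule finite_dimensional_mod_null_isometric[OF sD[OF sF[OF i(1)]] iso(2)[OF i(2)]])
    qed
    then show ?thesis using finite_dimensional_mod_null_isometric[OF sF iso(3)] by blast
  qed
qed

section \<open>Continuous functions vanishing at infinity\<close>

lemma finite_disjoint_neighbourhoods:
  assumes Y: "Hausdorff_space Y" and p: "inj_on p {..<n :: nat}" "p ` {..<n} \<subseteq> topspace Y"
  shows "\<exists>W. (\<forall>i<n. openin Y (W i) \<and> p i \<in> W i) \<and> (\<forall>i<n. \<forall>j<n. i \<noteq> j \<longrightarrow> W i \<inter> W j = {})"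
proof -
  have "\<forall>i j. \<exists>U V. i < n \<and> j < n \<and> i \<noteq> j \<longrightarrow> openin Y U \<and> openin Y V \<and> p i \<in> U \<and> p j \<in> V \<and> disjnt U V"
  proof (intro allI)
    fix i j
    show "\<exists>U V. i < n \<and> j < n \<and> i \<noteq> j \<longrightarrow> openin Y U \<and> openin Y V \<and> p i \<in> U \<and> p j \<in> V \<and> disjnt U V"
    proof (cases "i < n \<and> j < n \<and> i \<noteq> j")
      case True
      then have "p i \<in> topspace Y" "p j \<in> topspace Y" "p i \<noteq> p j"
        using p by (auto simp: inj_on_def)
      then have "\<exists>U V. openin Y U \<and> openin Y V \<and> p i \<in> U \<and> p j \<in> V \<and> disjnt U V"
        using Y unfolding Hausdorff_space_def by blast
      then show ?thesis by (elim exE) (intro exI impI)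
    qed (intro exI impI, blast)
  qed
  then obtain U V where UV: "\<And>i j. i < n \<Longrightarrow> j < n \<Longrightarrow> i \<noteq> j \<Longrightarrow>
      openin Y (U i j) \<and> openin Y (V i j) \<and> p i \<in> U i j \<and> p j \<in> V i j \<and> disjnt (U i j) (V i j)"
    by metis
  define W where "W i = (topspace Y \<inter> \<Inter>((\<lambda>j. U i j \<inter> V j i) ` ({..<n} - {i})))" for i
  show ?thesis
  proof (intro exI[of _ W] conjI allI impI)
    fix i assume i: "i < n"
    show "openin Y (W i)"
      unfolding W_def
      by (intro openin_Int_Inter) (use UV i in \<open>auto intro!: openin_Int\<close>)
    show "p i \<in> W i" using UV i p(2) by (auto simp: W_def)
  next
    fix i j assume ij: "i < n" "j < n" "i \<noteq> j"
    then have "W i \<subseteq> U i j" "W j \<subseteq> V i j" by (auto simp: W_def)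
    then show "W i \<inter> W j = {}" using UV[OF ij] by (auto simp: disjnt_def)
  qed
qed

lemma C0_memD:
  assumes "f \<in> pts (C0_space Y)"
  shows "continuous_map Y euclideanreal f" "x \<notin> topspace Y \<Longrightarrow> f x = 0"
    "0 < \<epsilon> \<Longrightarrow> compactin Y {x \<in> topspace Y. \<epsilon> \<le> \<bar>f x\<bar>}"
  using assms unfolding C0_space_def by auto

lemma C0_norm_eq: "nrm (C0_space Y) f = Sup0 ((\<lambda>x. \<bar>f x\<bar>) ` topspace Y)"
  by (simp add: C0_space_def sup_norm_def)

lemma C0_bounded:
  assumes f: "f \<in> pts (C0_space Y)"
  shows "\<exists>C. \<forall>a\<in>(\<lambda>x. \<bar>f x\<bar>) ` topspace Y. a \<le> C"
proof -
  have "compactin euclideanreal (f ` {x \<in> topspace Y. 1 \<le> \<bar>f x\<bar>})"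
    using C0_memD(3)[OF f, of 1] C0_memD(1)[OF f] image_compactin by fastforce
  then have "bounded (f ` {x \<in> topspace Y. 1 \<le> \<bar>f x\<bar>})"
    by (simp add: compact_imp_bounded)
  then obtain C where C: "\<And>x. x \<in> topspace Y \<Longrightarrow> 1 \<le> \<bar>f x\<bar> \<Longrightarrow> \<bar>f x\<bar> \<le> C"
    unfolding bounded_iff by auto
  have "\<bar>f x\<bar> \<le> max C 1" if "x \<in> topspace Y" for x
    using C[OF that] by (cases "1 \<le> \<bar>f x\<bar>") auto
  then show ?thesis by blast
qed

lemma C0_norm_nonneg: "f \<in> pts (C0_space Y) \<Longrightarrow> 0 \<le> nrm (C0_space Y) f"
  unfolding C0_norm_eq by (rule Sup0_nonneg[OF C0_bounded])

lemma C0_norm_bound: "f \<in> pts (C0_space Y) \<Longrightarrow> x \<in> topspace Y \<Longrightarrow> \<bar>f x\<bar> \<le> nrm (C0_space Y) f"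
  unfolding C0_norm_eq by (rule le_Sup0[OF _ C0_bounded]) auto

lemma C0_norm_le: "(\<And>x. x \<in> topspace Y \<Longrightarrow> \<bar>f x\<bar> \<le> C) \<Longrightarrow> 0 \<le> C \<Longrightarrow> nrm (C0_space Y) f \<le> C"
  unfolding C0_norm_eq by (rule Sup0_le) auto

lemma closedin_ge_abs:
  assumes "continuous_map Y euclideanreal f"
  shows "closedin Y {x \<in> topspace Y. \<epsilon> \<le> \<bar>f x\<bar>}"
proof -
  have "continuous_map Y euclideanreal (\<lambda>x. \<bar>f x\<bar>)"
    using assms by (rule continuous_map_real_abs)
  moreover have "closedin euclideanreal {\<epsilon>..}" by simp
  ultimately have "closedin Y {x \<in> topspace Y. \<bar>f x\<bar> \<in> {\<epsilon>..}}"
    by (rule closedin_continuous_map_preimage)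
  then show ?thesis by simp
qed

lemma seminormed_C0: "seminormed_space (C0_space Y)"
proof (rule seminormed_space_if_least_bound[where
      Q = "\<lambda>f C. f \<in> pts (C0_space Y) \<and> (\<forall>x\<in>topspace Y. \<bar>f x\<bar> \<le> C)"])
  fix f g C D
  assume f: "f \<in> pts (C0_space Y) \<and> (\<forall>x\<in>topspace Y. \<bar>f x\<bar> \<le> C)"
    and g: "g \<in> pts (C0_space Y) \<and> (\<forall>x\<in>topspace Y. \<bar>g x\<bar> \<le> D)"
  have cont: "continuous_map Y euclideanreal (\<lambda>x. f x + g x)"
    using C0_memD(1) f g by (intro continuous_map_add) auto
  have "compactin Y {x \<in> topspace Y. \<epsilon> \<le> \<bar>f x + g x\<bar>}" if \<epsilon>: "0 < \<epsilon>" for \<epsilon>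
  proof (rule closed_compactin)
    show "compactin Y ({x \<in> topspace Y. \<epsilon> / 2 \<le> \<bar>f x\<bar>} \<union> {x \<in> topspace Y. \<epsilon> / 2 \<le> \<bar>g x\<bar>})"
      using \<epsilon> f g by (intro compactin_Un C0_memD(3)) auto
    show "{x \<in> topspace Y. \<epsilon> \<le> \<bar>f x + g x\<bar>}
        \<subseteq> {x \<in> topspace Y. \<epsilon> / 2 \<le> \<bar>f x\<bar>} \<union> {x \<in> topspace Y. \<epsilon> / 2 \<le> \<bar>g x\<bar>}"
      by auto
  qed (rule closedin_ge_abs[OF cont])
  then have "f + g \<in> pts (C0_space Y)"
    using cont C0_memD(2) f g by (simp add: C0_space_def plus_fun_def)
  moreover have "\<bar>(f + g) x\<bar> \<le> C + D" if "x \<in> topspace Y" for x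
  proof -
    have "\<bar>f x\<bar> \<le> C" "\<bar>g x\<bar> \<le> D" using f g that by blast+
    then show ?thesis by simp
  qed
  ultimately show "f + g \<in> pts (C0_space Y) \<and> (\<forall>x\<in>topspace Y. \<bar>(f + g) x\<bar> \<le> C + D)" by blast
next
  fix f c C assume f: "f \<in> pts (C0_space Y) \<and> (\<forall>x\<in>topspace Y. \<bar>f x\<bar> \<le> C)"
  have cont: "continuous_map Y euclideanreal (\<lambda>x. c * f x)"
    using C0_memD(1) f by (intro continuous_map_real_mult_left) auto
  have "compactin Y {x \<in> topspace Y. \<epsilon> \<le> \<bar>c * f x\<bar>}" if \<epsilon>: "0 < \<epsilon>" for \<epsilon>
  proof (cases "c = 0")
    case False
    then have "{x \<in> topspace Y. \<epsilon> \<le> \<bar>c * f x\<bar>} = {x \<in> topspace Y. \<epsilon> / \<bar>c\<bar> \<le> \<bar>f x\<bar>}"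
      by (auto simp: abs_mult divide_le_eq mult.commute)
    then show ?thesis using C0_memD(3)[of f Y "\<epsilon> / \<bar>c\<bar>"] f \<epsilon> False by simp
  qed (use \<epsilon> in simp)
  then show "c *\<^sub>R f \<in> pts (C0_space Y) \<and> (\<forall>x\<in>topspace Y. \<bar>(c *\<^sub>R f) x\<bar> \<le> \<bar>c\<bar> * C)"
    using cont C0_memD(2) f by (simp add: C0_space_def scaleR_fun_def abs_mult mult_left_mono)
qed (simp_all add: C0_norm_nonneg C0_norm_bound C0_norm_le, simp add: C0_space_def zero_fun_def)

lemma bump_function_exists:
  assumes Y: "Hausdorff_space Y" "locally_compact_space Y" and W: "openin Y W" "p \<in> W"
  shows "\<exists>g\<in>pts (C0_space Y). g p = 1 \<and> (\<forall>x. 0 \<le> g x \<and> g x \<le> 1) \<and> (\<forall>x. x \<notin> W \<longrightarrow> g x = 0)"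
proof -
  have "neighbourhood_base_of (\<lambda>C. compactin Y C \<and> closedin Y C) Y"
    using locally_compact_space_neighbourhood_base_closedin[of Y] Y by blast
  then obtain V K where VK: "openin Y V" "compactin Y K" "p \<in> V" "V \<subseteq> K" "K \<subseteq> W"
    using W unfolding neighbourhood_base_of by meson
  have p: "p \<in> topspace Y" using W openin_subset by blast
  have "completely_regular_space Y"
    using locally_compact_regular_imp_completely_regular_space Y by blast
  moreover have "closedin Y (topspace Y - V)" using VK(1) by blast
  moreover have "p \<in> topspace Y - (topspace Y - V)" using p VK(3) by blast
  ultimately obtain f :: "'a \<Rightarrow> real" where f: "continuous_map Y (top_of_set {0..1}) f" "f p = 0"
    "f ` (topspace Y - V) \<subseteq> {1}"
    unfolding completely_regular_space_def by meson
  have f01: "f x \<in> {0..1}" if "x \<in> topspace Y" for x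
    using f(1) that by (auto simp: continuous_map_in_subtopology)
  have fc: "continuous_map Y euclideanreal f" using f(1) continuous_map_in_subtopology by blast
  define g where "g x = (if x \<in> topspace Y then 1 - f x else 0)" for x
  have "continuous_map Y euclideanreal (\<lambda>x. 1 - f x)"
    using fc by (intro continuous_map_diff) auto
  then have gc: "continuous_map Y euclideanreal g"
    by (rule continuous_map_eq) (simp add: g_def)
  have g_out: "g x = 0" if "x \<notin> V" for x using f(3) that by (auto simp: g_def)
  have "compactin Y {x \<in> topspace Y. \<epsilon> \<le> \<bar>g x\<bar>}" if "0 < \<epsilon>" for \<epsilon>
  proof (rule closed_compactin[OF VK(2)])
    show "{x \<in> topspace Y. \<epsilon> \<le> \<bar>g x\<bar>} \<subseteq> K"
    proof clarify
      fix x assume "\<epsilon> \<le> \<bar>g x\<bar>"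
      then have "x \<in> V" using g_out[of x] that by force
      then show "x \<in> K" using VK(4) by blast
    qed
  qed (rule closedin_ge_abs[OF gc])
  then have "g \<in> pts (C0_space Y)" using gc by (simp add: C0_space_def g_def)
  moreover have "g p = 1" using p f(2) by (simp add: g_def)
  moreover have "0 \<le> g x \<and> g x \<le> 1" for x using f01[of x] by (simp add: g_def)
  moreover have "g x = 0" if "x \<notin> W" for x using g_out[of x] VK(4,5) that by blast
  ultimately show ?thesis by blast
qed

text \<open>
  At each point at most one of the bumps is active, so their signed sums have norm at most \<open>1\<close>.
\<close>

lemma disjoint_bumps_exist:
  assumes Y: "Hausdorff_space Y" "locally_compact_space Y" and inf: "infinite (topspace Y)"
  shows "\<exists>g p. (\<forall>i<n :: nat. g i \<in> pts (C0_space Y) \<and> p i \<in> topspace Y) \<and>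
    (\<forall>i<n. \<forall>j<n. g i (p j) = (if i = j then 1 else 0)) \<and>
    (\<forall>\<epsilon>. (\<forall>i. \<bar>\<epsilon> i\<bar> \<le> 1) \<longrightarrow> nrm (C0_space Y) (\<Sum>i<n. \<epsilon> i *\<^sub>R g i) \<le> 1)"
proof -
  obtain p :: "nat \<Rightarrow> 'a" where p: "inj p" "range p \<subseteq> topspace Y"
    using infinite_countable_subset[OF inf] by blast
  have "inj_on p {..<n}" "p ` {..<n} \<subseteq> topspace Y" using p by (auto intro: inj_on_subset)
  from finite_disjoint_neighbourhoods[OF Y(1) this] obtain W
    where W': "\<forall>i<n. openin Y (W i) \<and> p i \<in> W i" "\<forall>i<n. \<forall>j<n. i \<noteq> j \<longrightarrow> W i \<inter> W j = {}"
    by (elim exE conjE) (rule that)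
  have W: "openin Y (W i)" "p i \<in> W i" if "i < n" for i using W'(1) that by simp_all
  have W_disj: "W i \<inter> W j = {}" if "i < n" "j < n" "i \<noteq> j" for i j using W'(2) that by simp
  have "\<exists>g. i < n \<longrightarrow> g \<in> pts (C0_space Y) \<and> g (p i) = 1 \<and> (\<forall>x. 0 \<le> g x \<and> g x \<le> 1) \<and>
      (\<forall>x. x \<notin> W i \<longrightarrow> g x = 0)" for i
  proof (cases "i < n")
    case True
    from bump_function_exists[OF Y W(1,2)[OF this]] show ?thesis unfolding Bex_def
      by (elim exE) (intro exI impI)
  qed simp
  then have "\<forall>i. \<exists>g. i < n \<longrightarrow> g \<in> pts (C0_space Y) \<and> g (p i) = 1 \<and> (\<forall>x. 0 \<le> g x \<and> g x \<le> 1) \<and>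
      (\<forall>x. x \<notin> W i \<longrightarrow> g x = 0)" by (rule allI)
  from choice[OF this] obtain g where g': "\<forall>i. i < n \<longrightarrow> g i \<in> pts (C0_space Y) \<and> g i (p i) = 1 \<and>
      (\<forall>x. 0 \<le> g i x \<and> g i x \<le> 1) \<and> (\<forall>x. x \<notin> W i \<longrightarrow> g i x = 0)"
    by (elim exE) (rule that)
  have g: "g i \<in> pts (C0_space Y)" "g i (p i) = 1" "0 \<le> g i x \<and> g i x \<le> 1"
    "x \<notin> W i \<Longrightarrow> g i x = 0" if "i < n" for i x
    using g' that by simp_all
  have "nrm (C0_space Y) (\<Sum>i<n. \<epsilon> i *\<^sub>R g i) \<le> 1" if \<epsilon>: "\<forall>i. \<bar>\<epsilon> i\<bar> \<le> 1" for \<epsilon>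
  proof (rule C0_norm_le)
    fix x assume "x \<in> topspace Y"
    show "\<bar>(\<Sum>i<n. \<epsilon> i *\<^sub>R g i) x\<bar> \<le> 1"
    proof (cases "\<exists>k<n. x \<in> W k")
      case True
      then obtain k where k: "k < n" "x \<in> W k" by blast
      have "g i x = 0" if "i < n" "i \<noteq> k" for i using W_disj[OF that(1) k(1) that(2)] g(4)[OF that(1), of x] k(2) by blast
      then have "(\<Sum>i<n. \<epsilon> i * g i x) = (\<Sum>i<n. if i = k then \<epsilon> i * g i x else 0)"
        by (intro sum.cong) auto
      also have "\<dots> = \<epsilon> k * g k x" using k by simp
      finally have "\<bar>(\<Sum>i<n. \<epsilon> i *\<^sub>R g i) x\<bar> = \<bar>\<epsilon> k\<bar> * g k x"
        using g(3)[OF k(1), of x] by (simp add: sum_scaleR_apply abs_mult)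
      also have "\<dots> \<le> 1 * 1" using \<epsilon> g(3)[OF k(1), of x] by (intro mult_mono) auto
      finally show ?thesis by simp
    next
      case False
      then have "(\<Sum>i<n. \<epsilon> i * g i x) = 0" using g(4) by (intro sum.neutral) auto
      then show ?thesis by (simp add: sum_scaleR_apply)
    qed
  qed simp
  moreover have "g i (p j) = (if i = j then 1 else 0)" if ij: "i < n" "j < n" for i j
    using g(2)[OF ij(1)] g(4)[OF ij(1), of "p j"] W_disj[OF ij] W(2)[OF ij(2)] by auto
  ultimately show ?thesis using g(1) p(2) by (intro exI[of _ g] exI[of _ p]) blast
qed

lemma C0_infinite_linf_systems:
  assumes Y: "Hausdorff_space Y" "locally_compact_space Y" and inf: "infinite (topspace Y)"
  shows "has_linf_systems (C0_space Y) (dual_space (C0_space Y))"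
proof -
  let ?X = "C0_space Y"
  note sub = seminormed_spaceD(1)[OF seminormed_C0[of Y]]
  have "\<exists>x h. linf_system ?X (dual_space ?X) 1 n x h" for n
  proof -
    obtain g p where gp: "\<forall>i<n. g i \<in> pts ?X \<and> p i \<in> topspace Y"
      "\<forall>i<n. \<forall>j<n. g i (p j) = (if i = j then 1 else 0)"
      "\<forall>\<epsilon>. (\<forall>i. \<bar>\<epsilon> i\<bar> \<le> 1) \<longrightarrow> nrm ?X (\<Sum>i<n. \<epsilon> i *\<^sub>R g i) \<le> 1"
      using disjoint_bumps_exist[OF Y inf, of n] by (elim exE conjE) (rule that)
    define h where "h i = (\<lambda>f. if f \<in> pts ?X then f (p i) else 0)" for i
    have "functional_bound ?X (h i) 1" if i: "i < n" for i
    proof (rule functional_boundI)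
      fix f assume "f \<in> pts ?X"
      then show "h i (c *\<^sub>R f) = c * h i f" "\<bar>h i f\<bar> \<le> 1 * nrm ?X f" for c
        using subspace_scale[OF sub, of f c] C0_norm_bound[of f Y "p i"] gp(1) i
        by (simp_all add: h_def scaleR_fun_def)
    qed (use subspace_add[OF sub] in \<open>auto simp: h_def\<close>)
    then show ?thesis
      using functional_bound_imp_dual[of ?X _ 1] gp unfolding linf_system_def
      by (intro exI[of _ g] exI[of _ h]) (auto simp: h_def)
  qed
  then show ?thesis unfolding has_linf_systems_def by blast
qed

lemma C0_dichotomy:
  assumes Y: "Hausdorff_space Y" "locally_compact_space Y"
  shows "has_linf_systems (C0_space Y) (dual_space (C0_space Y)) \<or> finite_dimensional_mod_null (C0_space Y)"
proof (cases "finite (topspace Y)")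
  case True
  have "finite_dimensional_mod_null (C0_space Y)"
    by (rule finite_dimensional_functions_on_finite_set[OF seminormed_C0 True]) (rule C0_memD(2))
  then show ?thesis ..
qed (use C0_infinite_linf_systems[OF Y] in blast)

lemma c0_eq_C0_space: "c0_space = C0_space (discrete_topology (UNIV :: nat set))"
proof -
  have "f \<longlonglongrightarrow> 0 \<longleftrightarrow> (\<forall>\<epsilon>>0. finite {n. \<epsilon> \<le> \<bar>f n\<bar>})" for f :: "nat \<Rightarrow> real"
    unfolding tendsto_iff cofinite_eq_sequentially[symmetric] eventually_cofinite
    by (simp add: not_less dist_real_def)
  then show ?thesis by (simp add: c0_space_def C0_space_def compactin_discrete_topology)
qed

lemma copy_of_c0_contains_l1:
  assumes "contains_copy_of Z c0_space"
  shows "uniformly_contains_l1 Z"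
proof -
  let ?Y = "discrete_topology (UNIV :: nat set)"
  have "has_linf_systems (C0_space ?Y) (dual_space (C0_space ?Y))"
    by (rule C0_infinite_linf_systems) (simp_all add: locally_compact_space_discrete_topology)
  then have "uniformly_contains_l1 (C0_space ?Y)"
    by (intro l1_systems_imp_uniformly_contains_l1 linf_systems_imp_l1_systems[OF _ dual_subspace_dual] seminormed_C0)
  with assms[unfolded c0_eq_C0_space] show ?thesis by (rule uniformly_contains_l1_copy[OF seminormed_C0])
qed

lemma C_space_eq_C0_space:
  assumes "compact_space K" shows "C_space K = C0_space K"
proof -
  have "compactin K {x \<in> topspace K. \<epsilon> \<le> \<bar>f x\<bar>}" if "continuous_map K euclideanreal f" for f \<epsilon>
    using assms closedin_ge_abs[OF that] by (rule closedin_compact_space)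
  then show ?thesis by (auto simp: C_space_def C0_space_def)
qed

text \<open>
  The images \<open>H\<^sub>i\<close> of disjoint bumps span an isometric copy of \<open>\<ell>\<^sub>\<infinity>\<^sup>n\<close> in the dual of \<open>E\<close>.  Almost norming
  vectors \<open>e\<^sub>i\<close> for them are almost biorthogonal, since \<open>\<Sum>j. \<bar>H\<^sub>j e\<^sub>i\<bar> \<le> 1\<close>; so they span a copy of \<open>\<ell>\<^sub>1\<^sup>n\<close>.
  If \<open>K\<close> is finite, then finitely many functionals separate the points of \<open>E\<close>.
\<close>

lemma predual_of_C_contains_l1:
  assumes K: "Hausdorff_space K" "compact_space K"
    and iso: "isometrically_isomorphic (C_space K) (whole :: ('e::real_normed_vector \<Rightarrow>\<^sub>L real) nspace)"
    and inf: "infinite_dimensional TYPE('e)"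
  shows "uniformly_contains_l1 (whole :: 'e nspace)"
proof (cases "finite (topspace K)")
  case True
  note C = C_space_eq_C0_space[OF K(2)]
  have "finite_dimensional_mod_null (C0_space K)"
    by (rule finite_dimensional_functions_on_finite_set[OF seminormed_C0 True]) (rule C0_memD(2))
  then have "finite_dimensional_mod_null (whole :: ('e \<Rightarrow>\<^sub>L real) nspace)"
    by (rule finite_dimensional_mod_null_isometric[OF seminormed_C0 iso[unfolded C]])
  then obtain B :: "('e \<Rightarrow>\<^sub>L real) set" where B: "finite B" "\<And>x. x \<in> span B"
    unfolding finite_dimensional_mod_null_def by auto
  have "\<exists>A. finite A \<and> A \<subseteq> (UNIV :: 'e set) \<and> UNIV \<subseteq> span A"
  proof (rule separating_functionals_imp_finite_span[where \<Lambda> = "blinfun_apply ` B"])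
    fix x :: 'e assume 0: "\<And>l. l \<in> blinfun_apply ` B \<Longrightarrow> l x = 0"
    obtain f where f: "bounded_linear f" "f x = norm x"
      using norming_functional_exists[of x] by blast
    have "blinfun_apply b x = 0" if "b \<in> span B" for b
      using that by (induction rule: span_induct_alt) (auto simp: blinfun.add_left blinfun.scaleR_left 0)
    from this[OF B(2), of "Blinfun f"] show "x = 0" using f by (simp add: bounded_linear_Blinfun_apply)
  qed (use B(1) in \<open>auto simp: blinfun.add_right blinfun.scaleR_right\<close>)
  then show ?thesis using inf unfolding infinite_dimensional_def by auto
next
  case False
  have loc: "locally_compact_space K" using K(2) by (rule compact_imp_locally_compact_space)
  obtain T where T: "isometry_onto (C0_space K) (whole :: ('e \<Rightarrow>\<^sub>L real) nspace) T"
    using iso unfolding C_space_eq_C0_space[OF K(2)] isometrically_isomorphic_iff by blast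
  note sub = seminormed_spaceD(1)[OF seminormed_C0[of K]]
  have "\<exists>e. l1_basis (whole :: 'e nspace) 2 n e" for n
  proof -
    obtain g p where g': "\<forall>i<n. g i \<in> pts (C0_space K) \<and> p i \<in> topspace K"
      and gp': "\<forall>i<n. \<forall>j<n. g i (p j) = (if i = j then 1 else 0)"
      and nrm': "\<forall>\<epsilon>. (\<forall>i. \<bar>\<epsilon> i\<bar> \<le> 1) \<longrightarrow> nrm (C0_space K) (\<Sum>i<n. \<epsilon> i *\<^sub>R g i) \<le> 1"
      using disjoint_bumps_exist[OF K(1) loc False, of n] by (elim exE conjE) (rule that)
    have g: "g i \<in> pts (C0_space K)" and p: "p i \<in> topspace K" if "i < n" for i
      using g' that by simp_all
    have gp: "g i (p j) = (if i = j then 1 else 0)" if "i < n" "j < n" for i j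
      using gp' that by blast
    have nrm: "nrm (C0_space K) (\<Sum>i<n. \<epsilon> i *\<^sub>R g i) \<le> 1" if "\<forall>i. \<bar>\<epsilon> i\<bar> \<le> 1" for \<epsilon>
      using nrm' that by blast
    define H where "H i = T (g i)" for i
    have H_comb: "\<bar>\<Sum>i<n. \<epsilon> i * H i x\<bar> \<le> norm x" if \<epsilon>: "\<forall>i. \<bar>\<epsilon> i\<bar> \<le> 1" for \<epsilon> x
    proof -
      have "(\<Sum>i<n. \<epsilon> i *\<^sub>R g i) \<in> pts (C0_space K)"
        using g by (intro subspace_sum[OF sub] subspace_scale[OF sub]) simp
      then have "norm (T (\<Sum>i<n. \<epsilon> i *\<^sub>R g i)) \<le> 1"
        using isometry_ontoD(4)[OF T] nrm[OF \<epsilon>] by simp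
      then have "norm (\<Sum>i<n. \<epsilon> i *\<^sub>R H i) \<le> 1"
        using linear_between_sum[OF sub isometry_onto_linear[OF T], of "{..<n}" g \<epsilon>] g by (simp add: H_def)
      then have "\<bar>blinfun_apply (\<Sum>i<n. \<epsilon> i *\<^sub>R H i) x\<bar> \<le> 1 * norm x"
        using norm_blinfun[of "\<Sum>i<n. \<epsilon> i *\<^sub>R H i" x]
          mult_right_mono[of "norm (\<Sum>i<n. \<epsilon> i *\<^sub>R H i)" 1 "norm x"] by simp
      then show ?thesis by (simp add: blinfun.sum_left blinfun.scaleR_left)
    qed
    have "\<exists>e. norm e \<le> 1 \<and> 3 / 4 \<le> H i e" if i: "i < n" for i
    proof (rule ccontr)
      assume "\<not> ?thesis"
      then have small: "H i e < 3 / 4" if "norm e \<le> 1" for e using that by (meson not_le)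
      have "norm (H i x) \<le> 3 / 4 * norm x" for x
      proof (cases "x = 0")
        case False
        then have *: "norm (sgn x) \<le> 1" "norm (sgn (- x)) \<le> 1" by (simp_all add: norm_sgn)
        have "H i (sgn x) < 3 / 4" "H i (sgn (- x)) < 3 / 4"
          using small[OF *(1)] small[OF *(2)] by simp_all
        then show ?thesis using False
          by (simp add: sgn_div_norm blinfun.scaleR_right blinfun.minus_right field_simps abs_le_iff)
      qed (simp add: blinfun.zero_right)
      then have "norm (H i) \<le> 3 / 4" by (intro norm_blinfun_bound) auto
      moreover have "1 \<le> norm (H i)"
        using C0_norm_bound[OF g[OF i] p[OF i]] isometry_ontoD(4)[OF T g[OF i]] gp[OF i i] by (simp add: H_def)
      ultimately show False by simp
    qed
    then have "\<forall>i. \<exists>e. i < n \<longrightarrow> norm e \<le> 1 \<and> 3 / 4 \<le> H i e" by blast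
    from choice[OF this] obtain e where e': "\<forall>i. i < n \<longrightarrow> norm (e i) \<le> 1 \<and> 3 / 4 \<le> H i (e i)"
      by (elim exE) (rule that)
    have e: "norm (e i) \<le> 1" "3 / 4 \<le> H i (e i)" if "i < n" for i
      using e' that by simp_all
    have off: "(\<Sum>j<n. \<bar>H j (e i)\<bar>) \<le> 1" if i: "i < n" for i
    proof -
      have "(\<Sum>j<n. \<bar>H j (e i)\<bar>) = (\<Sum>j<n. sgn (H j (e i)) * H j (e i))"
        by (simp add: abs_sgn mult.commute)
      also have "\<dots> \<le> norm (e i)"
        using H_comb[of "\<lambda>j. sgn (H j (e i))" "e i"] by (simp add: abs_le_iff sgn_real_def)
      finally show ?thesis using e(1)[OF i] by linarith
    qed
    have "(\<Sum>i<n. \<bar>c i\<bar>) \<le> 2 * norm (\<Sum>i<n. c i *\<^sub>R e i)" for c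
    proof -
      let ?y = "\<Sum>i<n. c i *\<^sub>R e i"
      have one: "\<bar>c i\<bar> / 2 \<le> c i * (\<Sum>j<n. sgn (c j) * H j (e i))" if i: "i < n" for i
      proof -
        have split: "(\<Sum>j<n. \<phi> j) = \<phi> i + (\<Sum>j\<in>{..<n} - {i}. \<phi> j)" for \<phi> :: "nat \<Rightarrow> real"
          using i by (intro sum.remove) auto
        have "\<bar>\<Sum>j\<in>{..<n} - {i}. sgn (c j) * H j (e i)\<bar> \<le> (\<Sum>j\<in>{..<n} - {i}. \<bar>H j (e i)\<bar>)"
          by (rule order_trans[OF sum_abs]) (intro sum_mono, auto simp: abs_mult sgn_real_def)
        also have "\<dots> \<le> 1 / 4"
          using off[OF i] e(2)[OF i] split[of "\<lambda>j. \<bar>H j (e i)\<bar>"] by simp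
        finally have r: "\<bar>\<Sum>j\<in>{..<n} - {i}. sgn (c j) * H j (e i)\<bar> \<le> 1 / 4" .
        have "\<bar>c i\<bar> * (3 / 4) \<le> \<bar>c i\<bar> * H i (e i)" using e(2)[OF i] by (intro mult_left_mono) auto
        moreover have "\<bar>c i * (\<Sum>j\<in>{..<n} - {i}. sgn (c j) * H j (e i))\<bar> \<le> \<bar>c i\<bar> * (1 / 4)"
          unfolding abs_mult using r by (intro mult_left_mono) auto
        moreover have "c i * (\<Sum>j<n. sgn (c j) * H j (e i))
            = \<bar>c i\<bar> * H i (e i) + c i * (\<Sum>j\<in>{..<n} - {i}. sgn (c j) * H j (e i))"
          unfolding split[of "\<lambda>j. sgn (c j) * H j (e i)"]
          by (simp add: distrib_left abs_sgn mult.assoc)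
        ultimately show ?thesis by linarith
      qed
      have "(\<Sum>i<n. \<bar>c i\<bar> / 2) \<le> (\<Sum>i<n. c i * (\<Sum>j<n. sgn (c j) * H j (e i)))"
        by (intro sum_mono one) simp
      also have "\<dots> = (\<Sum>i<n. \<Sum>j<n. sgn (c j) * (c i * H j (e i)))"
        by (simp add: sum_distrib_left ac_simps)
      also have "\<dots> = (\<Sum>j<n. sgn (c j) * H j ?y)"
        by (subst sum.swap) (simp add: blinfun.sum_right blinfun.scaleR_right sum_distrib_left)
      also have "\<dots> \<le> norm ?y"
        using H_comb[of "\<lambda>j. sgn (c j)" ?y] by (simp add: abs_le_iff sgn_real_def)
      finally show ?thesis by (simp add: sum_divide_distrib[symmetric])
    qed
    then show ?thesis using e(1) unfolding l1_basis_def by (intro exI[of _ e]) simp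
  qed
  then show ?thesis unfolding uniformly_contains_l1_def by (intro exI[of _ 2]) simp
qed

section \<open>Spaces of integrable and of essentially bounded functions\<close>

lemma positive_finite_subset:
  assumes M: "sigma_finite_measure M" and A: "A \<in> sets M" "emeasure M A \<noteq> 0"
  shows "\<exists>B\<in>sets M. B \<subseteq> A \<and> emeasure M B \<noteq> 0 \<and> emeasure M B < \<infinity>"
proof (rule ccontr)
  assume contr: "\<not> ?thesis"
  obtain F :: "nat \<Rightarrow> 'a set" where F: "range F \<subseteq> sets M" "(\<Union>i. F i) = space M" "\<And>i. emeasure M (F i) \<noteq> \<infinity>"
    using sigma_finite_measure.sigma_finite[OF M] by metis
  have null: "emeasure M (A \<inter> F i) = 0" for i
  proof (rule ccontr)
    assume "emeasure M (A \<inter> F i) \<noteq> 0"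
    moreover have "A \<inter> F i \<in> sets M" using A(1) F(1) by auto
    moreover have "emeasure M (A \<inter> F i) \<le> emeasure M (F i)" using F(1) by (intro emeasure_mono) auto
    then have "emeasure M (A \<inter> F i) < \<infinity>" using F(3)[of i] by (simp add: top.not_eq_extremum order_le_less_trans)
    ultimately show False using contr by blast
  qed
  have "A = (\<Union>i. A \<inter> F i)" using F(2) sets.sets_into_space[OF A(1)] by auto
  moreover have "emeasure M (\<Union>i. A \<inter> F i) = 0"
    using null A(1) F(1) by (intro emeasure_UN_eq_0) auto
  ultimately show False using A(2) by simp
qed

definition disjoint_positive_sets :: "'a measure \<Rightarrow> nat \<Rightarrow> (nat \<Rightarrow> 'a set) \<Rightarrow> bool"
  where "disjoint_positive_sets M n A \<longleftrightarrow> disjoint_family_on A {..<n} \<and>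
    (\<forall>i<n. A i \<in> sets M \<and> emeasure M (A i) \<noteq> 0 \<and> emeasure M (A i) < \<infinity>)"

text \<open>
  On an atom, every sublevel set \<open>{f < t}\<close> is null or conull; the threshold between the two cases is
  the value of \<open>f\<close> almost everywhere.
\<close>

lemma constant_on_atom:
  fixes f :: "'a \<Rightarrow> real"
  assumes A: "A \<in> sets M" "emeasure M A \<noteq> 0" and f: "f \<in> borel_measurable M"
    and atom: "\<And>B. B \<in> sets M \<Longrightarrow> B \<subseteq> A \<Longrightarrow> emeasure M B = 0 \<or> emeasure M (A - B) = 0"
  shows "\<exists>c. AE x in M. x \<in> A \<longrightarrow> f x = c"
proof -
  have [measurable]: "f \<in> borel_measurable M" "A \<in> sets M" using f A by auto
  have alt: "(AE x in M. x \<in> A \<longrightarrow> t \<le> f x) \<or> (AE x in M. x \<in> A \<longrightarrow> f x < t)" for t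
  proof -
    let ?B = "{x \<in> space M. x \<in> A \<and> f x < t}"
    have B: "?B \<in> sets M" by measurable
    moreover have "?B \<subseteq> A" by auto
    ultimately consider "emeasure M ?B = 0" | "emeasure M (A - ?B) = 0" using atom by blast
    then show ?thesis
    proof cases
      case 1
      then have "AE x in M. x \<notin> ?B" using B by (intro AE_not_in) (auto simp: null_sets_def)
      then have "AE x in M. x \<in> A \<longrightarrow> t \<le> f x" using AE_space by eventually_elim auto
      then show ?thesis ..
    next
      case 2
      then have "AE x in M. x \<notin> A - ?B" using A(1) B by (intro AE_not_in) (auto simp: null_sets_def)
      then have "AE x in M. x \<in> A \<longrightarrow> f x < t" by eventually_elim auto
      then show ?thesis ..
    qed
  qed
  have not_null: "\<not> (AE x in M. x \<notin> A)"
    using A AE_iff_measurable[OF A(1), of "\<lambda>x. x \<notin> A"] sets.sets_into_space[OF A(1)] by (auto simp: Collect_conj_eq Int_absorb1)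
  define N where "N = {t. AE x in M. x \<in> A \<longrightarrow> t \<le> f x}"
  have ne: "N \<noteq> {}"
  proof
    assume "N = {}"
    then have "AE x in M. x \<in> A \<longrightarrow> f x < - real k" for k :: nat
      using alt[of "- real k"] by (auto simp: N_def)
    then have "AE x in M. \<forall>k :: nat. x \<in> A \<longrightarrow> f x < - real k" unfolding AE_all_countable by blast
    then have "AE x in M. x \<notin> A"
    proof eventually_elim
      case (elim x)
      obtain k :: nat where "- f x < real k" using reals_Archimedean2 by blast
      then show ?case using elim[rule_format, of k] by auto
    qed
    then show False using not_null by blast
  qed
  have bdd: "bdd_above N"
  proof (rule ccontr)
    assume unb: "\<not> bdd_above N"
    have "AE x in M. x \<in> A \<longrightarrow> real k \<le> f x" for k :: nat
    proof -
      obtain t where "t \<in> N" "real k \<le> t" using unb unfolding bdd_above_def by (meson linear)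
      then show ?thesis unfolding N_def by (auto elim: eventually_mono)
    qed
    then have "AE x in M. \<forall>k :: nat. x \<in> A \<longrightarrow> real k \<le> f x" unfolding AE_all_countable by blast
    then have "AE x in M. x \<notin> A"
    proof eventually_elim
      case (elim x)
      obtain k :: nat where "f x < real k" using reals_Archimedean2 by blast
      then show ?case using elim[rule_format, of k] by auto
    qed
    then show False using not_null by blast
  qed
  define c where "c = Sup N"
  have "AE x in M. x \<in> A \<longrightarrow> c - 1 / real (Suc k) \<le> f x" for k
  proof -
    obtain t where "t \<in> N" "c - 1 / real (Suc k) < t"
      using less_cSup_iff[OF ne bdd, of "c - 1 / real (Suc k)"] by (auto simp: c_def)
    then show ?thesis unfolding N_def by (auto elim!: eventually_mono)
  qed
  then have lower: "AE x in M. \<forall>k. x \<in> A \<longrightarrow> c - 1 / real (Suc k) \<le> f x" unfolding AE_all_countable by blast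
  have "AE x in M. x \<in> A \<longrightarrow> f x < c + 1 / real (Suc k)" for k
  proof -
    have "c + 1 / real (Suc k) \<notin> N" using cSup_upper[OF _ bdd, of "c + 1 / real (Suc k)"] by (auto simp: c_def)
    then show ?thesis using alt[of "c + 1 / real (Suc k)"] by (simp add: N_def)
  qed
  then have upper: "AE x in M. \<forall>k. x \<in> A \<longrightarrow> f x < c + 1 / real (Suc k)" unfolding AE_all_countable by blast
  have "AE x in M. x \<in> A \<longrightarrow> f x = c"
    using lower upper
  proof eventually_elim
    case (elim x)
    show ?case
    proof
      assume x: "x \<in> A"
      have lim: "(\<lambda>k. 1 / real (Suc k)) \<longlonglongrightarrow> 0" by (rule LIMSEQ_Suc[OF lim_1_over_n])
      have "(\<lambda>k. c - 1 / real (Suc k)) \<longlonglongrightarrow> c - 0" by (intro tendsto_intros lim)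
      then have "c - 0 \<le> f x" by (rule LIMSEQ_le_const2) (use elim(1) x in auto)
      moreover have "(\<lambda>k. c + 1 / real (Suc k)) \<longlonglongrightarrow> c + 0" by (intro tendsto_intros lim)
      then have "f x \<le> c + 0" by (rule LIMSEQ_le_const) (use elim(2) x in \<open>auto intro: less_imp_le\<close>)
      ultimately show "f x = c" by simp
    qed
  qed
  then show ?thesis by blast
qed

text \<open>
  A disjoint family of maximal size consists of atoms whose union is conull, since otherwise a
  member could be split or a new one added.
\<close>

lemma finitely_many_atoms:
  assumes M: "sigma_finite_measure M" and bound: "\<not> (\<forall>n. \<exists>A. disjoint_positive_sets M n A)"
  shows "\<exists>n A. disjoint_positive_sets M n A \<and>
    (\<forall>f\<in>borel_measurable M. \<exists>c. AE x in M. f x = (\<Sum>i<n. c i * indicator (A i) x :: real))"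
proof -
  let ?P = "\<lambda>n. \<exists>A. disjoint_positive_sets M n A"
  have P0: "?P 0" by (simp add: disjoint_positive_sets_def disjoint_family_on_def)
  have "\<exists>n. ?P n \<and> \<not> ?P (Suc n)"
  proof (rule ccontr)
    assume "\<not> ?thesis"
    then have step: "?P (Suc n)" if "?P n" for n using that by blast
    have "?P n" for n by (induction n) (rule P0, rule step)
    then show False using bound by blast
  qed
  then obtain n where n: "?P n" "\<not> ?P (Suc n)" by blast
  then obtain A where A: "disjoint_positive_sets M n A" by blast
  have A_sets: "A i \<in> sets M" "emeasure M (A i) \<noteq> 0" "emeasure M (A i) < \<infinity>" if "i < n" for i
    using A that by (simp_all add: disjoint_positive_sets_def)
  have A_disj: "A i \<inter> A j = {}" if "i < n" "j < n" "i \<noteq> j" for i j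
    using A that by (simp add: disjoint_positive_sets_def disjoint_family_on_def)
  have atom: "emeasure M B = 0 \<or> emeasure M (A i - B) = 0" if i: "i < n" and B: "B \<in> sets M" "B \<subseteq> A i" for i B
  proof (rule ccontr)
    assume contr: "\<not> ?thesis"
    let ?A = "\<lambda>j. if j = n then A i - B else if j = i then B else A j"
    have fin: "emeasure M B < \<infinity>" "emeasure M (A i - B) < \<infinity>"
      using emeasure_mono[OF B(2) A_sets(1)[OF i]] emeasure_mono[of "A i - B" "A i" M] A_sets[OF i]
      by (auto intro: order_le_less_trans)
    have "disjoint_positive_sets M (Suc n) ?A"
      unfolding disjoint_positive_sets_def disjoint_family_on_def
    proof (intro conjI ballI allI impI)
      fix j k assume jk: "j \<in> {..<Suc n}" "k \<in> {..<Suc n}" "j \<noteq> k"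
      show "?A j \<inter> ?A k = {}"
        using jk i B(2) A_disj[of j k] A_disj[of i k] A_disj[of j i] by (auto simp: less_Suc_eq)
    qed (use i B contr A_sets fin in auto)
    then show False using n(2) by blast
  qed
  define R where "R = space M - (\<Union>i<n. A i)"
  have R: "R \<in> sets M" unfolding R_def using A_sets(1) by (intro sets.Diff sets.top sets.finite_UN) auto
  have R_null: "emeasure M R = 0"
  proof (rule ccontr)
    assume "emeasure M R \<noteq> 0"
    then obtain B where B: "B \<in> sets M" "B \<subseteq> R" "emeasure M B \<noteq> 0" "emeasure M B < \<infinity>"
      using positive_finite_subset[OF M R] by blast
    have "disjoint_positive_sets M (Suc n) (A(n := B))"
      unfolding disjoint_positive_sets_def disjoint_family_on_def
    proof (intro conjI ballI allI impI)
      fix j k assume jk: "j \<in> {..<Suc n}" "k \<in> {..<Suc n}" "j \<noteq> k"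
      show "(A(n := B)) j \<inter> (A(n := B)) k = {}"
        using jk B(2) A_disj[of j k] by (auto simp: less_Suc_eq R_def)
    qed (use B A_sets in auto)
    then show False using n(2) by blast
  qed
  have "\<exists>c. AE x in M. f x = (\<Sum>i<n. c i * indicator (A i) x)" if f: "f \<in> borel_measurable M" for f :: "'a \<Rightarrow> real"
  proof -
    have "\<forall>i. \<exists>c. i < n \<longrightarrow> (AE x in M. x \<in> A i \<longrightarrow> f x = c)"
      using constant_on_atom[OF A_sets(1,2) f atom] by meson
    from choice[OF this] obtain c where c: "\<forall>i. i < n \<longrightarrow> (AE x in M. x \<in> A i \<longrightarrow> f x = c i)" by blast
    have "AE x in M. \<forall>i\<in>{..<n}. x \<in> A i \<longrightarrow> f x = c i"
      using c by (intro AE_finite_allI) auto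
    moreover have "AE x in M. x \<notin> R" using R R_null by (intro AE_not_in) (auto simp: null_sets_def)
    ultimately have "AE x in M. f x = (\<Sum>i<n. c i * indicator (A i) x)"
      using AE_space
    proof eventually_elim
      case (elim x)
      then obtain k where k: "k < n" "x \<in> A k" by (auto simp: R_def)
      have "(\<Sum>i<n. c i * indicator (A i) x) = (\<Sum>i<n. if i = k then c k else 0)"
        using k A_disj[OF _ k(1)] by (intro sum.cong refl) (auto simp: indicator_def)
      then show ?case using k elim(1) by simp
    qed
    then show ?thesis by blast
  qed
  then show ?thesis using A by blast
qed

lemma Linf_memI:
  assumes "f \<in> borel_measurable M" "AE x in M. \<bar>f x\<bar> \<le> C"
  shows "f \<in> pts (Linf_space M)"
proof -
  have "esssup M (\<lambda>x. ereal \<bar>f x\<bar>) \<le> ereal C" using assms by (intro esssup_I) auto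
  also have "\<dots> < \<infinity>" by simp
  finally show ?thesis using assms(1) by (simp add: Linf_space_def)
qed

lemma Linf_norm_le:
  assumes "f \<in> borel_measurable M" "AE x in M. \<bar>f x\<bar> \<le> C" "0 \<le> C"
  shows "nrm (Linf_space M) f \<le> C"
proof -
  have "esssup M (\<lambda>x. ereal \<bar>f x\<bar>) \<le> ereal C" using assms by (intro esssup_I) auto
  then show ?thesis using assms(3)
    by (cases "esssup M (\<lambda>x. ereal \<bar>f x\<bar>)") (auto simp: Linf_space_def)
qed

lemma Linf_measurable: "f \<in> pts (Linf_space M) \<Longrightarrow> f \<in> borel_measurable M"
  by (simp add: Linf_space_def)

lemma Linf_norm_bound:
  assumes "f \<in> pts (Linf_space M)"
  shows "AE x in M. \<bar>f x\<bar> \<le> nrm (Linf_space M) f"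
  using esssup_AE[of "\<lambda>x. ereal \<bar>f x\<bar>" M]
proof eventually_elim
  case (elim x)
  then show ?case using assms
    by (cases "esssup M (\<lambda>x. ereal \<bar>f x\<bar>)") (auto simp: Linf_space_def)
qed

lemma Linf_norm_nonneg:
  assumes f: "f \<in> pts (Linf_space M)"
  shows "0 \<le> nrm (Linf_space M) f"
proof (rule ccontr)
  assume neg: "\<not> ?thesis"
  have "AE x in M. False"
    using Linf_norm_bound[OF f] by eventually_elim (use neg in auto)
  then have "emeasure M (space M) = 0" by (simp add: eventually_False ae_filter_eq_bot_iff)
  then have "esssup M (\<lambda>x. ereal \<bar>f x\<bar>) = - \<infinity>"
    using Linf_measurable[OF f] by (intro esssup_zero_space) auto
  then show False using neg by (simp add: Linf_space_def)
qed

lemma seminormed_Linf: "seminormed_space (Linf_space M)"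
proof (rule seminormed_space_if_least_bound[where
      Q = "\<lambda>f C. f \<in> borel_measurable M \<and> (AE x in M. \<bar>f x\<bar> \<le> C)"])
  fix f g :: "'a \<Rightarrow> real" and C D
  assume f: "f \<in> borel_measurable M \<and> (AE x in M. \<bar>f x\<bar> \<le> C)"
    and g: "g \<in> borel_measurable M \<and> (AE x in M. \<bar>g x\<bar> \<le> D)"
  have "AE x in M. \<bar>(f + g) x\<bar> \<le> C + D"
    using conjunct2[OF f] conjunct2[OF g] by eventually_elim auto
  then show "f + g \<in> borel_measurable M \<and> (AE x in M. \<bar>(f + g) x\<bar> \<le> C + D)"
    using f g by (auto simp: plus_fun_def)
next
  fix f :: "'a \<Rightarrow> real" and c C
  assume f: "f \<in> borel_measurable M \<and> (AE x in M. \<bar>f x\<bar> \<le> C)"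
  have "AE x in M. \<bar>(c *\<^sub>R f) x\<bar> \<le> \<bar>c\<bar> * C"
    using conjunct2[OF f] by eventually_elim (auto simp: scaleR_fun_def abs_mult mult_left_mono)
  then show "c *\<^sub>R f \<in> borel_measurable M \<and> (AE x in M. \<bar>(c *\<^sub>R f) x\<bar> \<le> \<bar>c\<bar> * C)"
    using f by (auto simp: scaleR_fun_def)
next
  fix f :: "'a \<Rightarrow> real" and C :: real
  assume "f \<in> borel_measurable M \<and> (AE x in M. \<bar>f x\<bar> \<le> C)" "0 \<le> C"
  then show "f \<in> pts (Linf_space M) \<and> nrm (Linf_space M) f \<le> C"
    using Linf_memI Linf_norm_le by blast
qed (simp_all add: Linf_norm_nonneg Linf_norm_bound Linf_measurable zero_fun_def)

lemma disjoint_positive_sets_apply: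
  assumes "disjoint_positive_sets M n A" "k < n" "x \<in> A k"
  shows "(\<Sum>i<n. c i * indicator (A i) x :: real) = c k"
proof -
  have "(\<Sum>i<n. c i * indicator (A i) x) = (\<Sum>i<n. if i = k then c k else 0)"
    using assms unfolding disjoint_positive_sets_def disjoint_family_on_def
    by (intro sum.cong refl) (auto simp: indicator_def)
  then show ?thesis using assms(2) by simp
qed

text \<open>
  The indicators of disjoint sets span \<open>\<ell>\<^sub>\<infinity>\<^sup>n\<close>; the coordinate functionals are the averages over these sets.
\<close>

lemma Linf_linf_systems:
  assumes sets: "\<forall>n. \<exists>A. disjoint_positive_sets M n A"
  shows "has_linf_systems (Linf_space M) (dual_space (Linf_space M))"
proof -
  let ?X = "Linf_space M"
  have "\<exists>x h. linf_system ?X (dual_space ?X) 1 n x h" for n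
  proof -
    obtain A where A: "disjoint_positive_sets M n A" using sets by blast
    have As: "A i \<in> sets M" "emeasure M (A i) \<noteq> 0" "emeasure M (A i) < \<infinity>" if "i < n" for i
      using A that by (simp_all add: disjoint_positive_sets_def)
    have pos: "0 < measure M (A i)" if "i < n" for i
      using As[OF that] by (simp add: measure_def enn2real_positive_iff zero_less_iff_neq_zero)
    define x where "x i = (indicator (A i) :: 'a \<Rightarrow> real)" for i
    define h where "h i = (\<lambda>f. if f \<in> pts ?X then (\<integral>x. indicator (A i) x * f x \<partial>M) / measure M (A i) else 0)" for i
    note sub = seminormed_spaceD(1)[OF seminormed_Linf[of M]]
    have int: "integrable M (\<lambda>x. indicator (A i) x * f x)" if i: "i < n" and f: "f \<in> pts ?X" for i f
    proof (rule Bochner_Integration.integrable_bound)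
      show "integrable M (\<lambda>x. nrm ?X f * indicator (A i) x)"
        using As[OF i] by (intro integrable_mult_right integrable_real_indicator) auto
      show "(\<lambda>x. indicator (A i) x * f x) \<in> borel_measurable M"
        using Linf_measurable[OF f] As(1)[OF i] by measurable
      show "AE x in M. norm (indicator (A i) x * f x) \<le> norm (nrm ?X f * indicator (A i) x)"
        using Linf_norm_bound[OF f] by eventually_elim (auto simp: indicator_def)
    qed
    have hb: "\<bar>h i f\<bar> \<le> 1 * nrm ?X f" if i: "i < n" and f: "f \<in> pts ?X" for i f
    proof -
      have "\<bar>\<integral>x. indicator (A i) x * f x \<partial>M\<bar> \<le> (\<integral>x. nrm ?X f * indicator (A i) x \<partial>M)"
      proof (rule order_trans[OF integral_abs_bound], rule integral_mono_AE)
        show "integrable M (\<lambda>x. \<bar>indicator (A i) x * f x\<bar>)" using int[OF i f] by simp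
        show "integrable M (\<lambda>x. nrm ?X f * indicator (A i) x)"
          using As[OF i] by (intro integrable_mult_right integrable_real_indicator) auto
        show "AE x in M. \<bar>indicator (A i) x * f x\<bar> \<le> nrm ?X f * indicator (A i) x"
          using Linf_norm_bound[OF f] by eventually_elim (auto simp: indicator_def)
      qed
      also have "\<dots> = nrm ?X f * measure M (A i)" using As[OF i] sets.sets_into_space[OF As(1)[OF i]]
        by (simp add: Int_absorb2)
      finally show ?thesis using pos[OF i] f by (simp add: h_def abs_divide divide_le_eq)
    qed
    have "functional_bound ?X (h i) 1" if i: "i < n" for i
    proof (rule functional_boundI[OF _ _ _ hb[OF i]])
      fix f f' assume ff: "f \<in> pts ?X" "f' \<in> pts ?X"
      then show "h i (f + f') = h i f + h i f'"
        using subspace_add[OF sub ff] int[OF i]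
        by (simp add: h_def distrib_left add_divide_distrib)
    next
      fix c f assume f: "f \<in> pts ?X"
      then show "h i (c *\<^sub>R f) = c * h i f" using subspace_scale[OF sub f, of c]
        by (simp add: h_def scaleR_fun_def mult.left_commute[of _ c])
    qed (auto simp: h_def)
    then have h: "h i \<in> pts (dual_space ?X) \<and> nrm (dual_space ?X) (h i) \<le> 1" if "i < n" for i
      using functional_bound_imp_dual[of ?X _ 1] that by simp
    have x_comb: "nrm ?X (\<Sum>i<n. \<epsilon> i *\<^sub>R x i) \<le> 1" if \<epsilon>: "\<forall>i. \<bar>\<epsilon> i\<bar> \<le> 1" for \<epsilon>
    proof (rule Linf_norm_le)
      have eq: "(\<Sum>i<n. \<epsilon> i *\<^sub>R x i) = (\<lambda>y. \<Sum>i<n. \<epsilon> i * indicator (A i) y)"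
        by (simp add: fun_eq_iff sum_scaleR_apply x_def)
      show "(\<Sum>i<n. \<epsilon> i *\<^sub>R x i) \<in> borel_measurable M" unfolding eq using As(1) by measurable
      have "\<bar>\<Sum>i<n. \<epsilon> i * indicator (A i) y\<bar> \<le> 1" for y
      proof (cases "\<exists>k<n. y \<in> A k")
        case True
        then obtain k where k: "k < n" "y \<in> A k" by blast
        show ?thesis using disjoint_positive_sets_apply[OF A k, of \<epsilon>] \<epsilon>[rule_format, of k] by auto
      next
        case False
        then have "(\<Sum>i<n. \<epsilon> i * indicator (A i) y) = 0" by (intro sum.neutral) (auto simp: indicator_def)
        then show ?thesis by simp
      qed
      then show "AE y in M. \<bar>(\<Sum>i<n. \<epsilon> i *\<^sub>R x i) y\<bar> \<le> 1" unfolding eq by simp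
    qed simp
    have x: "x i \<in> pts ?X" if i: "i < n" for i
      unfolding x_def using As(1)[OF i] by (intro Linf_memI[where C = 1]) (auto simp: indicator_def)
    have hx: "h i (x j) = (if i = j then 1 else 0)" if ij: "i < n" "j < n" for i j
    proof -
      have "(\<integral>x. indicator (A i) x * indicator (A j) x \<partial>M) = (if i = j then measure M (A i) else 0)"
      proof (cases "i = j")
        case True
        have "(\<lambda>x. indicator (A i) x * indicator (A j) x :: real) = indicator (A i)"
          using True by (auto simp: indicator_def fun_eq_iff)
        then show ?thesis using True As[OF ij(1)] sets.sets_into_space[OF As(1)[OF ij(1)]] by (simp add: Int_absorb2)
      next
        case False
        then have "(\<lambda>x. indicator (A i) x * indicator (A j) x :: real) = (\<lambda>x. 0)"
          using A ij unfolding disjoint_positive_sets_def disjoint_family_on_def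
          by (auto simp: indicator_def fun_eq_iff)
        then show ?thesis using False by simp
      qed
      then show ?thesis using x[OF ij(2)] pos[OF ij(1)] by (auto simp: h_def x_def)
    qed
    show ?thesis
      using h x hx x_comb unfolding linf_system_def by (intro exI[of _ x] exI[of _ h]) simp
  qed
  then show ?thesis unfolding has_linf_systems_def by blast
qed

text \<open>
  Stated for any space of measurable functions that contains the indicators of sets of finite measure, so as
  to cover \<open>L\<^sub>1(\<mu>)\<close> and \<open>L\<^sub>\<infinity>(\<mu>)\<close> together.
\<close>

lemma finite_dimensional_if_atoms:
  assumes X: "seminormed_space X" and m: "\<And>f. f \<in> pts X \<Longrightarrow> f \<in> borel_measurable M"
    and null: "\<And>f. f \<in> pts X \<Longrightarrow> (AE x in M. f x = (0 :: real)) \<Longrightarrow> nrm X f = 0"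
    and ind: "\<And>A. A \<in> sets M \<Longrightarrow> emeasure M A < \<infinity> \<Longrightarrow> indicator A \<in> pts X"
    and M: "sigma_finite_measure M" and bound: "\<not> (\<forall>n. \<exists>A. disjoint_positive_sets M n A)"
  shows "finite_dimensional_mod_null X"
proof -
  obtain n A where A: "disjoint_positive_sets M n A"
    and repr: "\<And>f. f \<in> borel_measurable M \<Longrightarrow> \<exists>c. AE x in M. f x = (\<Sum>i<n. c i * indicator (A i) x :: real)"
    using finitely_many_atoms[OF M bound] by blast
  note sub = seminormed_spaceD(1)[OF X]
  let ?B = "(\<lambda>i. indicator (A i)) ` {..<n} :: ('a \<Rightarrow> real) set"
  have B: "?B \<subseteq> pts X" using A ind by (auto simp: disjoint_positive_sets_def)
  show ?thesis
    unfolding finite_dimensional_mod_null_def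
  proof (intro exI[of _ ?B] conjI ballI)
    fix f assume f: "f \<in> pts X"
    obtain c where c: "AE x in M. f x = (\<Sum>i<n. c i * indicator (A i) x)" using repr[OF m[OF f]] by blast
    let ?y = "\<Sum>i<n. c i *\<^sub>R (indicator (A i) :: 'a \<Rightarrow> real)"
    have y: "?y \<in> span ?B" by (intro span_sum span_scale span_base) auto
    then have "?y \<in> pts X" using span_minimal[OF B sub] by blast
    then have "f - ?y \<in> pts X" using subspace_diff[OF sub f] by blast
    moreover have "AE x in M. (f - ?y) x = 0" using c by eventually_elim (simp add: sum_scaleR_apply)
    ultimately have "nrm X (f - ?y) = 0" by (rule null)
    then show "\<exists>y\<in>span ?B. nrm X (f - y) = 0" using y by blast
  qed (use B in auto)
qed

lemma Linf_dichotomy: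
  assumes M: "sigma_finite_measure M"
  shows "has_linf_systems (Linf_space M) (dual_space (Linf_space M)) \<or> finite_dimensional_mod_null (Linf_space M)"
proof (cases "\<forall>n. \<exists>A. disjoint_positive_sets M n A")
  case False
  have "finite_dimensional_mod_null (Linf_space M)"
  proof (rule finite_dimensional_if_atoms[OF seminormed_Linf Linf_measurable _ _ M False])
    fix f assume f: "f \<in> pts (Linf_space M)" "AE x in M. f x = 0"
    have "nrm (Linf_space M) f \<le> 0"
      using f(2) by (intro Linf_norm_le Linf_measurable[OF f(1)]) (auto elim: eventually_mono)
    then show "nrm (Linf_space M) f = 0" using Linf_norm_nonneg[OF f(1)] by simp
  next
    fix A assume "A \<in> sets M"
    then show "indicator A \<in> pts (Linf_space M)"
      by (intro Linf_memI[where C = 1]) (auto simp: indicator_def)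
  qed
  then show ?thesis ..
qed (use Linf_linf_systems in blast)

lemma seminormed_L1: "seminormed_space (L1_space M)"
proof -
  have "(\<integral>x. \<bar>f x + g x\<bar> \<partial>M) \<le> (\<integral>x. \<bar>f x\<bar> \<partial>M) + (\<integral>x. \<bar>g x\<bar> \<partial>M)"
    if "integrable M f" "integrable M g" for f g :: "'a \<Rightarrow> real"
  proof -
    have "(\<integral>x. \<bar>f x + g x\<bar> \<partial>M) \<le> (\<integral>x. \<bar>f x\<bar> + \<bar>g x\<bar> \<partial>M)"
      using that by (intro integral_mono) auto
    then show ?thesis using that by simp
  qed
  then show ?thesis
    by (auto simp: seminormed_space_def subspace_def L1_space_def plus_fun_def zero_fun_def
        scaleR_fun_def abs_mult)
qed

lemma L1_contains_l1:
  assumes sets: "\<forall>n. \<exists>A. disjoint_positive_sets M n A"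
  shows "uniformly_contains_l1 (L1_space M)"
proof -
  let ?X = "L1_space M"
  have "\<exists>e. l1_basis ?X 1 n e" for n
  proof -
    obtain A where A: "disjoint_positive_sets M n A" using sets by blast
    have As: "A i \<in> sets M" "emeasure M (A i) \<noteq> 0" "emeasure M (A i) < \<infinity>" if "i < n" for i
      using A that by (simp_all add: disjoint_positive_sets_def)
    have pos: "0 < measure M (A i)" if "i < n" for i
      using As[OF that] by (simp add: measure_def enn2real_positive_iff zero_less_iff_neq_zero)
    define e where "e i = (\<lambda>x. indicator (A i) x / measure M (A i))" for i
    have int: "integrable M (\<lambda>x. c * (indicator (A i) x / measure M (A i)))" if "i < n" for i and c :: real
      using As[OF that] by (intro integrable_mult_right integrable_divide integrable_real_indicator) auto
    have one: "(\<integral>x. indicator (A i) x / measure M (A i) \<partial>M) = 1" if i: "i < n" for i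
      using As[OF i] pos[OF i] sets.sets_into_space[OF As(1)[OF i]] by (simp add: Int_absorb2)
    have e: "e i \<in> pts ?X \<and> nrm ?X (e i) \<le> 1" if i: "i < n" for i
    proof -
      have "(\<integral>x. \<bar>indicator (A i) x / measure M (A i)\<bar> \<partial>M) = 1"
        using one[OF i] by (simp add: abs_divide)
      then show ?thesis using int[OF i, of 1] by (simp add: L1_space_def e_def)
    qed
    have "(\<Sum>i<n. \<bar>c i\<bar>) \<le> 1 * nrm ?X (\<Sum>i<n. c i *\<^sub>R e i)" for c
    proof -
      have eq: "\<bar>(\<Sum>i<n. c i *\<^sub>R e i) x\<bar> = (\<Sum>i<n. \<bar>c i\<bar> * (indicator (A i) x / measure M (A i)))" for x
      proof (cases "\<exists>k<n. x \<in> A k")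
        case True
        then obtain k where k: "k < n" "x \<in> A k" by blast
        show ?thesis
          using disjoint_positive_sets_apply[OF A k, of "\<lambda>i. c i / measure M (A i)"]
            disjoint_positive_sets_apply[OF A k, of "\<lambda>i. \<bar>c i\<bar> / measure M (A i)"]
          by (simp add: sum_scaleR_apply e_def abs_divide)
      next
        case False
        then show ?thesis by (simp add: sum_scaleR_apply e_def indicator_def)
      qed
      have "nrm ?X (\<Sum>i<n. c i *\<^sub>R e i) = (\<integral>x. (\<Sum>i<n. \<bar>c i\<bar> * (indicator (A i) x / measure M (A i))) \<partial>M)"
        unfolding L1_space_def nspace.sel eq ..
      also have "\<dots> = (\<Sum>i<n. \<integral>x. \<bar>c i\<bar> * (indicator (A i) x / measure M (A i)) \<partial>M)"
        by (rule Bochner_Integration.integral_sum) (use int in simp)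
      also have "\<dots> = (\<Sum>i<n. \<bar>c i\<bar>)"
      proof (rule sum.cong[OF refl])
        fix i assume "i \<in> {..<n}"
        then show "(\<integral>x. \<bar>c i\<bar> * (indicator (A i) x / measure M (A i)) \<partial>M) = \<bar>c i\<bar>"
          using one[of i] unfolding integral_mult_right_zero by simp
      qed
      finally show ?thesis by simp
  qed
  then show ?thesis using e unfolding l1_basis_def by blast
  qed
  then show ?thesis unfolding uniformly_contains_l1_def by (intro exI[of _ 1]) simp
qed

lemma L1_dichotomy:
  assumes M: "sigma_finite_measure M"
  shows "uniformly_contains_l1 (L1_space M) \<or> finite_dimensional_mod_null (L1_space M)"
proof (cases "\<forall>n. \<exists>A. disjoint_positive_sets M n A")
  case False
  have "finite_dimensional_mod_null (L1_space M)"
  proof (rule finite_dimensional_if_atoms[OF seminormed_L1 _ _ _ M False])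
    fix f assume f: "f \<in> pts (L1_space M)" "AE x in M. f x = 0"
    have "(\<integral>x. \<bar>f x\<bar> \<partial>M) = 0"
      using f(2) by (intro integral_eq_zero_AE) (auto elim: eventually_mono)
    then show "nrm (L1_space M) f = 0" by (simp add: L1_space_def)
  qed (auto simp: L1_space_def)
  then show ?thesis ..
qed (use L1_contains_l1 in blast)

section \<open>Lipschitz functions and Lipschitz-free spaces\<close>

text \<open>
  Some vertex has in-degree at most \<open>1\<close>, because the average in-degree is at most \<open>1\<close>.  Taking it and discarding
  its image and its preimage costs at most three vertices per step.
\<close>

lemma independent_subset_of_functional_graph:
  assumes "finite P" "3 * n \<le> card P" "\<And>i. i \<in> P \<Longrightarrow> g i \<noteq> i"
  shows "\<exists>I\<subseteq>P. card I = n \<and> (\<forall>i\<in>I. \<forall>j\<in>I. g i \<noteq> j)"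
  using assms
proof (induction n arbitrary: P)
  case 0
  then show ?case by (intro exI[of _ "{}"]) auto
next
  case (Suc n)
  note P = \<open>finite P\<close>
  have "\<exists>j\<in>P. card {i \<in> P. g i = j} \<le> 1"
  proof (rule ccontr)
    assume "\<not> ?thesis"
    then have two: "2 \<le> card {i \<in> P. g i = j}" if "j \<in> P" for j using that by force
    have "2 * card P \<le> (\<Sum>j\<in>P. card {i \<in> P. g i = j})"
      using sum_mono[of P "\<lambda>_. 2 :: nat" "\<lambda>j. card {i \<in> P. g i = j}"] two by (simp add: mult.commute)
    also have "\<dots> = card (\<Union>j\<in>P. {i \<in> P. g i = j})"
      using P by (intro card_UN_disjoint[symmetric]) auto
    also have "\<dots> \<le> card P" using P by (intro card_mono) auto
    finally show False using Suc.prems(2) by simp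
  qed
  then obtain j where j: "j \<in> P" "card {i \<in> P. g i = j} \<le> 1" by blast
  define Q where "Q = P - ({j, g j} \<union> {i \<in> P. g i = j})"
  have "card ({j, g j} \<union> {i \<in> P. g i = j}) \<le> 3"
    using card_Un_le[of "{j, g j}" "{i \<in> P. g i = j}"] card_insert_le_m1[of 2 "{g j}" j] j(2) by simp
  then have "3 * n \<le> card Q"
    unfolding Q_def using Suc.prems(2) diff_card_le_card_Diff[of "{j, g j} \<union> {i \<in> P. g i = j}" P] P by simp
  moreover have "finite Q" "Q \<subseteq> P" using P by (auto simp: Q_def)
  ultimately obtain I where I: "I \<subseteq> Q" "card I = n" "\<forall>i\<in>I. \<forall>k\<in>I. g i \<noteq> k"
    using Suc.IH[of Q] Suc.prems(3) by blast
  have "j \<notin> I" "finite I" using I(1) \<open>finite Q\<close> finite_subset by (auto simp: Q_def)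
  moreover have "insert j I \<subseteq> P" using I(1) \<open>Q \<subseteq> P\<close> j(1) by blast
  moreover have "\<forall>i\<in>insert j I. \<forall>k\<in>insert j I. g i \<noteq> k"
    using I(1,3) Suc.prems(3)[OF j(1)] by (auto simp: Q_def)
  ultimately show ?case using I(2) by (intro exI[of _ "insert j I"]) auto
qed

text \<open>
  Balls whose radius is half the distance \<open>2 r\<^sub>i\<close> of the centre \<open>x\<^sub>i\<close> to its nearest neighbour \<open>y\<^sub>i\<close> are disjoint.
  The neighbour must not itself be a centre; this is why an independent set is chosen.
\<close>

lemma separated_molecules_exist:
  fixes M :: "'m metric"
  assumes inf: "infinite (mspace M)"
  shows "\<exists>(x :: nat \<Rightarrow> 'm) y r. (\<forall>i<n. x i \<in> mspace M \<and> y i \<in> mspace M \<and> 0 < r i \<and> mdist M (x i) (y i) = 2 * r i) \<and>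
    (\<forall>i<n. \<forall>j<n. i \<noteq> j \<longrightarrow> r i + r j \<le> mdist M (x i) (x j) \<and> r j \<le> mdist M (y i) (x j))"
proof -
  obtain P where P: "finite P" "card P = 3 * n + 2" "P \<subseteq> mspace M"
    using infinite_arbitrarily_large[OF inf] by metis
  have "\<exists>q. p \<in> P \<longrightarrow> q \<in> P - {p} \<and> (\<forall>s\<in>P - {p}. mdist M p q \<le> mdist M p s)" for p
  proof (cases "p \<in> P")
    case True
    have ne: "P - {p} \<noteq> {}"
    proof
      assume "P - {p} = {}"
      then have "card P \<le> card {p}" by (intro card_mono) auto
      then show False using P(2) by simp
    qed
    have fin: "finite (P - {p})" using P(1) by simp
    show ?thesis
      using arg_min_if_finite[OF fin ne, of "mdist M p"] by (meson not_le)
  qed simp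
  then have "\<forall>p. \<exists>q. p \<in> P \<longrightarrow> q \<in> P - {p} \<and> (\<forall>s\<in>P - {p}. mdist M p q \<le> mdist M p s)" by (rule allI)
  from choice[OF this] obtain g
    where g': "\<forall>p. p \<in> P \<longrightarrow> g p \<in> P - {p} \<and> (\<forall>s\<in>P - {p}. mdist M p (g p) \<le> mdist M p s)"
    by (elim exE) (rule that)
  have g: "g p \<in> P" "g p \<noteq> p" "\<And>s. s \<in> P \<Longrightarrow> s \<noteq> p \<Longrightarrow> mdist M p (g p) \<le> mdist M p s" if "p \<in> P" for p
    using g' that by auto
  obtain I where I: "I \<subseteq> P" "card I = n" "\<forall>i\<in>I. \<forall>j\<in>I. g i \<noteq> j"
    using independent_subset_of_functional_graph[OF P(1), of n g] P(2) g(2) by auto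
  have "finite I" using I(1) P(1) by (rule finite_subset)
  then obtain x where x: "bij_betw x {..<n} I"
    using ex_bij_betw_nat_finite[of I] I(2) by (auto simp: atLeast0LessThan)
  have xI: "x i \<in> I" "x i \<in> P" if "i < n" for i using x that I(1) by (auto simp: bij_betw_def)
  have x_ne: "x i \<noteq> x j" if "i < n" "j < n" "i \<noteq> j" for i j
    using x that by (auto simp: bij_betw_def inj_on_def)
  define r where "r i = mdist M (x i) (g (x i)) / 2" for i
  show ?thesis
  proof (rule exI[of _ x], rule exI[of _ "g \<circ> x"], rule exI[of _ r], intro conjI allI impI)
    fix i assume i: "i < n"
    show "x i \<in> mspace M" "(g \<circ> x) i \<in> mspace M" using xI[OF i] g(1) P(3) by auto
    then show "0 < r i" using mdist_pos[of "x i" M "g (x i)"] g(2)[OF xI(2)[OF i]] by (auto simp: r_def)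
    show "mdist M (x i) ((g \<circ> x) i) = 2 * r i" by (simp add: r_def)
  next
    fix i j assume ij: "i < n" "j < n" "i \<noteq> j"
    have near: "2 * r j \<le> mdist M (x j) s" if "s \<in> P" "s \<noteq> x j" "j < n" for s j
      using g(3)[OF xI(2)[OF that(3)] that(1,2)] by (simp add: r_def)
    have r0: "0 \<le> r j" by (simp add: r_def)
    show "r i + r j \<le> mdist M (x i) (x j)"
      using near[OF xI(2)[OF ij(1)] x_ne[OF ij] ij(2)]
        near[OF xI(2)[OF ij(2)] x_ne[OF ij, symmetric] ij(1)] by (simp add: mdist_commute)
    have "g (x i) \<noteq> x j" using I(3) xI(1) ij by blast
    then show "r j \<le> mdist M ((g \<circ> x) i) (x j)"
      using near[OF g(1)[OF xI(2)[OF ij(1)]] _ ij(2)] r0 by (simp add: mdist_commute)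
  qed
qed

text \<open>
  Distance bumps on disjoint balls: at any two points at most two of them are active, and each is
  \<open>1\<close>-Lipschitz, so signed sums are \<open>2\<close>-Lipschitz.  Subtracting the value at the base point \<open>e\<close> does
  not change differences.
\<close>

lemma lipschitz_bumps_exist:
  fixes M :: "'m metric"
  assumes inf: "infinite (mspace M)" and e: "e \<in> mspace M"
  shows "\<exists>(x :: nat \<Rightarrow> 'm) y F. (\<forall>i<n. x i \<in> mspace M \<and> y i \<in> mspace M \<and> x i \<noteq> y i \<and> F i \<in> pts (Lip0_space M e)) \<and>
    (\<forall>i<n. \<forall>j<n. F j (x i) - F j (y i) = (if i = j then mdist M (x i) (y i) / 2 else 0)) \<and>
    (\<forall>\<epsilon>. (\<forall>i. \<bar>\<epsilon> i\<bar> \<le> 1) \<longrightarrow> nrm (Lip0_space M e) (\<Sum>i<n. \<epsilon> i *\<^sub>R F i) \<le> 2)"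
proof -
  obtain x y r where
    xyr: "\<forall>i<n. x i \<in> mspace M \<and> y i \<in> mspace M \<and> 0 < r i \<and> mdist M (x i) (y i) = 2 * r i"
    and sep: "\<forall>i<n. \<forall>j<n. i \<noteq> j \<longrightarrow> r i + r j \<le> mdist M (x i) (x j) \<and> r j \<le> mdist M (y i) (x j)"
    using separated_molecules_exist[OF inf, of n] by (elim exE conjE) (rule that)
  have xy: "x i \<in> mspace M" "y i \<in> mspace M" "0 < r i" "mdist M (x i) (y i) = 2 * r i" if "i < n" for i
    using xyr that by simp_all
  have sep1: "r i + r j \<le> mdist M (x i) (x j)" and sep2: "r j \<le> mdist M (y i) (x j)"
    if "i < n" "j < n" "i \<noteq> j" for i j
    using sep that by simp_all
  define f where "f i z = max 0 (r i - mdist M z (x i))" for i z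
  define F where "F i z = (if z \<in> mspace M then f i z - f i e else 0)" for i z
  have f_lip: "\<bar>f i z - f i w\<bar> \<le> mdist M z w" if "i < n" "z \<in> mspace M" "w \<in> mspace M" for i z w
    using mdist_triangle[of z M w "x i"] mdist_triangle[of w M z "x i"] that xy(1)[OF that(1)]
    by (auto simp: f_def mdist_commute[of M w z])
  have F_mem: "F i \<in> pts (Lip0_space M e)" if "i < n" for i
    using f_lip[OF that] e lipschitz_bound_imp_Lip0[of M e "F i" 1] by (simp add: lipschitz_bound_def F_def)
  have F_val: "F j (x i) - F j (y i) = (if i = j then mdist M (x i) (y i) / 2 else 0)" if ij: "i < n" "j < n" for i j
  proof (cases "i = j")
    case True
    have d0: "mdist M (x i) (x i) = 0" using xy(1)[OF ij(1)] by simp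
    have "f i (x i) = r i" unfolding f_def d0 using xy(3)[OF ij(1)] by simp
    moreover have "f i (y i) = 0"
      using xy[OF ij(1)] by (simp add: f_def mdist_commute[of M "y i"])
    ultimately have "f i (x i) = r i" "f i (y i) = 0" by simp_all
    then show ?thesis using True xy[OF ij(1)] by (simp add: F_def)
  next
    case False
    have "f j (x i) = 0" "f j (y i) = 0"
      using sep1[OF ij False] sep2[OF ij False] xy(3)[OF ij(1)] by (simp_all add: f_def)
    then show ?thesis using False xy(1,2)[OF ij(1)] by (simp add: F_def)
  qed
  have "nrm (Lip0_space M e) (\<Sum>i<n. \<epsilon> i *\<^sub>R F i) \<le> 2" if \<epsilon>: "\<forall>i. \<bar>\<epsilon> i\<bar> \<le> 1" for \<epsilon>
  proof -
    have "\<bar>(\<Sum>i<n. \<epsilon> i *\<^sub>R F i) z - (\<Sum>i<n. \<epsilon> i *\<^sub>R F i) w\<bar> \<le> 2 * mdist M z w"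
      if zw: "z \<in> mspace M" "w \<in> mspace M" for z w
    proof -
      define S where "S v = {i. i < n \<and> f i v \<noteq> 0}" for v
      have S_card: "card (S v) \<le> 1" if v: "v \<in> mspace M" for v
      proof -
        have "i = j" if "i \<in> S v" "j \<in> S v" for i j
        proof (rule ccontr)
          assume ne: "i \<noteq> j"
          have ij: "i < n" "j < n" and "mdist M v (x i) < r i" "mdist M v (x j) < r j"
            using that by (auto simp: S_def f_def max_def split: if_splits)
          then show False
            using sep1[OF ij ne] mdist_triangle[of "x i" M v "x j"] xy(1) v by (simp add: mdist_commute)
        qed
        then have "card (S v) \<le> Suc 0" by (subst card_le_Suc0_iff_eq) (auto simp: S_def)
        then show ?thesis by simp
      qed
      have "(\<Sum>i<n. \<epsilon> i *\<^sub>R F i) z - (\<Sum>i<n. \<epsilon> i *\<^sub>R F i) w = (\<Sum>i<n. \<epsilon> i * (f i z - f i w))"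
        using zw by (simp add: sum_scaleR_apply F_def sum_subtractf[symmetric] algebra_simps)
      also have "\<bar>\<dots>\<bar> \<le> (\<Sum>i<n. \<bar>f i z - f i w\<bar>)"
      proof (rule order_trans[OF sum_abs], rule sum_mono)
        fix i
        show "\<bar>\<epsilon> i * (f i z - f i w)\<bar> \<le> \<bar>f i z - f i w\<bar>"
          using mult_right_mono[of "\<bar>\<epsilon> i\<bar>" 1 "\<bar>f i z - f i w\<bar>"] \<epsilon> by (simp add: abs_mult)
      qed
      also have "\<dots> = (\<Sum>i\<in>S z \<union> S w. \<bar>f i z - f i w\<bar>)"
        by (rule sum.mono_neutral_right) (auto simp: S_def)
      also have "\<dots> \<le> (\<Sum>i\<in>S z \<union> S w. mdist M z w)"
        by (intro sum_mono f_lip zw) (auto simp: S_def)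
      also have "\<dots> = real (card (S z \<union> S w)) * mdist M z w" by simp
      also have "\<dots> \<le> 2 * mdist M z w"
        using card_Un_le[of "S z" "S w"] S_card[OF zw(1)] S_card[OF zw(2)] by (intro mult_right_mono) auto
      finally show ?thesis .
    qed
    moreover have mem: "(\<Sum>i<n. \<epsilon> i *\<^sub>R F i) \<in> pts (Lip0_space M e)"
      using F_mem by (intro subspace_sum subspace_scale seminormed_spaceD(1)[OF seminormed_Lip0]) simp
    ultimately show ?thesis
      using lipschitz_bound_imp_Lip0[of M e "\<Sum>i<n. \<epsilon> i *\<^sub>R F i" 2] Lip0_memD(1,2)[OF mem]
      by (simp add: lipschitz_bound_def)
  qed
  moreover have "x i \<noteq> y i" if "i < n" for i
  proof
    assume "x i = y i"
    then have "mdist M (x i) (y i) = 0" using xy(1)[OF that] by simp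
    then show False using xy(3,4)[OF that] by linarith
  qed
  ultimately show ?thesis
    using xy(1,2) F_mem F_val
    by - (rule exI[of _ x], rule exI[of _ y], rule exI[of _ F], simp)
qed

lemma lipschitz_free_pts:
  "pts (lipschitz_free M e) = {\<phi> \<in> pts (dual_space (Lip0_space M e)). \<forall>\<epsilon>>0.
    \<exists>\<psi>\<in>span (evaluation M e ` mspace M). nrm (dual_space (Lip0_space M e)) (\<phi> - \<psi>) < \<epsilon>}"
  and lipschitz_free_nrm: "nrm (lipschitz_free M e) = nrm (dual_space (Lip0_space M e))"
  by (simp_all add: lipschitz_free_def Let_def)

lemma evaluation_dual:
  assumes e: "e \<in> mspace M" and x: "x \<in> mspace M"
  shows "evaluation M e x \<in> pts (dual_space (Lip0_space M e))"
proof -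
  note sub = seminormed_spaceD(1)[OF seminormed_Lip0[of M e]]
  have "functional_bound (Lip0_space M e) (evaluation M e x) (mdist M x e)"
  proof (rule functional_boundI)
    fix f assume f: "f \<in> pts (Lip0_space M e)"
    show "\<bar>evaluation M e x f\<bar> \<le> mdist M x e * nrm (Lip0_space M e) f"
      using Lip0_norm_bound[OF f x e] Lip0_memD(1)[OF f] f by (simp add: evaluation_def mult.commute)
  qed (use subspace_add[OF sub] subspace_scale[OF sub] in \<open>auto simp: evaluation_def scaleR_fun_def\<close>)
  then show ?thesis using functional_bound_imp_dual by (metis mdist_nonneg)
qed

lemma dual_subspace_lipschitz_free:
  assumes e: "e \<in> mspace M"
  shows "dual_subspace (Lip0_space M e) (lipschitz_free M e)"
proof -
  let ?D = "dual_space (Lip0_space M e)" and ?F = "lipschitz_free M e"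
  let ?S = "span (evaluation M e ` mspace M)"
  note D = seminormed_dual_space[OF seminormed_Lip0[of M e]]
  note subD = seminormed_spaceD(1)[OF D]
  have SD: "?S \<subseteq> pts ?D" using evaluation_dual[OF e] by (intro span_minimal subD) auto
  have sub: "subspace (pts ?F)"
    unfolding subspace_def
  proof (intro conjI ballI allI)
    show "0 \<in> pts ?F"
      using subspace_0[OF subD] nrm_zero[OF D] span_zero
      by (auto simp: lipschitz_free_pts intro!: bexI[of _ 0])
  next
    fix \<alpha> \<beta> assume a: "\<alpha> \<in> pts ?F" and b: "\<beta> \<in> pts ?F"
    have mem: "\<alpha> \<in> pts ?D" "\<beta> \<in> pts ?D" using a b by (simp_all add: lipschitz_free_pts)
    have "\<exists>\<psi>\<in>?S. nrm ?D (\<alpha> + \<beta> - \<psi>) < \<epsilon>" if "0 < \<epsilon>" for \<epsilon>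
    proof -
      have approx: "\<exists>\<psi>\<in>?S. nrm ?D (\<phi> - \<psi>) < \<epsilon> / 2" if "\<phi> \<in> pts ?F" for \<phi>
        using that half_gt_zero[OF \<open>0 < \<epsilon>\<close>] unfolding lipschitz_free_pts by blast
      obtain \<psi> where p: "\<psi> \<in> ?S" "nrm ?D (\<alpha> - \<psi>) < \<epsilon> / 2" using approx[OF a] by (elim bexE) (rule that)
      obtain \<eta> where c: "\<eta> \<in> ?S" "nrm ?D (\<beta> - \<eta>) < \<epsilon> / 2" using approx[OF b] by (elim bexE) (rule that)
      have "\<alpha> - \<psi> \<in> pts ?D" "\<beta> - \<eta> \<in> pts ?D" using mem p(1) c(1) SD by (auto intro!: subspace_diff[OF subD])
      then have "nrm ?D ((\<alpha> - \<psi>) + (\<beta> - \<eta>)) \<le> nrm ?D (\<alpha> - \<psi>) + nrm ?D (\<beta> - \<eta>)"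
        by (rule seminormed_spaceD(4)[OF D])
      moreover have "(\<alpha> - \<psi>) + (\<beta> - \<eta>) = \<alpha> + \<beta> - (\<psi> + \<eta>)" by simp
      ultimately have "nrm ?D (\<alpha> + \<beta> - (\<psi> + \<eta>)) < \<epsilon>" using p(2) c(2) by simp
      then show ?thesis using span_add[OF p(1) c(1)] by blast
    qed
    then show "\<alpha> + \<beta> \<in> pts ?F" using subspace_add[OF subD mem] by (simp add: lipschitz_free_pts)
  next
    fix c \<alpha> assume a: "\<alpha> \<in> pts ?F"
    have mem: "\<alpha> \<in> pts ?D" using a by (simp add: lipschitz_free_pts)
    have "\<exists>\<psi>\<in>?S. nrm ?D (c *\<^sub>R \<alpha> - \<psi>) < \<epsilon>" if "0 < \<epsilon>" for \<epsilon>
    proof -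
      have "0 < \<epsilon> / (\<bar>c\<bar> + 1)" using that by simp
      then obtain \<psi> where p: "\<psi> \<in> ?S" "nrm ?D (\<alpha> - \<psi>) < \<epsilon> / (\<bar>c\<bar> + 1)"
        using a unfolding lipschitz_free_pts by blast
      have d: "\<alpha> - \<psi> \<in> pts ?D" using mem p(1) SD by (auto intro!: subspace_diff[OF subD])
      have "nrm ?D (c *\<^sub>R (\<alpha> - \<psi>)) = \<bar>c\<bar> * nrm ?D (\<alpha> - \<psi>)" by (rule seminormed_spaceD(3)[OF D d])
      also have "\<dots> \<le> (\<bar>c\<bar> + 1) * nrm ?D (\<alpha> - \<psi>)"
        using seminormed_spaceD(2)[OF D d] by (intro mult_right_mono) auto
      also have "\<dots> < \<epsilon>" using p(2) by (subst (asm) pos_less_divide_eq) (auto simp: mult.commute)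
      finally have "nrm ?D (c *\<^sub>R \<alpha> - c *\<^sub>R \<psi>) < \<epsilon>" by (simp add: scaleR_diff_right)
      then show ?thesis using span_scale[OF p(1)] by blast
    qed
    then show "c *\<^sub>R \<alpha> \<in> pts ?F" using subspace_scale[OF subD mem] by (simp add: lipschitz_free_pts)
  qed
  then show ?thesis by (auto simp: dual_subspace_def lipschitz_free_nrm lipschitz_free_pts)
qed

text \<open>
  The functionals biorthogonal to the bumps are the normalised molecules, that is, differences of
  two evaluations.  They belong to the free space, so this one system serves both
  \<open>Lip\<^sub>0(M)\<close> and \<open>\<F>(M)\<close>.
\<close>

lemma Lip0_linf_systems:
  fixes M :: "'m metric"
  assumes e: "e \<in> mspace M" and inf: "infinite (mspace M)"
  shows "has_linf_systems (Lip0_space M e) (lipschitz_free M e)"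
proof -
  let ?X = "Lip0_space M e" and ?D = "dual_space (Lip0_space M e)"
  note D = seminormed_dual_space[OF seminormed_Lip0[of M e]]
  note subD = seminormed_spaceD(1)[OF D]
  have "\<exists>x h. linf_system ?X (lipschitz_free M e) 2 n x h" for n
  proof -
    obtain x y F where
      xy': "\<forall>i<n. x i \<in> mspace M \<and> y i \<in> mspace M \<and> x i \<noteq> y i \<and> F i \<in> pts ?X"
      and F: "\<forall>i<n. \<forall>j<n. F j (x i) - F j (y i) = (if i = j then mdist M (x i) (y i) / 2 else 0)"
      and nrm: "\<forall>\<epsilon>. (\<forall>i. \<bar>\<epsilon> i\<bar> \<le> 1) \<longrightarrow> nrm ?X (\<Sum>i<n. \<epsilon> i *\<^sub>R F i) \<le> 2"
      using lipschitz_bumps_exist[OF inf e, of n] by (elim exE conjE) (rule that)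
    have xy: "x i \<in> mspace M" "y i \<in> mspace M" "x i \<noteq> y i" "F i \<in> pts ?X" if "i < n" for i
      using xy' that by simp_all
    define m where "m i = (2 / mdist M (x i) (y i)) *\<^sub>R (evaluation M e (x i) - evaluation M e (y i))" for i
    have m_apply: "m i f = 2 * (f (x i) - f (y i)) / mdist M (x i) (y i)" if "f \<in> pts ?X" for i f
      using that by (simp add: m_def scaleR_fun_def evaluation_def)
    have m: "m i \<in> pts ?D" "m i \<in> span (evaluation M e ` mspace M)" if "i < n" for i
      unfolding m_def using xy[OF that]
      by (auto intro!: subspace_scale[OF subD] subspace_diff[OF subD] evaluation_dual[OF e]
          span_scale span_diff intro: span_base)
    have "functional_bound ?X (m i) 2" if i: "i < n" for i
    proof (rule functional_boundI)
      fix f assume f: "f \<in> pts ?X"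
      show "\<bar>m i f\<bar> \<le> 2 * nrm ?X f"
        using Lip0_norm_bound[OF f xy(1,2)[OF i]] mdist_pos[OF xy(1-3)[OF i]]
        by (simp add: m_apply[OF f] abs_divide divide_le_eq abs_mult)
    qed (use dual_spaceD[OF m(1)[OF i]] in auto)
    then have "nrm ?D (m i) \<le> 2" if "i < n" for i using functional_bound_imp_dual[of ?X _ 2] that by simp
    moreover have "m i \<in> pts (lipschitz_free M e)" if "i < n" for i
      using m[OF that] nrm_zero[OF D] by (auto simp: lipschitz_free_pts intro!: bexI[of _ "m i"])
    moreover have "m i (F j) = (if i = j then 1 else 0)" if "i < n" "j < n" for i j
      using F[rule_format, OF that] mdist_pos[OF xy(1-3)[OF that(1)]] by (cases "i = j") (auto simp: m_apply[OF xy(4)[OF that(2)]])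
    ultimately show ?thesis
      using xy(4) nrm unfolding linf_system_def lipschitz_free_nrm by (intro exI[of _ F] exI[of _ m]) simp
  qed
  then show ?thesis unfolding has_linf_systems_def by blast
qed

lemma has_linf_systems_mono:
  assumes "dual_subspace X F" "has_linf_systems X F"
  shows "has_linf_systems X (dual_space X)"
proof -
  have "linf_system X (dual_space X) C n x h" if "linf_system X F C n x h" for C n x h
    using assms(1) that unfolding dual_subspace_def linf_system_def by auto
  then show ?thesis using assms(2) unfolding has_linf_systems_def by blast
qed

lemma Lip0_finite:
  assumes fin: "finite (mspace M)"
  shows "finite_dimensional_mod_null (Lip0_space M e)"
  by (rule finite_dimensional_functions_on_finite_set[OF seminormed_Lip0 fin]) (rule Lip0_memD(2))

lemma Lip0_dichotomy:
  assumes e: "e \<in> mspace M"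
  shows "has_linf_systems (Lip0_space M e) (dual_space (Lip0_space M e)) \<or>
    finite_dimensional_mod_null (Lip0_space M e)"
proof (cases "finite (mspace M)")
  case False
  then show ?thesis
    using has_linf_systems_mono[OF dual_subspace_lipschitz_free[OF e] Lip0_linf_systems[OF e]] by blast
qed (simp add: Lip0_finite)

text \<open>
  For finite \<open>M\<close> the free space is a subspace of a dual space that is finite-dimensional modulo null vectors,
  and a functional of norm \<open>0\<close> is itself \<open>0\<close>.
\<close>

lemma lipschitz_free_dichotomy:
  assumes e: "e \<in> mspace M"
  shows "uniformly_contains_l1 (lipschitz_free M e) \<or> finite_dimensional_mod_null (lipschitz_free M e)"
proof (cases "finite (mspace M)")
  case False
  note F = dual_subspace_lipschitz_free[OF e]
  have "has_l1_systems (lipschitz_free M e)"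
    by (rule linf_systems_imp_l1_systems_dual[OF seminormed_Lip0 F Lip0_linf_systems[OF e False]])
  then have "uniformly_contains_l1 (lipschitz_free M e)"
    by (rule l1_systems_imp_uniformly_contains_l1[OF seminormed_dual_subspace[OF seminormed_Lip0 F]])
  then show ?thesis ..
next
  case True
  let ?X = "Lip0_space M e" and ?D = "dual_space (Lip0_space M e)" and ?F = "lipschitz_free M e"
  note X = seminormed_Lip0[of M e] and F = dual_subspace_lipschitz_free[OF e]
  note D = seminormed_dual_space[OF X]
  obtain B where B: "finite B" "B \<subseteq> pts ?D" "\<forall>\<phi>\<in>pts ?D. \<exists>\<psi>\<in>span B. nrm ?D (\<phi> - \<psi>) = 0"
    using finite_dimensional_mod_null_dual[OF X Lip0_finite[OF True]] unfolding finite_dimensional_mod_null_def by blast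
  have "pts ?F \<subseteq> span B"
  proof
    fix \<phi> assume "\<phi> \<in> pts ?F"
    then have \<phi>: "\<phi> \<in> pts ?D" by (simp add: lipschitz_free_pts)
    then obtain \<psi> where \<psi>: "\<psi> \<in> span B" "nrm ?D (\<phi> - \<psi>) = 0" using B(3) by blast
    have "\<psi> \<in> pts ?D" using \<psi>(1) span_minimal[OF B(2) seminormed_spaceD(1)[OF D]] by blast
    then have d: "\<phi> - \<psi> \<in> pts ?D" using subspace_diff[OF seminormed_spaceD(1)[OF D] \<phi>] by blast
    have "(\<phi> - \<psi>) f = 0" for f
    proof (cases "f \<in> pts ?X")
      case True
      then show ?thesis using dual_norm_bound[OF X d True] \<psi>(2) by simp
    qed (rule dual_spaceD(3)[OF d])
    then have "\<phi> = \<psi>" by (simp add: fun_eq_iff)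
    then show "\<phi> \<in> span B" using \<psi>(1) by simp
  qed
  moreover obtain A where A: "A \<subseteq> pts ?F" "independent A" "pts ?F \<subseteq> span A"
    using maximal_independent_subset by metis
  ultimately have "finite A" using independent_span_bound[OF B(1) A(2)] by blast
  then show ?thesis using finite_dimensional_mod_nullI[OF seminormed_dual_subspace[OF X F]] A by blast
qed

section \<open>Operators and bilinear mappings into spaces containing \<open>c\<^sub>0\<close>\<close>

lemma norm_one_functional_exists:
  assumes "infinite_dimensional TYPE('y::real_normed_vector)"
  shows "\<exists>f (y :: 'y). bounded_linear f \<and> (\<forall>x. \<bar>f x\<bar> \<le> norm x) \<and> f y = 1 \<and> norm y = 1"
proof -
  have "span {} \<noteq> (UNIV :: 'y set)" using assms unfolding infinite_dimensional_def by blast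
  then obtain y :: 'y where "y \<noteq> 0" by auto
  then have "norm (sgn y) = 1" by (simp add: norm_sgn)
  then show ?thesis using norming_functional_exists[of "sgn y"] by metis
qed

text \<open>Tensoring with a norming functional embeds \<open>Z\<close> isometrically; likewise for bilinear mappings.\<close>

lemma operators_contain_range:
  assumes Y: "infinite_dimensional TYPE('y::real_normed_vector)"
  shows "contains_copy_of (whole :: ('y \<Rightarrow>\<^sub>L 'z) nspace) (whole :: 'z::real_normed_vector nspace)"
proof -
  obtain f and y :: 'y where f: "bounded_linear f" "\<And>x. \<bar>f x\<bar> \<le> norm x" "f y = 1" "norm y = 1"
    using norm_one_functional_exists[OF Y] by blast
  define T where "T z = Blinfun (\<lambda>x. f x *\<^sub>R z)" for z :: 'z
  have T: "blinfun_apply (T z) x = f x *\<^sub>R z" for z x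
    unfolding T_def by (simp add: bounded_linear_Blinfun_apply[OF bounded_linear_scaleR_const[OF f(1)]])
  have "norm (T z) = norm z" for z
  proof (rule antisym)
    show "norm (T z) \<le> norm z"
      by (rule norm_blinfun_bound) (simp_all add: T mult.commute[of "norm z"] mult_right_mono f(2))
    show "norm z \<le> norm (T z)" using norm_blinfun[of "T z" y] by (simp add: T f)
  qed
  moreover have "linear_between UNIV UNIV T"
    by (simp add: linear_between_def blinfun_eqI T blinfun.add_left blinfun.scaleR_left algebra_simps)
  ultimately show ?thesis
    unfolding contains_copy_of_def by (intro exI[of _ T] exI[of _ "1 :: real"]) simp
qed

lemma bilinear_maps_contain_range:
  assumes P: "infinite_dimensional TYPE('p::real_normed_vector)" and Q: "infinite_dimensional TYPE('q::real_normed_vector)"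
  shows "contains_copy_of (Bil_space :: ('p \<Rightarrow> 'q \<Rightarrow> 'r) nspace) (whole :: 'r::real_normed_vector nspace)"
proof -
  obtain f and p :: 'p where f: "bounded_linear f" "\<And>x. \<bar>f x\<bar> \<le> norm x" "f p = 1" "norm p = 1"
    using norm_one_functional_exists[OF P] by blast
  obtain g and q :: 'q where g: "bounded_linear g" "\<And>x. \<bar>g x\<bar> \<le> norm x" "g q = 1" "norm q = 1"
    using norm_one_functional_exists[OF Q] by blast
  interpret f: bounded_linear f by (rule f(1))
  interpret g: bounded_linear g by (rule g(1))
  define T where "T z = (\<lambda>x y. (f x * g y) *\<^sub>R z)" for z :: 'r
  have fg: "\<bar>f x * g y\<bar> \<le> norm x * norm y" for x y
    unfolding abs_mult by (intro mult_mono f(2) g(2)) auto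
  have T_mem: "T z \<in> pts Bil_space" for z
    unfolding Bil_space_def nspace.sel mem_Collect_eq
  proof
    have "norm (T z x y) \<le> norm x * norm y * norm z" for x y
      using fg[of x y] by (simp add: T_def mult_right_mono)
    then show "\<exists>K. \<forall>x y. norm (T z x y) \<le> norm x * norm y * K" by blast
  qed (simp_all add: T_def f.add g.add f.scaleR g.scaleR algebra_simps)
  have "nrm Bil_space (T z) = norm z" for z
  proof -
    have le: "norm (T z x y) \<le> norm z" if "norm x \<le> 1" "norm y \<le> 1" for x y
    proof -
      have "\<bar>f x * g y\<bar> \<le> 1 * 1"
        using order_trans[OF f(2) that(1)] order_trans[OF g(2) that(2)]
        unfolding abs_mult by (intro mult_mono) auto
      then show ?thesis using mult_right_mono[of "\<bar>f x * g y\<bar>" 1 "norm z"] by (simp add: T_def)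
    qed
    show ?thesis
      unfolding Bil_space_def nspace.sel
    proof (rule antisym)
      show "Sup0 {norm (T z x y) |x y. norm x \<le> 1 \<and> norm y \<le> 1} \<le> norm z"
        using le by (intro Sup0_le) auto
      have "norm (T z p q) \<in> {norm (T z x y) |x y. norm x \<le> 1 \<and> norm y \<le> 1}"
        using f(4) g(4) by (intro CollectI exI[of _ p] exI[of _ q]) simp
      then have "norm (T z p q) \<le> Sup0 {norm (T z x y) |x y. norm x \<le> 1 \<and> norm y \<le> 1}"
        using le by (intro le_Sup0) auto
      then show "norm z \<le> Sup0 {norm (T z x y) |x y. norm x \<le> 1 \<and> norm y \<le> 1}"
        by (simp add: T_def f(3) g(3))
    qed
  qed
  moreover have "linear_between UNIV (pts Bil_space) T"
    using T_mem by (auto simp: linear_between_def T_def scaleR_fun_def fun_eq_iff algebra_simps)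
  ultimately show ?thesis
    unfolding contains_copy_of_def by (intro exI[of _ T] exI[of _ "1 :: real"]) simp
qed

section \<open>The classes of Banach spaces\<close>

text \<open>
  Except for the preduals of \<open>C(K)\<close>, the space \<open>E\<close> is isometric to a space, or to an iterated dual of a space,
  that contains \<open>\<ell>\<^sub>1\<^sup>n\<close> uniformly unless its dimension is finite.  The following lemmas pass from that space to \<open>E\<close>.
\<close>

lemma contains_copy_isometric:
  assumes copy: "contains_copy_of Y X" and iso: "isometrically_isomorphic Y Z"
  shows "contains_copy_of Z X"
proof -
  obtain T a b where T: "linear_between (pts X) (pts Y) T" and a: "0 < (a :: real)"
    and ab: "\<forall>x\<in>pts X. a * nrm X x \<le> nrm Y (T x) \<and> nrm Y (T x) \<le> b * nrm X x"
    using copy unfolding contains_copy_of_def by (elim exE conjE) (rule that)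
  obtain S where S: "isometry_onto Y Z S" using iso isometrically_isomorphic_iff by blast
  have T_mem: "T x \<in> pts Y" if "x \<in> pts X" for x using T that by (auto simp: linear_between_def)
  have "linear_between (pts X) (pts Z) (S \<circ> T)"
    using T isometry_onto_linear[OF S] T_mem by (auto simp: linear_between_def)
  moreover have "nrm Z ((S \<circ> T) x) = nrm Y (T x)" if "x \<in> pts X" for x
    using isometry_ontoD(4)[OF S T_mem[OF that]] by simp
  ultimately show ?thesis
    unfolding contains_copy_of_def using a ab
    by (intro exI[of _ "S \<circ> T"] exI[of _ a] exI[of _ b]) simp
qed

lemma linf_dichotomy_imp_l1_dichotomy:
  assumes X: "seminormed_space X"
    and alt: "has_linf_systems X (dual_space X) \<or> finite_dimensional_mod_null X"
  shows "uniformly_contains_l1 X \<or> finite_dimensional_mod_null X"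
  using alt l1_systems_imp_uniformly_contains_l1[OF X linf_systems_imp_l1_systems[OF X dual_subspace_dual[OF X]]]
  by blast

lemma not_grothendieck_if_isometric:
  assumes E: "infinite_dimensional TYPE('e::real_normed_vector)" and X: "seminormed_space X"
    and iso: "isometrically_isomorphic X (whole :: 'e nspace)"
    and alt: "uniformly_contains_l1 X \<or> finite_dimensional_mod_null X"
  shows "\<not> grothendieck (Lip0_space (euclidean_metric :: 'e metric) 0)"
proof -
  have "uniformly_contains_l1 X"
    using alt finite_dimensional_mod_null_isometric[OF X iso] infinite_dimensional_whole[OF E] by blast
  then have "uniformly_contains_l1 (whole :: 'e nspace)"
    by (rule uniformly_contains_l1_copy[OF X isometrically_isomorphic_imp_copy[OF iso]])
  then show ?thesis by (rule not_grothendieck_Lip0)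
qed

lemma not_grothendieck_if_iterated_dual:
  assumes E: "infinite_dimensional TYPE('e::real_normed_vector)" and X: "seminormed_space X"
    and dual: "iterated_dual TYPE('u::real_vector) n X (whole :: 'e nspace)"
    and alt: "has_linf_systems X (dual_space X) \<or> finite_dimensional_mod_null X"
  shows "\<not> grothendieck (Lip0_space (euclidean_metric :: 'e metric) 0)"
proof -
  have "has_l1_systems (whole :: 'e nspace)"
    using iterated_dual_dichotomy[OF X dual alt] infinite_dimensional_whole[OF E] by blast
  then show ?thesis
    by (rule not_grothendieck_Lip0[OF l1_systems_imp_uniformly_contains_l1[OF seminormed_whole]])
qed

text \<open>A copy of \<open>c\<^sub>0\<close> in \<open>Z\<close> only enters through the copies of \<open>\<ell>\<^sub>1\<^sup>n\<close> in it.\<close>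

lemma not_grothendieck_if_contains_c0:
  assumes Z: "seminormed_space Z" and c0: "contains_copy_of Z c0_space"
    and copy: "contains_copy_of Y Z" and iso: "isometrically_isomorphic Y (whole :: 'e::real_normed_vector nspace)"
  shows "\<not> grothendieck (Lip0_space (euclidean_metric :: 'e metric) 0)"
  by (rule not_grothendieck_Lip0[OF uniformly_contains_l1_copy[OF Z contains_copy_isometric[OF copy iso]
        copy_of_c0_contains_l1[OF c0]]])

theorem corollary5p21:
  fixes n :: nat
  assumes "infinite_dimensional TYPE('e::banach)"
  shows
    "((\<exists>Y :: 'a topology. Hausdorff_space Y \<and> locally_compact_space Y \<and>
          iterated_dual TYPE('u::real_vector) n (C0_space Y) (whole :: 'e nspace)) \<or>
      (\<exists>M :: 'b measure. sigma_finite_measure M \<and>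
          iterated_dual TYPE('u) n (Linf_space M) (whole :: 'e nspace)) \<or>
      (\<exists>K :: 'c topology. Hausdorff_space K \<and> compact_space K \<and>
          isometrically_isomorphic (C_space K) (whole :: ('e \<Rightarrow>\<^sub>L real) nspace)) \<or>
      (\<exists>M :: 'b measure. sigma_finite_measure M \<and>
          isometrically_isomorphic (L1_space M) (whole :: 'e nspace)) \<or>
      (infinite_dimensional TYPE('y::real_normed_vector) \<and>
          contains_copy_of (whole :: 'z::banach nspace) c0_space \<and>
          isometrically_isomorphic (whole :: ('y \<Rightarrow>\<^sub>L 'z) nspace) (whole :: 'e nspace)) \<or>
      (infinite_dimensional TYPE('p::banach) \<and> infinite_dimensional TYPE('q::banach) \<and>
          infinite_dimensional TYPE('r::banach) \<and>
          contains_copy_of (whole :: 'r nspace) c0_space \<and>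
          isometrically_isomorphic (Bil_space :: ('p \<Rightarrow> 'q \<Rightarrow> 'r) nspace) (whole :: 'e nspace)) \<or>
      (\<exists>(M :: 'm metric) e. e \<in> mspace M \<and>
          iterated_dual TYPE('u) n (Lip0_space M e) (whole :: 'e nspace)) \<or>
      (\<exists>(M :: 'm metric) e. e \<in> mspace M \<and>
          isometrically_isomorphic (lipschitz_free M e) (whole :: 'e nspace))
      \<longrightarrow> \<not> grothendieck (Lip0_space (euclidean_metric :: 'e metric) 0)) \<and>
     ((\<exists>K :: 'c topology. Hausdorff_space K \<and> compact_space K \<and>
          isometrically_isomorphic (C_space K) (whole :: 'e nspace)) \<or>
      (\<exists>M :: 'b measure. sigma_finite_measure M \<and>
          isometrically_isomorphic (L1_space M) (whole :: 'e nspace)) \<or>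
      (\<exists>(M :: 'm metric) e. e \<in> mspace M \<and>
          isometrically_isomorphic (Lip0_space M e) (whole :: 'e nspace)) \<or>
      (\<exists>(M :: 'm metric) e. e \<in> mspace M \<and>
          isometrically_isomorphic (lipschitz_free M e) (whole :: 'e nspace))
      \<longrightarrow> \<not> grothendieck (Lip0_space (euclidean_metric :: 'e metric) 0))"
proof -
  let ?G = "grothendieck (Lip0_space (euclidean_metric :: 'e metric) 0)"
  note not_G = not_grothendieck_if_isometric[OF assms]
    and not_G_dual = not_grothendieck_if_iterated_dual[OF assms]
  have c1: "\<not> ?G" if "\<exists>Y :: 'a topology. Hausdorff_space Y \<and> locally_compact_space Y \<and>
      iterated_dual TYPE('u) n (C0_space Y) (whole :: 'e nspace)"
    using that by (elim exE conjE) (rule not_G_dual[OF seminormed_C0 _ C0_dichotomy])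
  have c2: "\<not> ?G" if "\<exists>M :: 'b measure. sigma_finite_measure M \<and>
      iterated_dual TYPE('u) n (Linf_space M) (whole :: 'e nspace)"
    using that by (elim exE conjE) (rule not_G_dual[OF seminormed_Linf _ Linf_dichotomy])
  have c3: "\<not> ?G" if "\<exists>K :: 'c topology. Hausdorff_space K \<and> compact_space K \<and>
      isometrically_isomorphic (C_space K) (whole :: ('e \<Rightarrow>\<^sub>L real) nspace)"
    using that by (elim exE conjE) (rule not_grothendieck_Lip0[OF predual_of_C_contains_l1[OF _ _ _ assms]])
  have c4: "\<not> ?G" if "\<exists>M :: 'b measure. sigma_finite_measure M \<and>
      isometrically_isomorphic (L1_space M) (whole :: 'e nspace)"
    using that by (elim exE conjE) (rule not_G[OF seminormed_L1 _ L1_dichotomy])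
  have c5: "\<not> ?G" if "infinite_dimensional TYPE('y) \<and>
      contains_copy_of (whole :: 'z nspace) c0_space \<and>
      isometrically_isomorphic (whole :: ('y \<Rightarrow>\<^sub>L 'z) nspace) (whole :: 'e nspace)"
    using that
    by (elim conjE) (rule not_grothendieck_if_contains_c0[OF seminormed_whole _ operators_contain_range])
  have c6: "\<not> ?G" if "infinite_dimensional TYPE('p) \<and> infinite_dimensional TYPE('q) \<and>
      infinite_dimensional TYPE('r) \<and> contains_copy_of (whole :: 'r nspace) c0_space \<and>
      isometrically_isomorphic (Bil_space :: ('p \<Rightarrow> 'q \<Rightarrow> 'r) nspace) (whole :: 'e nspace)"
    using that
    by (elim conjE) (rule not_grothendieck_if_contains_c0[OF seminormed_whole _ bilinear_maps_contain_range])
  have c7: "\<not> ?G" if "\<exists>(M :: 'm metric) e. e \<in> mspace M \<and>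
      iterated_dual TYPE('u) n (Lip0_space M e) (whole :: 'e nspace)"
    using that by (elim exE conjE) (rule not_G_dual[OF seminormed_Lip0 _ Lip0_dichotomy])
  have c8: "\<not> ?G" if "\<exists>(M :: 'm metric) e. e \<in> mspace M \<and>
      isometrically_isomorphic (lipschitz_free M e) (whole :: 'e nspace)"
    using that
    by (elim exE conjE) (rule not_G[OF seminormed_dual_subspace[OF seminormed_Lip0 dual_subspace_lipschitz_free]
          _ lipschitz_free_dichotomy])
  have c1': "\<not> ?G" if h: "\<exists>K :: 'c topology. Hausdorff_space K \<and> compact_space K \<and>
      isometrically_isomorphic (C_space K) (whole :: 'e nspace)"
  proof -
    obtain K :: "'c topology" where K: "Hausdorff_space K" "compact_space K"
      "isometrically_isomorphic (C_space K) (whole :: 'e nspace)"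
      using h by blast
    note C = C_space_eq_C0_space[OF K(2)]
    show ?thesis
      by (rule not_G[OF seminormed_C0 K(3)[unfolded C] linf_dichotomy_imp_l1_dichotomy[OF seminormed_C0
            C0_dichotomy[OF K(1) compact_imp_locally_compact_space[OF K(2)]]]])
  qed
  have c7': "\<not> ?G" if "\<exists>(M :: 'm metric) e. e \<in> mspace M \<and>
      isometrically_isomorphic (Lip0_space M e) (whole :: 'e nspace)"
    using that
    by (elim exE conjE) (rule not_G[OF seminormed_Lip0 _ linf_dichotomy_imp_l1_dichotomy[OF seminormed_Lip0
            Lip0_dichotomy]])
  show ?thesis
    by (intro conjI impI; elim disjE) (erule c1 c2 c3 c4 c5 c6 c7 c8 c1' c7')+
qed

end
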